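(* Let $d\ge1$. A homotopy circle action $\{\Delta_i\}_{i\ge 0}$ on a graded commutative associative algebra $(V,\mu)$ is of homotopical differential order at most $\frac{d+1}{d}$ if and only if $$X(\Delta)(f) = 0,\qquad \Delta=\sum_{i\ge0}\Delta_iz^i,$$ for the operad morphism $f\colon\mathrm{HyperCom}_d\to \mathcal{E}nd_V$ satisfying $f(\mu_2^{(d-1)})=\mu$ and $f(\mu_n^{(k)})=0$ unless $k=d(n-1)-1$.
   Context: Ground field of characteristic zero, Koszul sign rule. Homotopy circle action on a graded vector space $V$: operators $\Delta_i$ on $V$, $i\ge0$, $|\Delta_i|=2i-1$, with $\sum_{i=0}^n\Delta_i\Delta_{n-i}=0$ for all $n\ge 0$. An operator $T$ on a graded commutative associative algebra $V$ is of differential order at most $k$ if its Koszul brace $\langle -,\dots,-\rangle^{T}_{k+1}$ vanishes, where $\langle a_1,\dots,a_r\rangle_r^T=\sum_{\varnothing\ne J\subseteq\underline{r}}(-1)^{r-|J|}\,(\pm)\,T(a_J)\,a_{J^c}$, $a_J=\prod_{j\in J}a_j$, with Koszul signs $(\pm)$ (so order at most $1$ means derivation). A homotopy circle action is of homotopical differential order at most $\frac{d+1}{d}$ if each $\Delta_i$ is of differential order at most $\lfloor i/d\rfloor+1$. $\mathrm{HyperCom}_d$ is the homology operad of the Chen--Gibney--Krashen spaces (compactified moduli of configurations of points in $\mathbb{C}^d$ modulo translations and homotheties); algebraically, it is generated by totally symmetric operations $\mu_n^{(p)}$, $n\ge2$, $p\ge0$, of degree $2(d(n-1)-1-p)$ with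 the defining relations, for all $n\ge2$, $i\ne j\in\underline{n}$, $m\ge d$: $$\sum_{q\ge1}\sum_{\substack{S_1\sqcup \cdots\sqcup S_q=\underline{n}\\ S_1,\ldots,S_q\ne\varnothing,\ \{i,j\}\subseteq S_1}}\sum_{p_1+\cdots+p_q+q-1=m}\mu^{(p_q)}_{S_q\sqcup\{\star\}}\circ_\star\cdots\circ_\star\mu^{(p_2)}_{S_2\sqcup\{\star\}}\circ_\star\mu^{(p_1)}_{S_1}=0,$$ compositions being nested (each operation inserted in the slot $\star$ of the one to its left), where $\mu^{(p)}_S$ is $\mu^{(p)}_{|S|}$ with inputs labelled by $S$. It is concentrated in non-negative degrees. There is a unique operad morphism $f$ as in the claim. For an operad $\mathcal O$ and an operad morphism $f\colon\mathrm{HyperCom}_d\to\mathcal O$, an element $a=\sum_p r_pz^p\in\mathcal O(\underline 1)[[z]]$ defines an $f$-derivation $X(a)(f)=\sum_pX(r_pz^p)(f)\colon\mathrm{HyperCom}_d\to\mathcal O$ (that is, $E(u\circ_\star v)=E(u)\circ_\star f(v)\pm f(u)\circ_\star E(v)$) determined by its values on generators $$[X(rz^p)(f)](\mu_{n}^{(k)})=[r,f(\mu_n^{(k+p)})]+\sum_{q\ge1}\sum_{\substack{p_0+\cdots+p_q+q=p\\ S_0\sqcup\cdots\sqcup S_q=\underline{n}}} f(\mu^{(k+p_{q})}_{S_{q}\sqcup\{\star\}})\circ_\star f(\mu^{(p_{q-1})}_{S_{q-1}\sqcup\{\star\}})\circ_\star\cdots\circ_\star f(\mu^{(p_1)}_{S_1\sqcup\{\star\}})\circ_\star[r,f(\mu^{(p_0)}_{S_0})],$$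 with $|S_0|\ge2$, $S_1,\dots,S_q\ne\varnothing$, $p_i\ge0$, and $[r,u]=r\circ_1u-(-1)^{|r||u|}\sum_iu\circ_ir$. Here $\mathcal O=\mathcal{E}nd_V$ is the endomorphism operad. *)

theory Defs
  imports Complex_Main
    "HOL-Library.Multiset"
    "HOL-Library.Poly_Mapping"
    "HOL-Library.Groups_Big_Fun"
    "HOL-Combinatorics.Transposition"
begin

section \<open>Koszul signs\<close>

definition ksign :: "int \<Rightarrow> int \<Rightarrow> 'k::field" where
  "ksign i j = (if odd i \<and> odd j then - 1 else 1)"

text \<open>The Koszul sign of the unshuffle of a word with entries of degrees \<open>ds\<close> which moves the
  entries at the (0-based) positions in \<open>J\<close> to the front, keeping the relative orders.\<close>

definition front_sign :: "int list \<Rightarrow> nat set \<Rightarrow> 'k::field" where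
  "front_sign ds J =
     (\<Prod>(i, j) \<in> {(i, j). i < j \<and> j < length ds \<and> i \<notin> J \<and> j \<in> J}. ksign (ds ! i) (ds ! j))"


section \<open>Graded vector spaces and graded commutative algebras\<close>

text \<open>The whole type \<open>'v\<close> is the direct sum of the subspaces \<open>V i\<close>, \<open>i \<in> \<int>\<close>.\<close>

definition graded_vector_space ::
    "('k::field \<Rightarrow> 'v::ab_group_add \<Rightarrow> 'v) \<Rightarrow> (int \<Rightarrow> 'v set) \<Rightarrow> bool" where
  "graded_vector_space scale V \<longleftrightarrow>
     vector_space scale \<and>
     (\<forall>i. module.subspace scale (V i)) \<and>
     (\<forall>v. \<exists>!c. finite {i. c i \<noteq> 0} \<and> (\<forall>i. c i \<in> V i) \<and> v = (\<Sum>i | c i \<noteq> 0. c i))"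

definition homogeneous :: "(int \<Rightarrow> 'v set) \<Rightarrow> 'v \<Rightarrow> bool" where
  "homogeneous V a \<longleftrightarrow> (\<exists>i. a \<in> V i)"

text \<open>The degree of a homogeneous element; it is arbitrary for \<open>0\<close>, which is harmless since the
  degree is only used in Koszul signs multiplying multilinear expressions in the elements.\<close>

definition hdeg :: "(int \<Rightarrow> 'v set) \<Rightarrow> 'v \<Rightarrow> int" where
  "hdeg V a = (SOME i. a \<in> V i)"

definition homogeneous_operator ::
    "('k::field \<Rightarrow> 'v::ab_group_add \<Rightarrow> 'v) \<Rightarrow> (int \<Rightarrow> 'v set) \<Rightarrow> int \<Rightarrow> ('v \<Rightarrow> 'v) \<Rightarrow> bool" where
  "homogeneous_operator scale V e T \<longleftrightarrow>
     Vector_Spaces.linear scale scale T \<and> (\<forall>j. \<forall>a\<in>V j. T a \<in> V (j + e))"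

text \<open>No unit is required.\<close>

definition graded_comm_algebra ::
    "('k::field \<Rightarrow> 'v::ab_group_add \<Rightarrow> 'v) \<Rightarrow> (int \<Rightarrow> 'v set) \<Rightarrow> ('v \<Rightarrow> 'v \<Rightarrow> 'v) \<Rightarrow> bool" where
  "graded_comm_algebra scale V m \<longleftrightarrow>
     graded_vector_space scale V \<and>
     (\<forall>a. Vector_Spaces.linear scale scale (m a)) \<and>
     (\<forall>b. Vector_Spaces.linear scale scale (\<lambda>a. m a b)) \<and>
     (\<forall>i j. \<forall>a\<in>V i. \<forall>b\<in>V j. m a b \<in> V (i + j)) \<and>
     (\<forall>a b c. m (m a b) c = m a (m b c)) \<and>
     (\<forall>i j. \<forall>a\<in>V i. \<forall>b\<in>V j. m a b = scale (ksign i j) (m b a))"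

definition homotopy_circle_action ::
    "('k::field \<Rightarrow> 'v::ab_group_add \<Rightarrow> 'v) \<Rightarrow> (int \<Rightarrow> 'v set) \<Rightarrow> (nat \<Rightarrow> 'v \<Rightarrow> 'v) \<Rightarrow> bool" where
  "homotopy_circle_action scale V \<Delta> \<longleftrightarrow>
     (\<forall>i. homogeneous_operator scale V (2 * int i - 1) (\<Delta> i)) \<and>
     (\<forall>n v. (\<Sum>i\<le>n. \<Delta> i (\<Delta> (n - i) v)) = 0)"


section \<open>Koszul braces and differential orders\<close>

text \<open>The product of a non-empty word.\<close>

fun word_prod :: "('v \<Rightarrow> 'v \<Rightarrow> 'v) \<Rightarrow> 'v list \<Rightarrow> 'v" where
  "word_prod m [] = undefined"
| "word_prod m [a] = a"
| "word_prod m (a # b # xs) = m a (word_prod m (b # xs))"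

text \<open>Since algebras need not have units, the factor \<open>a\<^bsub>J\<^sup>c\<^esub>\<close> is omitted when \<open>J\<close> is everything.\<close>

definition koszul_brace ::
    "('k::field \<Rightarrow> 'v::ab_group_add \<Rightarrow> 'v) \<Rightarrow> (int \<Rightarrow> 'v set) \<Rightarrow> ('v \<Rightarrow> 'v \<Rightarrow> 'v) \<Rightarrow>
     ('v \<Rightarrow> 'v) \<Rightarrow> 'v list \<Rightarrow> 'v" where
  "koszul_brace scale V m T xs =
     (\<Sum>J \<in> {J. J \<subseteq> {..<length xs} \<and> J \<noteq> {}}.
        scale ((- 1) ^ (length xs - card J) * front_sign (map (hdeg V) xs) J)
          (if J = {..<length xs} then T (word_prod m xs)
           else m (T (word_prod m (nths xs J))) (word_prod m (nths xs (- J)))))"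

definition diff_order_at_most ::
    "('k::field \<Rightarrow> 'v::ab_group_add \<Rightarrow> 'v) \<Rightarrow> (int \<Rightarrow> 'v set) \<Rightarrow> ('v \<Rightarrow> 'v \<Rightarrow> 'v) \<Rightarrow>
     ('v \<Rightarrow> 'v) \<Rightarrow> nat \<Rightarrow> bool" where
  "diff_order_at_most scale V m T k \<longleftrightarrow>
     (\<forall>xs. length xs = k + 1 \<and> (\<forall>a\<in>set xs. homogeneous V a) \<longrightarrow> koszul_brace scale V m T xs = 0)"

text \<open>Homotopical differential order at most \<open>(d + 1) / d\<close>.\<close>

definition homotopical_diff_order ::
    "nat \<Rightarrow> ('k::field \<Rightarrow> 'v::ab_group_add \<Rightarrow> 'v) \<Rightarrow> (int \<Rightarrow> 'v set) \<Rightarrow> ('v \<Rightarrow> 'v \<Rightarrow> 'v) \<Rightarrow>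
     (nat \<Rightarrow> 'v \<Rightarrow> 'v) \<Rightarrow> bool" where
  "homotopical_diff_order d scale V m \<Delta> \<longleftrightarrow>
     (\<forall>i. diff_order_at_most scale V m (\<Delta> i) (i div d + 1))"


section \<open>Operads, morphisms and derivations\<close>

text \<open>The data of a graded operad, with operations labelled by finite sets of natural numbers:
  \<open>op_carr P S e\<close> is the degree \<open>e\<close> component of \<open>P(S)\<close>, the structure map \<open>op_comp P S T s\<close> is
  \<open>\<circ>\<^sub>s : P(S) \<otimes> P(T) \<rightarrow> P(S - {s} \<squnion> T)\<close>, and \<open>op_ren P S \<sigma> : P(S) \<rightarrow> P(\<sigma>(S))\<close> is the action of
  (the restriction to \<open>S\<close> of) a permutation \<open>\<sigma>\<close> of the natural numbers; each bijection between
  finite sets of natural numbers is such a restriction.\<close>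

record ('k, 'a) operad =
  op_carr :: "nat set \<Rightarrow> int \<Rightarrow> 'a set"
  op_zero :: "nat set \<Rightarrow> 'a"
  op_add :: "nat set \<Rightarrow> 'a \<Rightarrow> 'a \<Rightarrow> 'a"
  op_scale :: "nat set \<Rightarrow> 'k \<Rightarrow> 'a \<Rightarrow> 'a"
  op_unit :: "nat \<Rightarrow> 'a"
  op_comp :: "nat set \<Rightarrow> nat set \<Rightarrow> nat \<Rightarrow> 'a \<Rightarrow> 'a \<Rightarrow> 'a"
  op_ren :: "nat set \<Rightarrow> (nat \<Rightarrow> nat) \<Rightarrow> 'a \<Rightarrow> 'a"

definition composable :: "nat set \<Rightarrow> nat set \<Rightarrow> nat \<Rightarrow> bool" where
  "composable S T s \<longleftrightarrow> finite S \<and> finite T \<and> s \<in> S \<and> (S - {s}) \<inter> T = {}"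

text \<open>Families of linear maps \<open>P(S) \<rightarrow> Q(S)\<close> of degree \<open>\<delta>\<close>, compatible with relabellings.\<close>

definition species_map ::
    "('k, 'a) operad \<Rightarrow> ('k, 'b) operad \<Rightarrow> int \<Rightarrow> (nat set \<Rightarrow> 'a \<Rightarrow> 'b) \<Rightarrow> bool" where
  "species_map P Q \<delta> E \<longleftrightarrow>
     (\<forall>S e. finite S \<longrightarrow>
        (\<forall>u \<in> op_carr P S e. E S u \<in> op_carr Q S (e + \<delta>)) \<and>
        (\<forall>u \<in> op_carr P S e. \<forall>v \<in> op_carr P S e.
           E S (op_add P S u v) = op_add Q S (E S u) (E S v)) \<and>
        (\<forall>c. \<forall>u \<in> op_carr P S e. E S (op_scale P S c u) = op_scale Q S c (E S u)) \<and>
        (\<forall>\<sigma>. bij \<sigma> \<longrightarrow> (\<forall>u \<in> op_carr P S e.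
           E (\<sigma> ` S) (op_ren P S \<sigma> u) = op_ren Q S \<sigma> (E S u))))"

definition operad_hom ::
    "('k, 'a) operad \<Rightarrow> ('k, 'b) operad \<Rightarrow> (nat set \<Rightarrow> 'a \<Rightarrow> 'b) \<Rightarrow> bool" where
  "operad_hom P Q f \<longleftrightarrow>
     species_map P Q 0 f \<and>
     (\<forall>s. f {s} (op_unit P s) = op_unit Q s) \<and>
     (\<forall>S T s e e'. composable S T s \<longrightarrow>
        (\<forall>u \<in> op_carr P S e. \<forall>v \<in> op_carr P T e'.
           f (S - {s} \<union> T) (op_comp P S T s u v) = op_comp Q S T s (f S u) (f T v)))"

text \<open>\<open>f\<close>-derivations of degree \<open>\<delta>\<close>:
  \<open>E(u \<circ>\<^sub>s v) = E(u) \<circ>\<^sub>s f(v) + (-1)\<^bsup>\<delta>|u|\<^esup> f(u) \<circ>\<^sub>s E(v)\<close>.\<close>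

definition operad_derivation ::
    "('k::field, 'a) operad \<Rightarrow> ('k, 'b) operad \<Rightarrow> (nat set \<Rightarrow> 'a \<Rightarrow> 'b) \<Rightarrow> int \<Rightarrow>
     (nat set \<Rightarrow> 'a \<Rightarrow> 'b) \<Rightarrow> bool" where
  "operad_derivation P Q f \<delta> E \<longleftrightarrow>
     species_map P Q \<delta> E \<and>
     (\<forall>S T s e e'. composable S T s \<longrightarrow>
        (\<forall>u \<in> op_carr P S e. \<forall>v \<in> op_carr P T e'.
           E (S - {s} \<union> T) (op_comp P S T s u v) =
             op_add Q (S - {s} \<union> T)
               (op_comp Q S T s (E S u) (f T v))
               (op_scale Q (S - {s} \<union> T) (ksign \<delta> e) (op_comp Q S T s (f S u) (E T v)))))"

text \<open>\<open>nested P T v [(S\<^sub>1, u\<^sub>1), \<dots>, (S\<^sub>q, u\<^sub>q)]\<close> is \<open>u\<^sub>q \<circ>\<^sub>\<star> \<cdots> \<circ>\<^sub>\<star> u\<^sub>1 \<circ>\<^sub>\<star> v\<close> for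
  \<open>v \<in> P(T)\<close> and \<open>u\<^sub>i \<in> P(S\<^sub>i \<squnion> {\<star>})\<close>. Throughout, the label \<open>\<star>\<close> is \<open>0\<close>, and \<open>{1..n}\<close> is the
  standard set of \<open>n\<close> labels.\<close>

fun nested :: "('k, 'a) operad \<Rightarrow> nat set \<Rightarrow> 'a \<Rightarrow> (nat set \<times> 'a) list \<Rightarrow> 'a" where
  "nested P T v [] = v"
| "nested P T v ((S, u) # us) = nested P (S \<union> T) (op_comp P (insert 0 S) T 0 u v) us"

definition ordered_partition :: "nat set \<Rightarrow> nat set list \<Rightarrow> bool" where
  "ordered_partition A Ss \<longleftrightarrow>
     (\<forall>S\<in>set Ss. S \<noteq> {}) \<and>
     (\<forall>i j. i < j \<and> j < length Ss \<longrightarrow> Ss ! i \<inter> Ss ! j = {}) \<and>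
     \<Union>(set Ss) = A"


section \<open>The endomorphism operad\<close>

text \<open>An element of \<open>End\<^sub>V(S) = Hom(V\<^bsup>\<otimes>S\<^esup>, V)\<close> is a function of words \<open>(s\<^sub>1, a\<^sub>1) \<dots> (s\<^sub>n, a\<^sub>n)\<close>,
  where \<open>s\<^sub>1, \<dots>, s\<^sub>n\<close> is an enumeration of \<open>S\<close> and the \<open>a\<^sub>i\<close> are homogeneous. It is multilinear,
  and transforms by the Koszul sign if the word is permuted: the tensor product over the set \<open>S\<close> is
  the unordered one. On all other lists such a function is set to \<open>0\<close>.\<close>

definition is_word :: "(int \<Rightarrow> 'v set) \<Rightarrow> nat set \<Rightarrow> (nat \<times> 'v) list \<Rightarrow> bool" where
  "is_word V S w \<longleftrightarrow>
     distinct (map fst w) \<and> set (map fst w) = S \<and> (\<forall>x\<in>set w. homogeneous V (snd x))"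

definition word_degs :: "(int \<Rightarrow> 'v set) \<Rightarrow> (nat \<times> 'v) list \<Rightarrow> int list" where
  "word_degs V w = map (\<lambda>x. hdeg V (snd x)) w"

definition end_carr ::
    "('k::field \<Rightarrow> 'v::ab_group_add \<Rightarrow> 'v) \<Rightarrow> (int \<Rightarrow> 'v set) \<Rightarrow> nat set \<Rightarrow> int \<Rightarrow>
     ((nat \<times> 'v) list \<Rightarrow> 'v) set" where
  "end_carr scale V S e =
     {u. (\<forall>w. \<not> is_word V S w \<longrightarrow> u w = 0) \<and>
         (\<forall>w. is_word V S w \<longrightarrow> u w \<in> V (e + sum_list (word_degs V w))) \<and>
         (\<forall>w w' s i a b. a \<in> V i \<and> b \<in> V i \<and> is_word V S (w @ (s, a) # w') \<longrightarrow>
            u (w @ (s, a + b) # w') = u (w @ (s, a) # w') + u (w @ (s, b) # w')) \<and>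
         (\<forall>w w' s c a. is_word V S (w @ (s, a) # w') \<longrightarrow>
            u (w @ (s, scale c a) # w') = scale c (u (w @ (s, a) # w'))) \<and>
         (\<forall>w w' x y. is_word V S (w @ x # y # w') \<longrightarrow>
            u (w @ x # y # w') =
              scale (ksign (hdeg V (snd x)) (hdeg V (snd y))) (u (w @ y # x # w')))}"

text \<open>To evaluate \<open>u \<circ>\<^sub>s v\<close> on a word, move the arguments of \<open>v\<close> to the front. As \<open>v\<close> is then
  inserted in the first slot of \<open>u\<close>, it is not moved past any argument.\<close>

definition end_comp ::
    "('k::field \<Rightarrow> 'v::ab_group_add \<Rightarrow> 'v) \<Rightarrow> (int \<Rightarrow> 'v set) \<Rightarrow> nat set \<Rightarrow> nat set \<Rightarrow> nat \<Rightarrow>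
     ((nat \<times> 'v) list \<Rightarrow> 'v) \<Rightarrow> ((nat \<times> 'v) list \<Rightarrow> 'v) \<Rightarrow> (nat \<times> 'v) list \<Rightarrow> 'v" where
  "end_comp scale V S T s u v = (\<lambda>w.
     if is_word V (S - {s} \<union> T) w
     then scale (front_sign (word_degs V w) {j. j < length w \<and> fst (w ! j) \<in> T})
            (u ((s, v (filter (\<lambda>x. fst x \<in> T) w)) # filter (\<lambda>x. fst x \<notin> T) w))
     else 0)"

definition End_operad ::
    "('k::field \<Rightarrow> 'v::ab_group_add \<Rightarrow> 'v) \<Rightarrow> (int \<Rightarrow> 'v set) \<Rightarrow>
     ('k, (nat \<times> 'v) list \<Rightarrow> 'v) operad" where
  "End_operad scale V =
     \<lparr> op_carr = end_carr scale V,
       op_zero = (\<lambda>S w. 0),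
       op_add = (\<lambda>S u v w. u w + v w),
       op_scale = (\<lambda>S c u w. scale c (u w)),
       op_unit = (\<lambda>s w. if is_word V {s} w then snd (hd w) else 0),
       op_comp = end_comp scale V,
       op_ren = (\<lambda>S \<sigma> u w. u (map (\<lambda>x. (inv \<sigma> (fst x), snd x)) w)) \<rparr>"

text \<open>An operator as an element of \<open>End\<^sub>V({1})\<close>, and the product as an element of
  \<open>End\<^sub>V({1, 2})\<close>; by graded commutativity, the order of the factors agrees with the Koszul rule.\<close>

definition end_unary :: "(int \<Rightarrow> 'v::zero set) \<Rightarrow> ('v \<Rightarrow> 'v) \<Rightarrow> (nat \<times> 'v) list \<Rightarrow> 'v" where
  "end_unary V T = (\<lambda>w. if is_word V {1} w then T (snd (hd w)) else 0)"

definition end_product :: "(int \<Rightarrow> 'v::zero set) \<Rightarrow> ('v \<Rightarrow> 'v \<Rightarrow> 'v) \<Rightarrow> (nat \<times> 'v) list \<Rightarrow> 'v" where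
  "end_product V m = (\<lambda>w. if is_word V {1, 2} w then m (snd (w ! 0)) (snd (w ! 1)) else 0)"

text \<open>\<open>[r, u] = r \<circ>\<^sub>1 u - (-1)\<^bsup>|r||u|\<^esup> \<Sum>\<^sub>i u \<circ>\<^sub>i r\<close> for \<open>r \<in> End\<^sub>V({1})\<close> of degree \<open>er\<close> and
  \<open>u \<in> End\<^sub>V(S)\<close> of degree \<open>eu\<close>; for \<open>u \<circ>\<^sub>i r\<close>, the input of \<open>r\<close> is relabelled \<open>i\<close>.\<close>

definition end_bracket ::
    "('k::field \<Rightarrow> 'v::ab_group_add \<Rightarrow> 'v) \<Rightarrow> (int \<Rightarrow> 'v set) \<Rightarrow> int \<Rightarrow> int \<Rightarrow> nat set \<Rightarrow>
     ((nat \<times> 'v) list \<Rightarrow> 'v) \<Rightarrow> ((nat \<times> 'v) list \<Rightarrow> 'v) \<Rightarrow> (nat \<times> 'v) list \<Rightarrow> 'v" where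
  "end_bracket scale V er eu S r u = (\<lambda>w.
     end_comp scale V {1} S 1 r u w
     - scale (ksign er eu)
         (\<Sum>i\<in>S. end_comp scale V S {i} i u
                   (op_ren (End_operad scale V) {1} (transpose 1 i) r) w))"


section \<open>The operad HyperCom\<close>

text \<open>Tree monomials: \<open>Node p ts\<close> is the operation \<open>\<mu>\<^sub>n\<^bsup>(p)\<^esup>\<close> with \<open>n = size ts\<close>, applied to
  \<open>ts\<close>. Since the operations are totally symmetric of even degree, the arguments form a multiset and
  no signs occur in the free operad.\<close>

datatype 'l hctree = Leaf 'l | Node nat "'l hctree multiset"

primrec hc_leaves :: "'l hctree \<Rightarrow> 'l multiset" where
  "hc_leaves (Leaf x) = {#x#}"
| "hc_leaves (Node p ts) = \<Sum>\<^sub># (image_mset hc_leaves ts)"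

primrec hc_wf :: "'l hctree \<Rightarrow> bool" where
  "hc_wf (Leaf x) = True"
| "hc_wf (Node p ts) = (2 \<le> size ts \<and> (\<forall>b \<in># image_mset hc_wf ts. b))"

definition gen_deg :: "nat \<Rightarrow> nat \<Rightarrow> nat \<Rightarrow> int" where
  "gen_deg d n p = 2 * (int d * (int n - 1) - 1 - int p)"

primrec hc_deg :: "nat \<Rightarrow> 'l hctree \<Rightarrow> int" where
  "hc_deg d (Leaf x) = 0"
| "hc_deg d (Node p ts) = gen_deg d (size ts) p + \<Sum>\<^sub># (image_mset (hc_deg d) ts)"

primrec graft :: "'l \<Rightarrow> 'l hctree \<Rightarrow> 'l hctree \<Rightarrow> 'l hctree" where
  "graft s t' (Leaf x) = (if x = s then t' else Leaf x)"
| "graft s t' (Node p ts) = Node p (image_mset (graft s t') ts)"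

definition hc_trees :: "nat set \<Rightarrow> nat hctree set" where
  "hc_trees S = {t. finite S \<and> hc_wf t \<and> hc_leaves t = mset_set S}"

text \<open>The free operad: linear combinations of tree monomials.\<close>

definition free_comp ::
    "nat \<Rightarrow> (nat hctree \<Rightarrow>\<^sub>0 'k::field) \<Rightarrow> (nat hctree \<Rightarrow>\<^sub>0 'k) \<Rightarrow> (nat hctree \<Rightarrow>\<^sub>0 'k)" where
  "free_comp s u v =
     (\<Sum>t \<in> Poly_Mapping.keys u. \<Sum>t' \<in> Poly_Mapping.keys v.
        Poly_Mapping.single (graft s t' t) (Poly_Mapping.lookup u t * Poly_Mapping.lookup v t'))"

definition free_ren ::
    "(nat \<Rightarrow> nat) \<Rightarrow> (nat hctree \<Rightarrow>\<^sub>0 'k::field) \<Rightarrow> (nat hctree \<Rightarrow>\<^sub>0 'k)" where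
  "free_ren \<sigma> u =
     (\<Sum>t \<in> Poly_Mapping.keys u. Poly_Mapping.single (map_hctree \<sigma> t) (Poly_Mapping.lookup u t))"

definition Free_operad :: "nat \<Rightarrow> ('k::field, nat hctree \<Rightarrow>\<^sub>0 'k) operad" where
  "Free_operad d =
     \<lparr> op_carr = (\<lambda>S e. {u. Poly_Mapping.keys u \<subseteq> {t \<in> hc_trees S. hc_deg d t = e}}),
       op_zero = (\<lambda>S. 0),
       op_add = (\<lambda>S. (+)),
       op_scale = (\<lambda>S c. Poly_Mapping.map ((*) c)),
       op_unit = (\<lambda>s. Poly_Mapping.single (Leaf s) 1),
       op_comp = (\<lambda>S T. free_comp),
       op_ren = (\<lambda>S. free_ren) \<rparr>"

text \<open>The generator \<open>\<mu>\<^sub>S\<^bsup>(p)\<^esup>\<close>.\<close>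

definition free_gen :: "nat set \<Rightarrow> nat \<Rightarrow> (nat hctree \<Rightarrow>\<^sub>0 'k::field)" where
  "free_gen S p = Poly_Mapping.single (Node p (image_mset Leaf (mset_set S))) 1"

text \<open>The sum on the left-hand side of the defining relations; \<open>S1\<close>, \<open>p1\<close> are \<open>S\<^sub>1\<close>, \<open>p\<^sub>1\<close>,
  and \<open>L\<close> is the list \<open>(S\<^sub>2, p\<^sub>2), \<dots>, (S\<^sub>q, p\<^sub>q)\<close> of length \<open>q - 1\<close>.\<close>

definition hc_relation ::
    "nat \<Rightarrow> nat \<Rightarrow> nat \<Rightarrow> nat \<Rightarrow> nat \<Rightarrow> (nat hctree \<Rightarrow>\<^sub>0 'k::field)" where
  "hc_relation d n i j m =
     (\<Sum>(S1, p1, L) \<in> {(S1, p1, L :: (nat set \<times> nat) list).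
          ordered_partition {1..n} (S1 # map fst L) \<and> {i, j} \<subseteq> S1 \<and>
          p1 + sum_list (map snd L) + length L = m}.
        nested (Free_operad d) S1 (free_gen S1 p1)
          (map (\<lambda>(S, p). (S, free_gen (insert 0 S) p)) L))"

text \<open>The operadic ideal generated by the defining relations; \<open>hc_ideal d S\<close> is its component in
  the arity \<open>S\<close>.\<close>

definition free_space :: "nat set \<Rightarrow> (nat hctree \<Rightarrow>\<^sub>0 'k::field) set" where
  "free_space S = {u. Poly_Mapping.keys u \<subseteq> hc_trees S}"

inductive hc_ideal :: "nat \<Rightarrow> nat set \<Rightarrow> (nat hctree \<Rightarrow>\<^sub>0 'k::field) \<Rightarrow> bool" for d :: nat where
  rel: "n \<ge> 2 \<Longrightarrow> i \<in> {1..n} \<Longrightarrow> j \<in> {1..n} \<Longrightarrow> i \<noteq> j \<Longrightarrow> m \<ge> d \<Longrightarrow>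
          hc_ideal d {1..n} (hc_relation d n i j m)"
| zero: "finite S \<Longrightarrow> hc_ideal d S 0"
| add: "hc_ideal d S u \<Longrightarrow> hc_ideal d S v \<Longrightarrow> hc_ideal d S (u + v)"
| scale: "hc_ideal d S u \<Longrightarrow> hc_ideal d S (Poly_Mapping.map ((*) c) u)"
| ren: "hc_ideal d S u \<Longrightarrow> bij \<sigma> \<Longrightarrow> hc_ideal d (\<sigma> ` S) (free_ren \<sigma> u)"
| comp_left: "composable S T s \<Longrightarrow> hc_ideal d S u \<Longrightarrow> v \<in> free_space T \<Longrightarrow>
          hc_ideal d (S - {s} \<union> T) (free_comp s u v)"
| comp_right: "composable S T s \<Longrightarrow> u \<in> free_space S \<Longrightarrow> hc_ideal d T v \<Longrightarrow>
          hc_ideal d (S - {s} \<union> T) (free_comp s u v)"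

definition hc_class ::
    "nat \<Rightarrow> nat set \<Rightarrow> (nat hctree \<Rightarrow>\<^sub>0 'k::field) \<Rightarrow> (nat hctree \<Rightarrow>\<^sub>0 'k) set" where
  "hc_class d S u = {v \<in> free_space S. hc_ideal d S (v - u)}"

text \<open>The quotient of the free operad by the ideal. The unions over representatives are unions
  over equal cosets.\<close>

definition HyperCom :: "nat \<Rightarrow> ('k::field, (nat hctree \<Rightarrow>\<^sub>0 'k) set) operad" where
  "HyperCom d =
     \<lparr> op_carr = (\<lambda>S e. hc_class d S ` op_carr (Free_operad d) S e),
       op_zero = (\<lambda>S. hc_class d S 0),
       op_add = (\<lambda>S A B. \<Union>u\<in>A. \<Union>v\<in>B. hc_class d S (u + v)),
       op_scale = (\<lambda>S c A. \<Union>u\<in>A. hc_class d S (Poly_Mapping.map ((*) c) u)),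
       op_unit = (\<lambda>s. hc_class d {s} (Poly_Mapping.single (Leaf s) 1)),
       op_comp = (\<lambda>S T s A B. \<Union>u\<in>A. \<Union>v\<in>B. hc_class d (S - {s} \<union> T) (free_comp s u v)),
       op_ren = (\<lambda>S \<sigma> A. \<Union>u\<in>A. hc_class d (\<sigma> ` S) (free_ren \<sigma> u)) \<rparr>"

definition hc_gen :: "nat \<Rightarrow> nat set \<Rightarrow> nat \<Rightarrow> (nat hctree \<Rightarrow>\<^sub>0 'k::field) set" where
  "hc_gen d S p = hc_class d S (free_gen S p)"


section \<open>The derivation X\<close>

text \<open>The value of \<open>X(r z\<^sup>p)(f)\<close> on the generator \<open>\<mu>\<^sub>n\<^bsup>(k)\<^esup>\<close>, for \<open>r \<in> End\<^sub>V({1})\<close> of degree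
  \<open>er\<close>. In the sum, \<open>L\<close> is the list \<open>(S\<^sub>1, p\<^sub>1), \<dots>, (S\<^sub>q\<^sub>-\<^sub>1, p\<^sub>q\<^sub>-\<^sub>1)\<close> of length \<open>q - 1\<close>, and
  \<open>Sq\<close>, \<open>pq\<close> are \<open>S\<^sub>q\<close>, \<open>p\<^sub>q\<close>.\<close>

definition X_value ::
    "nat \<Rightarrow> ('k::field \<Rightarrow> 'v::ab_group_add \<Rightarrow> 'v) \<Rightarrow> (int \<Rightarrow> 'v set) \<Rightarrow>
     (nat set \<Rightarrow> (nat hctree \<Rightarrow>\<^sub>0 'k) set \<Rightarrow> (nat \<times> 'v) list \<Rightarrow> 'v) \<Rightarrow>
     int \<Rightarrow> ((nat \<times> 'v) list \<Rightarrow> 'v) \<Rightarrow> nat \<Rightarrow> nat \<Rightarrow> nat \<Rightarrow> (nat \<times> 'v) list \<Rightarrow> 'v" where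
  "X_value d scale V f er r p n k = (\<lambda>w.
     end_bracket scale V er (gen_deg d n (k + p)) {1..n} r (f {1..n} (hc_gen d {1..n} (k + p))) w
     + (\<Sum>(S0, p0, L, Sq, pq) \<in> {(S0, p0, L :: (nat set \<times> nat) list, Sq, pq).
            ordered_partition {1..n} (S0 # map fst L @ [Sq]) \<and> card S0 \<ge> 2 \<and>
            p0 + sum_list (map snd L) + pq + (length L + 1) = p}.
          nested (End_operad scale V) S0
            (end_bracket scale V er (gen_deg d (card S0) p0) S0 r (f S0 (hc_gen d S0 p0)))
            (map (\<lambda>(S, j). (S, f (insert 0 S) (hc_gen d (insert 0 S) j))) L
              @ [(Sq, f (insert 0 Sq) (hc_gen d (insert 0 Sq) (k + pq)))]) w))"

text \<open>For a family of operators with \<open>|\<Delta>\<^sub>p| = 2p - 1\<close>, \<open>X(\<Delta>)(f) = \<Sum>\<^sub>p X(\<Delta>\<^sub>p z\<^sup>p)(f)\<close> is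
  the \<open>f\<close>-derivation, of degree \<open>-1\<close>, with the given values on generators. It is encoded by the set
  of all \<open>f\<close>-derivations with these values, normalised to be \<open>0\<close> off the carrier of HyperCom, so that
  \<open>X(\<Delta>)(f) = E\<close> reads \<open>X_derivations d scale V f \<Delta> = {E}\<close>: the derivation
  determined by these values exists, is unique, and is \<open>E\<close>. The sum over \<open>p\<close> is a finite one, as
  HyperCom is concentrated in non-negative degrees.\<close>

definition X_derivations ::
    "nat \<Rightarrow> ('k::field \<Rightarrow> 'v::ab_group_add \<Rightarrow> 'v) \<Rightarrow> (int \<Rightarrow> 'v set) \<Rightarrow>
     (nat set \<Rightarrow> (nat hctree \<Rightarrow>\<^sub>0 'k) set \<Rightarrow> (nat \<times> 'v) list \<Rightarrow> 'v) \<Rightarrow> (nat \<Rightarrow> 'v \<Rightarrow> 'v) \<Rightarrow>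
     (nat set \<Rightarrow> (nat hctree \<Rightarrow>\<^sub>0 'k) set \<Rightarrow> (nat \<times> 'v) list \<Rightarrow> 'v) set" where
  "X_derivations d scale V f \<Delta> =
     {E. operad_derivation (HyperCom d) (End_operad scale V) f (- 1) E \<and>
         (\<forall>S u. infinite S \<or> (\<forall>e. u \<notin> op_carr (HyperCom d) S e) \<longrightarrow> E S u = (\<lambda>w. 0)) \<and>
         (\<forall>n\<ge>2. \<forall>k. E {1..n} (hc_gen d {1..n} k) =
            (\<lambda>w. Sum_any (\<lambda>p. X_value d scale V f (2 * int p - 1) (end_unary V (\<Delta> p)) p n k w)))}"

end

theory Submission
  imports Defs
begin

text \<open>The morphism \<open>f\<close> kills all generators except the operations \<open>\<mu>\<^sub>n\<^bsup>(d(n-1)-1)\<^esup>\<close>, which have degree 0,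
and the relations force \<open>f\<close> to send these to \<open>(-1)\<^sup>n\<close> times the \<open>n\<close>-fold product (\<open>f_gen\<close>): for
\<open>n \<ge> 3\<close>, the relation with \<open>m = d(n-1)-1\<close> says that a sum of products of the coefficients over ordered
partitions vanishes, and \<open>(-1)\<^sup>n\<close> solves this recursion because the ordered partitions of a finite set
\<open>M\<close>, counted with the sign \<open>(-1)\<^bsup>length\<^esup>\<close>, number \<open>(-1)\<^bsup>|M|\<^esup>\<close> (\<open>sum_ordered_partitions_sign\<close>).

Hence only \<open>p = d(n-1)-1-k\<close> contributes to the value of \<open>X(\<Delta>)(f)\<close> on \<open>\<mu>\<^sub>n\<^bsup>(k)\<^esup>\<close>. Write \<open>D = \<Delta>\<^sub>p\<close> and
\<open>A = {1..n}\<close>, let \<open>h(B) = \<plusminus> D(a\<^sub>B) a\<^bsub>A-B\<^esub>\<close>, and let \<open>G(B) = h(B) - \<Sum>\<^bsub>i\<in>B\<^esub> h({i})\<close>, which is the bracket of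
\<open>D\<close> with the product of the \<open>a\<^sub>i\<close>, \<open>i \<in> B\<close>, multiplied by the remaining arguments. For a fixed first block \<open>S\<^sub>0\<close>
and a fixed last block \<open>Q\<close> the middle blocks contribute only a sign, and the value becomes
\<open>(-1)\<^sup>n (G(A) - \<Sum>\<^sub>Q MG(A - Q))\<close>, where \<open>M\<close> is the Moebius transform over subsets and \<open>Q\<close> runs over the subsets
with \<open>d|Q| > k\<close>. As \<open>G(A)\<close> is the sum of all \<open>MG(B)\<close>, the value is \<open>(-1)\<^sup>n\<close> times the sum of the \<open>MG(B)\<close> with
\<open>d|A - B| \<le> k\<close> (\<open>X_sum_eq\<close>). Such sets have at least two elements, and there \<open>MG(B) = Mh(B)\<close> is, up to a
Koszul sign, the Koszul brace of the \<open>a\<^sub>i\<close>, \<open>i \<in> B\<close>, multiplied by the remaining arguments.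

The sets \<open>B\<close> that survive have more than \<open>\<lfloor>p/d\<rfloor> + 1\<close> elements, so the bound on the order of \<open>\<Delta>\<^sub>p\<close> makes all
values vanish, because with the braces of one length all longer ones vanish as well (\<open>higher_braces_vanish\<close>).
Conversely, \<open>n = \<lfloor>p/d\<rfloor> + 2\<close> and \<open>k = d - 1 - (p mod d)\<close> give the same \<open>p\<close>, and then only \<open>B = A\<close> survives: the
value is the brace of length \<open>\<lfloor>p/d\<rfloor> + 2\<close> up to a sign. Finally, a derivation is zero as soon as its values on
the generators are, because each tree monomial is an iterated composite of generators (\<open>derivation_zero\<close>).

For the signs, arguments are kept in words of labelled letters, and every expression in sight is written as a sum
over sets of labels of one fixed word. All sign cancellations are then instances of one cocycle identity
for unshuffles (\<open>unshuffle_sign_cocycle\<close>) and of the compatibility of products with unshuffles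
(\<open>mul_word_unshuffle\<close>, \<open>word_prod_unshuffle\<close>).\<close>

section \<open>Koszul signs of unshuffles\<close>

definition pass_sign :: "int \<Rightarrow> (nat \<times> int \<times> 'v) list \<Rightarrow> 'k::field" where
  "pass_sign i w = (\<Prod>x\<leftarrow>w. ksign i (fst (snd x)))"

text \<open>Words are lists of labelled letters. Sets of labels, unlike sets of positions, keep their
  meaning when a word is restricted to some of its letters.\<close>

abbreviation on :: "nat set \<Rightarrow> (nat \<times> 'a) list \<Rightarrow> (nat \<times> 'a) list" where
  "on T w \<equiv> filter (\<lambda>x. fst x \<in> T) w"

abbreviation elts :: "(nat \<times> int \<times> 'v) list \<Rightarrow> 'v list" where
  "elts w \<equiv> map (\<lambda>x. snd (snd x)) w"

abbreviation labels :: "(nat \<times> 'a) list \<Rightarrow> nat set" where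
  "labels w \<equiv> fst ` set w"

text \<open>The sign that \<open>front_sign\<close> computes from positions, for words of triples of a label, a degree
  and a letter. The degree is carried along because the degree \<open>hdeg\<close> of a product of letters is arbitrary when
  this product happens to be 0.\<close>

fun unshuffle_sign :: "nat set \<Rightarrow> (nat \<times> int \<times> 'v) list \<Rightarrow> 'k::field" where
  "unshuffle_sign T [] = 1"
| "unshuffle_sign T (x # w) =
     (if fst x \<in> T then 1 else pass_sign (fst (snd x)) (on T w)) * unshuffle_sign T w"

lemma ksign_add_left: "(ksign (i + j) l :: 'k::field) = ksign i l * ksign j l"
  by (auto simp: ksign_def)

lemma pass_sign_simps [simp]:
  "pass_sign i [] = (1 :: 'k::field)"
  "pass_sign i (x # w) = ksign i (fst (snd x)) * (pass_sign i w :: 'k)"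
  "pass_sign i (v @ w) = pass_sign i v * (pass_sign i w :: 'k)"
  by (simp_all add: pass_sign_def)

lemma pass_sign_add: "(pass_sign (i + j) w :: 'k::field) = pass_sign i w * pass_sign j w"
  by (induction w) (simp_all add: ksign_add_left)

lemma pass_sign_split:
  assumes "A \<subseteq> T"
  shows "(pass_sign i (on T w) :: 'k::field) = pass_sign i (on A w) * pass_sign i (on T (on (- A) w))"
  using assms by (induction w) auto

lemma unshuffle_sign_all: "labels w \<subseteq> T \<Longrightarrow> unshuffle_sign T w = (1 :: 'k::field)"
  by (induction w) auto

text \<open>Moving \<open>T\<close> to the front and then \<open>A\<close> to the front of \<open>T\<close> rearranges the word in the same way as
  moving \<open>A\<close> to the front and then \<open>T - A\<close> to the front of the rest, so both sides collect the same inversions.\<close>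

lemma unshuffle_sign_cocycle:
  assumes "A \<subseteq> T"
  shows "(unshuffle_sign T w :: 'k::field) * unshuffle_sign A (on T w)
    = unshuffle_sign A w * unshuffle_sign T (on (- A) w)"
  using assms
proof (induction w)
  case (Cons x w)
  have *: "filter (\<lambda>x. fst x \<in> A) (on T w) = on A w"
    using Cons.prems by (auto intro!: filter_cong simp: subset_iff)
  consider "fst x \<in> A" | "fst x \<in> T" "fst x \<notin> A" | "fst x \<notin> T" by blast
  then show ?case
  proof cases
    case 1
    then show ?thesis using Cons by auto
  next
    case 2
    have "unshuffle_sign T w * (c * unshuffle_sign A (on T w))
      = c * (unshuffle_sign T w * unshuffle_sign A (on T w))" for c :: 'k
      by (simp add: mult_ac)
    with 2 show ?thesis using Cons * by (simp add: mult_ac)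
  next
    case 3
    then have "fst x \<notin> A" using Cons.prems by auto
    with 3 show ?thesis using Cons * pass_sign_split[OF Cons.prems, of "fst (snd x)" w, where 'k='k]
      by (simp add: mult_ac)
  qed
qed simp

lemma prod_over_positions:
  "(\<Prod>j | j < length w \<and> P (w ! j). g (w ! j)) = (\<Prod>x\<leftarrow>filter P w. g x :: 'k::comm_monoid_mult)"
proof (induction w)
  case (Cons x w)
  have "{j. j < length (x # w) \<and> P ((x # w) ! j)}
     = (if P x then {0} else {}) \<union> Suc ` {j. j < length w \<and> P (w ! j)}"
    by (auto simp: image_iff less_Suc_eq_0_disj split: if_splits)
  then show ?case
    using Cons by (simp add: prod.union_disjoint prod.reindex o_def)
qed simp

lemma front_sign_Cons:
  "(front_sign (i # ds) J :: 'k::field)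
    = (if 0 \<in> J then 1 else \<Prod>j | j < length ds \<and> Suc j \<in> J. ksign i (ds ! j))
      * front_sign ds {j. Suc j \<in> J}"
proof -
  define K where "K = {(a, b). a < b \<and> b < length ds \<and> Suc a \<notin> J \<and> Suc b \<in> J}"
  define L where "L = (if 0 \<in> J then {} else (\<lambda>j. (0 :: nat, Suc j)) ` {j. j < length ds \<and> Suc j \<in> J})"
  have fin: "finite K" "finite L"
    by (rule finite_subset[of _ "{..<length ds} \<times> {..<length ds}"])
      (auto simp: K_def L_def)
  have *: "{(a, b). a < b \<and> b < length (i # ds) \<and> a \<notin> J \<and> b \<in> J} = L \<union> map_prod Suc Suc ` K"
    (is "?S = _")
  proof
    show "?S \<subseteq> L \<union> map_prod Suc Suc ` K"
    proof
      fix z assume "z \<in> ?S"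
      then obtain a b where z: "z = (a, b)" "a < b" "b < length (i # ds)" "a \<notin> J" "b \<in> J" by auto
      then obtain b' where b: "b = Suc b'" by (cases b) auto
      show "z \<in> L \<union> map_prod Suc Suc ` K"
      proof (cases a)
        case 0
        then show ?thesis using z b by (auto simp: L_def)
      next
        case (Suc a')
        then have "(a', b') \<in> K" using z b by (auto simp: K_def)
        then show ?thesis using z b Suc by (force simp: image_iff)
      qed
    qed
    show "L \<union> map_prod Suc Suc ` K \<subseteq> ?S"
      by (auto simp: L_def K_def split: if_splits)
  qed
  have "L \<inter> map_prod Suc Suc ` K = {}" by (auto simp: L_def split: if_splits)
  then have "(front_sign (i # ds) J :: 'k)
     = (\<Prod>(a, b)\<in>L. ksign ((i # ds) ! a) ((i # ds) ! b)) *
       (\<Prod>(a, b)\<in>map_prod Suc Suc ` K. ksign ((i # ds) ! a) ((i # ds) ! b))"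
    unfolding front_sign_def * using fin by (subst prod.union_disjoint) auto
  moreover have "(\<Prod>(a, b)\<in>map_prod Suc Suc ` K. ksign ((i # ds) ! a) ((i # ds) ! b) :: 'k)
     = front_sign ds {j. Suc j \<in> J}"
    unfolding front_sign_def
    by (subst prod.reindex) (auto simp: K_def inj_on_def intro!: prod.cong)
  moreover have "(\<Prod>(a, b)\<in>L. ksign ((i # ds) ! a) ((i # ds) ! b) :: 'k)
     = (if 0 \<in> J then 1 else \<Prod>j | j < length ds \<and> Suc j \<in> J. ksign i (ds ! j))"
    by (auto simp: L_def prod.reindex inj_on_def)
  ultimately show ?thesis by simp
qed

text \<open>Both signs charge the first letter, if it stays behind, for exactly the letters that overtake it.\<close>

lemma front_sign_eq_unshuffle_sign:
  "(front_sign (map (\<lambda>x. fst (snd x)) w) {j. j < length w \<and> fst (w ! j) \<in> T} :: 'k::field)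
    = unshuffle_sign T w"
proof (induction w)
  case Nil
  then show ?case by (simp add: front_sign_def)
next
  case (Cons x w)
  have "(\<Prod>j | j < length w \<and> fst (w ! j) \<in> T. ksign i (map (\<lambda>x. fst (snd x)) w ! j) :: 'k)
     = pass_sign i (on T w)" for i
    unfolding pass_sign_def by (subst prod_over_positions[symmetric]) (auto intro!: prod.cong)
  then show ?case
    using Cons by (simp add: front_sign_Cons)
qed

section \<open>Graded commutative algebras\<close>

locale graded_comm_alg =
  fixes scale :: "'k::field_char_0 \<Rightarrow> 'v::ab_group_add \<Rightarrow> 'v"
    and V :: "int \<Rightarrow> 'v set"
    and m :: "'v \<Rightarrow> 'v \<Rightarrow> 'v"
  assumes graded_comm_algebra: "graded_comm_algebra scale V m"
begin

sublocale vector_space scale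
  using graded_comm_algebra unfolding graded_comm_algebra_def graded_vector_space_def by blast

lemma V_subspace: "subspace (V i)"
  using graded_comm_algebra unfolding graded_comm_algebra_def graded_vector_space_def by blast

text \<open>Otherwise \<open>a\<close> would have two decompositions into homogeneous components, concentrated in the
  degrees \<open>i\<close> and \<open>j\<close>.\<close>

lemma V_unique:
  assumes "a \<in> V i" "a \<in> V j" "a \<noteq> 0"
  shows "i = j"
proof (rule ccontr)
  assume "i \<noteq> j"
  define c where "c i = (\<lambda>l. if l = i then a else 0)" for i :: int
  have "\<exists>!c. finite {i. c i \<noteq> 0} \<and> (\<forall>i. c i \<in> V i) \<and> a = (\<Sum>i | c i \<noteq> 0. c i)"
    using graded_comm_algebra unfolding graded_comm_algebra_def graded_vector_space_def by blast
  moreover have "finite {l. c i l \<noteq> 0} \<and> (\<forall>l. c i l \<in> V l) \<and> a = (\<Sum>l | c i l \<noteq> 0. c i l)"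
    if "a \<in> V i" for i
  proof -
    have "{l. c i l \<noteq> 0} = {i}" using assms by (auto simp: c_def)
    then show ?thesis using that by (simp add: c_def subspace_0[OF V_subspace])
  qed
  ultimately have "c i = c j" using assms by blast
  then have "c i i = c j i" by simp
  then show False using \<open>i \<noteq> j\<close> assms by (simp add: c_def)
qed

lemma m_linear: "Vector_Spaces.linear scale scale (m a)" "Vector_Spaces.linear scale scale (\<lambda>a. m a b)"
  using graded_comm_algebra unfolding graded_comm_algebra_def by blast+

lemma m_simps [simp]:
  "m (a + b) c = m a c + m b c" "m (scale r a) c = scale r (m a c)" "m 0 c = 0"
  "m c (a + b) = m c a + m c b" "m c (scale r a) = scale r (m c a)" "m c 0 = 0"
proof -
  show add: "m (a + b) c = m a c + m b c" "m c (a + b) = m c a + m c b" for a b c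
    using m_linear unfolding Vector_Spaces.linear_iff by blast+
  show "m (scale r a) c = scale r (m a c)" "m c (scale r a) = scale r (m c a)"
    using m_linear unfolding Vector_Spaces.linear_iff by blast+
  show "m 0 c = 0" "m c 0 = 0"
    using add(1)[of 0 0 c] add(2)[of c 0 0] by simp_all
qed

lemma m_assoc: "m (m a b) c = m a (m b c)"
  using graded_comm_algebra unfolding graded_comm_algebra_def by blast

lemma m_commute: "a \<in> V i \<Longrightarrow> b \<in> V j \<Longrightarrow> m a b = scale (ksign i j) (m b a)"
  using graded_comm_algebra unfolding graded_comm_algebra_def by blast

lemma m_in_V: "a \<in> V i \<Longrightarrow> b \<in> V j \<Longrightarrow> m a b \<in> V (i + j)"
  using graded_comm_algebra unfolding graded_comm_algebra_def by blast

lemma hdeg_in: "homogeneous V a \<Longrightarrow> a \<in> V (hdeg V a)"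
  unfolding homogeneous_def hdeg_def by (rule someI_ex)

lemma hdeg_eq: "a \<in> V i \<Longrightarrow> a \<noteq> 0 \<Longrightarrow> hdeg V a = i"
  using hdeg_in V_unique homogeneous_def by metis

lemma homogeneous_scale: "homogeneous V a \<Longrightarrow> homogeneous V (scale c a)"
  unfolding homogeneous_def using subspace_scale[OF V_subspace] by blast

section \<open>Moebius inversion over the subsets of a finite set\<close>

lemma sum_Pow_insert:
  fixes g :: "'l set \<Rightarrow> 'c::comm_monoid_add"
  assumes "finite B" "x \<notin> B"
  shows "(\<Sum>A\<in>Pow (insert x B). g A) = (\<Sum>A\<in>Pow B. g A) + (\<Sum>A\<in>Pow B. g (insert x A))"
proof -
  have "(\<Sum>A\<in>Pow (insert x B). g A) = (\<Sum>A\<in>Pow B. g A) + (\<Sum>A\<in>insert x ` Pow B. g A)"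
    unfolding Pow_insert using assms by (intro sum.union_disjoint) auto
  also have "(\<Sum>A\<in>insert x ` Pow B. g A) = (\<Sum>A\<in>Pow B. g (insert x A))"
    using assms by (subst sum.reindex) (auto simp: inj_on_def)
  finally show ?thesis .
qed

definition moebius :: "('l set \<Rightarrow> 'v) \<Rightarrow> 'l set \<Rightarrow> 'v" where
  "moebius h B = (\<Sum>A\<in>Pow B. scale ((- 1) ^ card (B - A)) (h A))"

lemma moebius_empty [simp]: "moebius h {} = h {}"
  by (simp add: moebius_def)

text \<open>The Moebius transform is an iterated difference operator, with one difference for each element of the
  set. The inductions over \<open>B\<close> only use this recursion.\<close>

lemma moebius_insert:
  assumes "finite B" "x \<notin> B"
  shows "moebius h (insert x B) = moebius (\<lambda>A. h (insert x A) - h A) B"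
proof -
  have 1: "card (insert x B - A) = Suc (card (B - A))" "insert x B - insert x A = B - A"
    if "A \<in> Pow B" for A
  proof -
    have "insert x B - A = insert x (B - A)" "x \<notin> B - A" "finite (B - A)"
      using that assms by auto
    then show "card (insert x B - A) = Suc (card (B - A))" by simp
    show "insert x B - insert x A = B - A" using assms by auto
  qed
  have "moebius h (insert x B) = (\<Sum>A\<in>Pow B. scale ((- 1) ^ card (insert x B - A)) (h A))
      + (\<Sum>A\<in>Pow B. scale ((- 1) ^ card (insert x B - insert x A)) (h (insert x A)))"
    unfolding moebius_def by (rule sum_Pow_insert[OF assms])
  also have "\<dots> = (\<Sum>A\<in>Pow B. - (scale ((- 1) ^ card (B - A)) (h A)))
      + (\<Sum>A\<in>Pow B. scale ((- 1) ^ card (B - A)) (h (insert x A)))"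
    using 1 by (intro arg_cong2[where f="(+)"] sum.cong) (simp_all add: scale_minus_left)
  also have "\<dots> = moebius (\<lambda>A. h (insert x A) - h A) B"
    unfolding moebius_def by (simp add: scale_right_diff_distrib sum_subtractf sum_negf)
  finally show ?thesis .
qed

lemma moebius_cong: "(\<And>A. A \<subseteq> B \<Longrightarrow> h A = h' A) \<Longrightarrow> moebius h B = moebius h' B"
  unfolding moebius_def by (intro sum.cong) auto

lemma moebius_diff: "moebius (\<lambda>A. h A - h' A) B = moebius h B - moebius h' B"
  unfolding moebius_def by (simp add: scale_right_diff_distrib sum_subtractf)

lemma moebius_zero [simp]: "moebius (\<lambda>A. 0) B = 0"
  unfolding moebius_def by simp

lemma moebius_const:
  assumes "finite B" "B \<noteq> {}"
  shows "moebius (\<lambda>A. c) B = 0"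
proof -
  from assms obtain x where "x \<in> B" by auto
  then have "B = insert x (B - {x})" by auto
  then show ?thesis using moebius_insert[of "B - {x}" x] assms by fastforce
qed

lemma sum_moebius:
  assumes "finite S"
  shows "(\<Sum>B\<in>Pow S. moebius h B) = h S"
  using assms
proof (induction S arbitrary: h)
  case (insert x S)
  have "(\<Sum>B\<in>Pow (insert x S). moebius h B)
     = (\<Sum>B\<in>Pow S. moebius h B) + (\<Sum>B\<in>Pow S. moebius h (insert x B))"
    using insert by (intro sum_Pow_insert)
  also have "(\<Sum>B\<in>Pow S. moebius h (insert x B)) = (\<Sum>B\<in>Pow S. moebius (\<lambda>A. h (insert x A) - h A) B)"
    using insert.hyps by (intro sum.cong moebius_insert) (auto dest: finite_subset)
  finally show ?case
    using insert.IH by simp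
qed simp

text \<open>The first difference turns an additive function into a constant, and the second one kills it.\<close>

lemma moebius_additive:
  assumes "finite B" "card B \<ge> 2"
  shows "moebius (\<lambda>A. \<Sum>i\<in>A. c i) B = 0"
proof -
  from assms obtain x where x: "x \<in> B" by fastforce
  then have B: "B = insert x (B - {x})" by auto
  have "card (B - {x}) \<ge> 1" using assms x by simp
  then have ne: "B - {x} \<noteq> {}" by force
  have "moebius (\<lambda>A. \<Sum>i\<in>A. c i) (insert x (B - {x}))
     = moebius (\<lambda>A. (\<Sum>i\<in>insert x A. c i) - (\<Sum>i\<in>A. c i)) (B - {x})"
    using assms by (intro moebius_insert) auto
  also have "\<dots> = moebius (\<lambda>A. c x) (B - {x})"
  proof (rule moebius_cong)
    fix A assume A: "A \<subseteq> B - {x}"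
    then have "finite A" "x \<notin> A" using assms by (auto dest: finite_subset)
    then show "(\<Sum>i\<in>insert x A. c i) - (\<Sum>i\<in>A. c i) = c x" by simp
  qed
  also have "\<dots> = 0" using assms ne by (intro moebius_const) auto
  finally show ?thesis using B by simp
qed

text \<open>Passing from \<open>D\<close> applied to a product to the bracket of \<open>D\<close> with the product subtracts
  a function that is additive in the set of factors. This is invisible to Koszul braces of length at least 2.\<close>

lemma moebius_minus_linear_part:
  assumes "finite B" "h {} = 0"
  shows "moebius (\<lambda>A. h A - (\<Sum>i\<in>A. h {i})) B = (if card B \<ge> 2 then moebius h B else 0)"
proof (cases "card B \<ge> 2")
  case True
  then show ?thesis using assms by (simp add: moebius_diff moebius_additive)
next
  case False
  then have "card B = 0 \<or> card B = 1" by linarith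
  then consider "B = {}" | x where "B = {x}"
    using assms by (auto simp: card_1_singleton_iff)
  then show ?thesis
  proof cases
    case 2
    then show ?thesis using moebius_insert[of "{}" x] assms by simp
  qed (simp add: assms)
qed

section \<open>Products of words with Koszul signs\<close>

definition typed :: "(nat \<times> int \<times> 'v) list \<Rightarrow> bool" where
  "typed w \<longleftrightarrow> (\<forall>x\<in>set w. snd (snd x) \<in> V (fst (snd x)))"

lemma typed_simps [simp]:
  "typed []" "typed (x # w) \<longleftrightarrow> snd (snd x) \<in> V (fst (snd x)) \<and> typed w"
  by (auto simp: typed_def)

lemma typed_filter: "typed w \<Longrightarrow> typed (filter P w)"
  by (simp add: typed_def)

text \<open>Since algebras need not have units, products with a possibly empty word of further factors
  are formed by multiplying a given element successively from the right. This covers the summand of the Koszul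
  brace in which no factor is left over.\<close>

definition mul_word :: "'v \<Rightarrow> (nat \<times> int \<times> 'v) list \<Rightarrow> 'v" where
  "mul_word y w = foldl m y (elts w)"

lemma mul_word_simps [simp]: "mul_word y [] = y" "mul_word y (x # w) = mul_word (m y (snd (snd x))) w"
  by (simp_all add: mul_word_def)

lemma mul_word_scale: "mul_word (scale c y) w = scale c (mul_word y w)"
  by (induction w arbitrary: y) simp_all

lemma mul_word_add: "mul_word (y + z) w = mul_word y w + mul_word z w"
  by (induction w arbitrary: y z) simp_all

lemma mul_word_zero [simp]: "mul_word 0 w = 0"
  by (induction w) simp_all

lemma mul_word_zero_entry: "0 \<in> set (elts w) \<Longrightarrow> mul_word y w = 0"
  by (induction w arbitrary: y) auto

lemma word_prod_Cons: "word_prod m (a # xs) = foldl m a xs"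
proof (induction xs arbitrary: a)
  case (Cons b xs)
  have "m a (foldl m b xs) = foldl m (m a b) xs" for b
    by (induction xs arbitrary: b) (simp_all add: m_assoc)
  then show ?case using Cons by simp
qed simp

lemma word_prod_elts_Cons: "word_prod m (elts (x # w)) = mul_word (snd (snd x)) w"
  unfolding list.map word_prod_Cons mul_word_def ..

definition word_deg :: "(nat \<times> int \<times> 'v) list \<Rightarrow> int" where
  "word_deg w = (\<Sum>x\<leftarrow>w. fst (snd x))"

lemma mul_word_in_V: "y \<in> V i \<Longrightarrow> typed w \<Longrightarrow> mul_word y w \<in> V (i + word_deg w)"
proof (induction w arbitrary: y i)
  case (Cons x w)
  have "m y (snd (snd x)) \<in> V (i + fst (snd x))" using Cons.prems by (intro m_in_V) auto
  from Cons.IH[OF this] Cons.prems show ?case by (simp add: word_deg_def add.assoc)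
qed (simp add: word_deg_def)

lemma word_prod_in_V:
  assumes "typed w" "w \<noteq> []"
  shows "word_prod m (elts w) \<in> V (word_deg w)"
proof (cases w)
  case (Cons x u)
  have "mul_word (snd (snd x)) u \<in> V (fst (snd x) + word_deg u)"
    using assms Cons by (intro mul_word_in_V) auto
  then show ?thesis unfolding Cons word_prod_elts_Cons by (simp add: word_deg_def)
qed (use assms in simp)

lemma homogeneous_mul_word:
  "homogeneous V y \<Longrightarrow> typed w \<Longrightarrow> homogeneous V (mul_word y w)"
  unfolding homogeneous_def using mul_word_in_V by blast

lemma mul_word_word_prod: "w \<noteq> [] \<Longrightarrow> mul_word y w = m y (word_prod m (elts w))"
proof (cases w)
  case (Cons x u)
  have "mul_word (m y a) u = m y (mul_word a u)" for a
    by (induction u arbitrary: a) (simp_all add: m_assoc)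
  then show ?thesis using Cons word_prod_elts_Cons[of x u] by simp
qed simp

lemma word_prod_zero_entry:
  assumes "0 \<in> set (elts w)"
  shows "word_prod m (elts w) = 0"
proof (cases w)
  case (Cons x u)
  have "snd (snd x) = 0 \<or> 0 \<in> set (elts u)" using assms Cons by auto
  then have "mul_word (snd (snd x)) u = 0"
    using mul_word_zero_entry[of u] by auto
  then show ?thesis unfolding Cons word_prod_elts_Cons .
qed (use assms in simp)

lemma mul_word_move:
  assumes "typed (x # w)"
  shows "mul_word (m y (snd (snd x))) w
    = scale (pass_sign (fst (snd x)) w) (m (mul_word y w) (snd (snd x)))"
  using assms
proof (induction w arbitrary: y)
  case (Cons z w)
  obtain s i a t j b where xz: "x = (s, i, a)" "z = (t, j, b)" by (metis prod.exhaust)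
  have "m (m y a) b = scale (ksign i j) (m (m y b) a)"
    using Cons.prems m_commute[of a i b j] by (simp add: xz m_assoc)
  then have "mul_word (m y a) (z # w) = scale (ksign i j) (mul_word (m (m y b) a) w)"
    by (simp add: xz mul_word_scale)
  also have "\<dots> = scale (ksign i j) (scale (pass_sign i w) (m (mul_word (m y b) w) a))"
    using Cons.IH[of "m y b"] Cons.prems by (simp add: xz)
  finally show ?case by (simp add: xz)
qed simp

text \<open>Induction on \<open>w\<close>: a first letter outside \<open>T\<close> has to be carried past the letters in \<open>T\<close>.\<close>

lemma mul_word_unshuffle:
  assumes "typed w"
  shows "mul_word y w = scale (unshuffle_sign T w) (mul_word (mul_word y (on T w)) (on (- T) w))"
  using assms
proof (induction w arbitrary: y)
  case (Cons x w)
  show ?case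
  proof (cases "fst x \<in> T")
    case True
    then show ?thesis using Cons by simp
  next
    case False
    have "mul_word (m y (snd (snd x))) (on T w)
       = scale (pass_sign (fst (snd x)) (on T w)) (m (mul_word y (on T w)) (snd (snd x)))"
      using Cons.prems by (intro mul_word_move) (simp add: typed_filter)
    then show ?thesis
      using Cons False by (simp add: mul_word_scale mult.commute)
  qed
qed simp

text \<open>Without a unit, \<open>mul_word_move\<close> applies only after the first letter of \<open>u\<close> has been
  exchanged with \<open>x\<close> by hand.\<close>

lemma m_word_prod_commute:
  assumes "typed (x # u)" "u \<noteq> []"
  shows "m (snd (snd x)) (word_prod m (elts u))
    = scale (pass_sign (fst (snd x)) u) (m (word_prod m (elts u)) (snd (snd x)))"
proof -
  obtain y t where u: "u = y # t" using assms(2) by (cases u) auto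
  have c: "m (snd (snd x)) (snd (snd y))
     = scale (ksign (fst (snd x)) (fst (snd y))) (m (snd (snd y)) (snd (snd x)))"
    using assms(1) unfolding u by (intro m_commute) auto
  have "m (snd (snd x)) (word_prod m (elts (y # t))) = mul_word (m (snd (snd x)) (snd (snd y))) t"
    using mul_word_word_prod[of "y # t" "snd (snd x)"] by simp
  also have "\<dots> = scale (ksign (fst (snd x)) (fst (snd y))) (mul_word (m (snd (snd y)) (snd (snd x))) t)"
    unfolding c mul_word_scale ..
  also have "\<dots> = scale (ksign (fst (snd x)) (fst (snd y)))
      (scale (pass_sign (fst (snd x)) t) (m (mul_word (snd (snd y)) t) (snd (snd x))))"
    using assms(1) u by (subst mul_word_move) auto
  finally show ?thesis unfolding u by (simp add: word_prod_elts_Cons del: list.map)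
qed

lemma m_mul_word: "m z (mul_word y w) = mul_word (m z y) w"
  by (induction w arbitrary: y) (simp_all add: m_assoc)

text \<open>The analogue of \<open>mul_word_unshuffle\<close> when there is no element \<open>y\<close> to start from.\<close>

lemma word_prod_unshuffle:
  assumes "typed w" "on T w \<noteq> []"
  shows "word_prod m (elts w)
    = scale (unshuffle_sign T w) (mul_word (word_prod m (elts (on T w))) (on (- T) w))"
  using assms
proof (induction w)
  case (Cons x w)
  show ?case
  proof (cases "fst x \<in> T")
    case True
    then show ?thesis
      using mul_word_unshuffle[of w "snd (snd x)" T] Cons.prems
      by (simp add: word_prod_Cons mul_word_def del: word_prod.simps)
  next
    case False
    then have ne: "on T w \<noteq> []" using Cons.prems by simp
    then have w: "w \<noteq> []" by auto
    have a: "word_prod m (elts (x # w)) = m (snd (snd x)) (word_prod m (elts w))"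
      unfolding word_prod_elts_Cons by (rule mul_word_word_prod[OF w])
    have "typed (x # on T w)" using Cons.prems by (simp add: typed_filter)
    from m_word_prod_commute[OF this ne] show ?thesis
      using False Cons.IH[OF _ ne] Cons.prems unfolding a
      by (simp add: m_mul_word mul_word_scale mult.commute)
  qed
qed simp

text \<open>If an operation with the inputs \<open>T\<close> takes the value \<open>y\<close> on the letters of \<open>w\<close> labelled by \<open>T\<close>, then
  this is the value on \<open>w\<close> of its composite with the product that multiplies it by all the other letters.\<close>

definition extend :: "nat set \<Rightarrow> (nat \<times> int \<times> 'v) list \<Rightarrow> 'v \<Rightarrow> 'v" where
  "extend T w y = scale (unshuffle_sign T w) (mul_word y (on (- T) w))"

lemma extend_scale: "extend T w (scale c y) = scale c (extend T w y)"
  by (simp add: extend_def mul_word_scale mult.commute)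

lemma extend_add: "extend T w (y + z) = extend T w y + extend T w z"
  by (simp add: extend_def mul_word_add scale_right_distrib)

lemma extend_zero [simp]: "extend T w 0 = 0"
  by (simp add: extend_def)

lemma extend_sum: "extend T w (\<Sum>i\<in>I. y i) = (\<Sum>i\<in>I. extend T w (y i))"
  by (induction I rule: infinite_finite_induct) (simp_all add: extend_add)

lemma extend_diff: "extend T w (y - z) = extend T w y - extend T w z"
  using extend_add[of T w "y - z" z] by simp

lemma on_on: "A \<subseteq> T \<Longrightarrow> on A (on T w) = on A w"
  by (auto intro!: filter_cong)

text \<open>The remaining letters may be multiplied in two stages: the signs agree by the cocycle identity, the
  products by \<open>mul_word_unshuffle\<close> for the letters outside \<open>A\<close>.\<close>

lemma extend_extend:
  assumes "typed w" "A \<subseteq> T"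
  shows "extend T w (extend A (on T w) y) = extend A w y"
proof -
  have *: "on (- T) (on (- A) w) = on (- T) w" "on T (on (- A) w) = on (- A) (on T w)"
    using assms(2) by (auto intro!: filter_cong)
  have "mul_word y (on (- A) w)
     = scale (unshuffle_sign T (on (- A) w)) (mul_word (mul_word y (on (- A) (on T w))) (on (- T) w))"
    using mul_word_unshuffle[of "on (- A) w" y T] assms(1) * by (simp add: typed_filter)
  then show ?thesis
    using unshuffle_sign_cocycle[OF assms(2), of w, where 'k='k]
    by (simp add: extend_def mul_word_scale mult.commute)
qed

lemma extend_all:
  assumes "labels w \<subseteq> T"
  shows "extend T w y = y"
proof -
  have "on (- T) w = []" using assms by (force simp: filter_empty_conv)
  then show ?thesis by (simp add: extend_def unshuffle_sign_all[OF assms])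
qed

text \<open>The summand of the Koszul brace of \<open>D\<close> in which \<open>D\<close> is applied to the letters labelled by \<open>A\<close>, up to
  the factor \<open>\<plusminus>1\<close> that depends only on the cardinality of \<open>A\<close>. The value 0 for empty \<open>A\<close> lets sums range over all sets of labels.\<close>

definition op_term :: "('v \<Rightarrow> 'v) \<Rightarrow> (nat \<times> int \<times> 'v) list \<Rightarrow> nat set \<Rightarrow> 'v" where
  "op_term D w A = (if A = {} then 0 else extend A w (D (word_prod m (elts (on A w)))))"

lemma op_term_empty [simp]: "op_term D w {} = 0"
  by (simp add: op_term_def)

lemma extend_op_term:
  assumes "typed w" "A \<subseteq> T"
  shows "extend T w (op_term D (on T w) A) = op_term D w A"
  unfolding op_term_def on_on[OF assms(2)] by (simp add: extend_extend[OF assms])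

text \<open>The brace of the letters in \<open>T\<close>, multiplied by the other letters, is the Moebius transform of
  the terms of the whole word. So products with braces of subwords need not be expanded.\<close>

lemma extend_moebius_op_term:
  assumes "typed w"
  shows "extend T w (moebius (op_term D (on T w)) T) = moebius (op_term D w) T"
  unfolding moebius_def extend_sum
  by (intro sum.cong) (auto simp: extend_scale extend_op_term[OF assms])

definition with_degrees :: "(nat \<times> 'v) list \<Rightarrow> (nat \<times> int \<times> 'v) list" where
  "with_degrees w = map (\<lambda>x. (fst x, hdeg V (snd x), snd x)) w"

lemma with_degrees_simps [simp]:
  "map fst (with_degrees w) = map fst w"
  "elts (with_degrees w) = map snd w"
  "map (\<lambda>x. fst (snd x)) (with_degrees w) = word_degs V w"
  "length (with_degrees w) = length w"
  by (simp_all add: with_degrees_def o_def word_degs_def)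

lemma labels_with_degrees [simp]: "labels (with_degrees w) = labels w"
  by (force simp: with_degrees_def)

lemma on_with_degrees: "with_degrees (on T w) = on T (with_degrees w)"
  by (simp add: with_degrees_def filter_map o_def)

lemma typed_with_degrees: "(\<forall>x\<in>set w. homogeneous V (snd x)) \<Longrightarrow> typed (with_degrees w)"
  by (auto simp: with_degrees_def typed_def hdeg_in)

lemma front_sign_with_degrees:
  "(front_sign (word_degs V w) {j. j < length w \<and> fst (w ! j) \<in> T} :: 'k)
     = unshuffle_sign T (with_degrees w)"
proof -
  have "{j. j < length w \<and> fst (w ! j) \<in> T}
     = {j. j < length (with_degrees w) \<and> fst (with_degrees w ! j) \<in> T}"
    by (auto simp: with_degrees_def)
  then show ?thesis
    using front_sign_eq_unshuffle_sign[of "with_degrees w" T, where 'k='k] by simp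
qed

end

section \<open>Koszul braces as Moebius transforms\<close>

lemma labels_at_positions:
  assumes "A \<subseteq> labels w"
  shows "(\<lambda>j. fst (w ! j)) ` {j. j < length w \<and> fst (w ! j) \<in> A} = A"
proof -
  have "x \<in> (\<lambda>j. fst (w ! j)) ` {j. j < length w \<and> fst (w ! j) \<in> A}" if "x \<in> A" for x
  proof -
    from that assms obtain y where "y \<in> set w" "x = fst y" by auto
    then obtain j where "j < length w" "fst (w ! j) = x" by (auto simp: in_set_conv_nth)
    then show ?thesis using that by auto
  qed
  then show ?thesis by auto
qed

lemma inj_on_label_at:
  assumes "distinct (map fst w)"
  shows "inj_on (\<lambda>j. fst (w ! j)) {..<length w}"
proof (rule inj_onI)
  fix i j assume "i \<in> {..<length w}" "j \<in> {..<length w}" "fst (w ! i) = fst (w ! j)"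
  then show "i = j" using nth_eq_iff_index_eq[OF assms, of i j] by simp
qed

lemma bij_betw_positions:
  assumes "distinct (map fst w)"
  shows "bij_betw (\<lambda>A. {j. j < length w \<and> fst (w ! j) \<in> A}) (Pow (labels w)) (Pow {..<length w})"
proof (rule bij_betw_byWitness[where f' = "\<lambda>J. (\<lambda>j. fst (w ! j)) ` J"])
  show "\<forall>A\<in>Pow (labels w). (\<lambda>j. fst (w ! j)) ` {j. j < length w \<and> fst (w ! j) \<in> A} = A"
    using labels_at_positions by blast
  show "\<forall>J\<in>Pow {..<length w}. {j. j < length w \<and> fst (w ! j) \<in> (\<lambda>j. fst (w ! j)) ` J} = J"
    using inj_on_label_at[OF assms] by (auto simp: inj_on_def)
  show "(\<lambda>A. {j. j < length w \<and> fst (w ! j) \<in> A}) ` Pow (labels w) \<subseteq> Pow {..<length w}"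
    by auto
  show "(\<lambda>J. (\<lambda>j. fst (w ! j)) ` J) ` Pow {..<length w} \<subseteq> Pow (labels w)"
    by auto
qed

context graded_comm_alg
begin

lemma koszul_brace_eq_moebius_hdeg:
  assumes "distinct (map fst w)" "\<forall>x\<in>set w. fst (snd x) = hdeg V (snd (snd x))"
  shows "koszul_brace scale V m D (elts w) = moebius (op_term D w) (labels w)"
proof -
  let ?pos = "\<lambda>A. {j. j < length w \<and> fst (w ! j) \<in> A}"
  define F where "F J = (if J = {} then 0 else
        scale ((- 1) ^ (length (elts w) - card J) * front_sign (map (hdeg V) (elts w)) J)
          (if J = {..<length (elts w)} then D (word_prod m (elts w))
           else m (D (word_prod m (nths (elts w) J))) (word_prod m (nths (elts w) (- J)))))" for J
  have hd: "map (hdeg V) (elts w) = map (\<lambda>x. fst (snd x)) w" using assms(2) by simp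
  have bij: "bij_betw ?pos (Pow (labels w)) (Pow {..<length w})"
    by (rule bij_betw_positions[OF assms(1)])
  have card_labels: "card (labels w) = length w"
    using assms(1) by (metis distinct_card length_map list.set_map)
  have "koszul_brace scale V m D (elts w) = (\<Sum>J\<in>Pow {..<length w}. F J)"
    unfolding koszul_brace_def
    by (rule sum.mono_neutral_cong_left) (auto simp: F_def)
  also have "\<dots> = (\<Sum>A\<in>Pow (labels w). F (?pos A))"
    using sum.reindex_bij_betw[OF bij, of F] by simp
  also have "\<dots> = moebius (op_term D w) (labels w)"
    unfolding moebius_def
  proof (rule sum.cong[OF refl])
    fix A assume A: "A \<in> Pow (labels w)"
    have inj: "inj_on ?pos (Pow (labels w))" using bij by (simp add: bij_betw_def)
    have empty: "?pos A = {} \<longleftrightarrow> A = {}" using inj_on_eq_iff[OF inj A, of "{}"] by auto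
    have full: "?pos A = {..<length w} \<longleftrightarrow> A = labels w"
      using inj_on_eq_iff[OF inj A, of "labels w"] by (auto simp: lessThan_def)
    have nths1: "nths (elts w) (?pos A) = elts (on A w)"
      by (simp add: nths_map filter_eq_nths)
    have nths2: "nths (elts w) (- ?pos A) = elts (on (- A) w)"
    proof -
      have "nths w (- ?pos A) = nths w {j. j < length w \<and> fst (w ! j) \<in> - A}"
        unfolding nths_def by (rule arg_cong[where f="map fst"], rule filter_cong[OF refl])
          (auto simp: set_zip)
      then show ?thesis by (simp add: nths_map filter_eq_nths)
    qed
    have "card (?pos A) = card A"
    proof -
      have "inj_on (\<lambda>j. fst (w ! j)) (?pos A)"
        by (rule inj_on_subset[OF inj_on_label_at[OF assms(1)]]) auto
      from card_image[OF this] show ?thesis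
        using labels_at_positions[of A w] A by simp
    qed
    then have card: "length (elts w) - card (?pos A) = card (labels w - A)"
      using A card_labels by (simp add: card_Diff_subset finite_subset)
    have sign: "(front_sign (map (hdeg V) (elts w)) (?pos A) :: 'k) = unshuffle_sign A w"
      unfolding hd by (rule front_sign_eq_unshuffle_sign)
    show "F (?pos A) = scale ((- 1) ^ card (labels w - A)) (op_term D w A)"
    proof (cases "A = {}")
      case True
      then show ?thesis by (simp add: F_def)
    next
      case False
      let ?x = "if ?pos A = {..<length (elts w)} then D (word_prod m (elts w))
           else m (D (word_prod m (nths (elts w) (?pos A)))) (word_prod m (nths (elts w) (- ?pos A)))"
      have x: "scale (unshuffle_sign A w) ?x = extend A w (D (word_prod m (elts (on A w))))"
      proof (cases "A = labels w")
        case True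
        moreover have "on (labels w) w = w" "on (- labels w) w = []"
          by (auto simp: filter_id_conv filter_empty_conv)
        ultimately show ?thesis using full by (simp add: extend_def)
      next
        case False
        then have "on (- A) w \<noteq> []" using A by (auto simp: filter_empty_conv)
        then show ?thesis
          using False full unfolding extend_def nths1 nths2
          by (simp add: mul_word_word_prod)
      qed
      have ne: "?pos A \<noteq> {}" using False empty by blast
      have "F (?pos A) = scale ((- 1) ^ card (labels w - A) * unshuffle_sign A w) ?x"
        unfolding F_def card sign by (rule if_not_P[OF ne])
      also have "\<dots> = scale ((- 1) ^ card (labels w - A)) (extend A w (D (word_prod m (elts (on A w)))))"
        by (simp only: scale_scale[symmetric] x)
      finally show ?thesis using False by (simp add: op_term_def)
    qed
  qed
  finally show ?thesis .
qed

lemma op_term_zero_entry: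
  assumes "D 0 = 0" "0 \<in> set (elts w)"
  shows "op_term D w A = 0"
proof -
  from assms(2) obtain x where "x \<in> set w" "snd (snd x) = 0" by auto
  then have "0 \<in> set (elts (on A w)) \<or> 0 \<in> set (elts (on (- A) w))" by force
  then have "D (word_prod m (elts (on A w))) = 0 \<or> mul_word y (on (- A) w) = 0" for y
    using assms(1) word_prod_zero_entry mul_word_zero_entry by metis
  then show ?thesis unfolding op_term_def extend_def by (metis mul_word_zero scale_zero_right)
qed

text \<open>A degree attached to a letter can differ from \<open>hdeg\<close> only if the letter is 0, and then both sides
  vanish.\<close>

lemma koszul_brace_eq_moebius:
  assumes "distinct (map fst w)" "typed w" "D 0 = 0"
  shows "koszul_brace scale V m D (elts w) = moebius (op_term D w) (labels w)"
proof -
  define w' where "w' = map (\<lambda>x. (fst x, hdeg V (snd (snd x)), snd (snd x))) w"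
  have w': "elts w' = elts w" "map fst w' = map fst w" "labels w' = labels w"
    by (simp_all add: w'_def image_image)
  have "koszul_brace scale V m D (elts w') = moebius (op_term D w') (labels w')"
    using assms(1) by (intro koszul_brace_eq_moebius_hdeg) (auto simp: w'_def o_def)
  moreover have "moebius (op_term D w') B = moebius (op_term D w) B" for B
  proof (cases "0 \<in> set (elts w)")
    case True
    then show ?thesis
      using op_term_zero_entry[where D=D, OF assms(3)] w'(1) by (metis (no_types, lifting) moebius_cong)
  next
    case False
    have "w' = map (\<lambda>x. x) w"
      unfolding w'_def
    proof (rule map_cong[OF refl])
      fix x assume "x \<in> set w"
      then have "snd (snd x) \<noteq> 0" "snd (snd x) \<in> V (fst (snd x))"
        using False assms(2) by (force simp: typed_def)+
      then show "(fst x, hdeg V (snd (snd x)), snd (snd x)) = x"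
        by (simp add: hdeg_eq)
    qed
    then show ?thesis by simp
  qed
  ultimately show ?thesis using w' by simp
qed

text \<open>Up to Koszul signs, this is the recursion
  \<open>\<langle>a, b, \<dots>\<rangle> = \<langle>a b, \<dots>\<rangle> - \<langle>a, \<dots>\<rangle> b - \<langle>b, \<dots>\<rangle> a\<close> of Koszul braces. Subsets of the merged word correspond to the subsets
  of the long word that contain both or neither of \<open>s\<close> and \<open>t\<close>; as \<open>a\<close> and \<open>b\<close> are adjacent, no sign arises.\<close>

lemma moebius_merge:
  assumes typed: "typed ((s, i, a) # (t, j, b) # w)"
    and distinct: "distinct (map fst ((s, i, a) # (t, j, b) # w))"
    and R: "R = labels w"
  shows "moebius (op_term D ((s, i, a) # (t, j, b) # w)) (insert s (insert t R))
     = moebius (op_term D ((s, i + j, m a b) # w)) (insert s R)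
     - moebius (op_term D ((s, i, a) # (t, j, b) # w)) (insert s R)
     - moebius (op_term D ((s, i, a) # (t, j, b) # w)) (insert t R)"
proof -
  let ?w = "(s, i, a) # (t, j, b) # w" and ?w' = "(s, i + j, m a b) # w"
  let ?h = "op_term D ?w" and ?h' = "op_term D ?w'"
  have st: "s \<noteq> t" "s \<notin> R" "t \<notin> R" "finite R" using distinct R by auto
  have 1: "?h' A = ?h A" if "A \<subseteq> R" for A
  proof -
    have A: "s \<notin> A" "t \<notin> A" using that st by auto
    have *: "unshuffle_sign A ?w' = (unshuffle_sign A ?w :: 'k)"
      using A by (simp add: pass_sign_add mult.assoc)
    then have "extend A ?w' y = extend A ?w y" for y
      unfolding extend_def * using A by (simp add: m_assoc)
    then show ?thesis unfolding op_term_def using A by simp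
  qed
  have 2: "?h' (insert s A) = ?h (insert s (insert t A))" if "A \<subseteq> R" for A
  proof -
    have A: "s \<notin> A" "t \<notin> A" using that st by auto
    have o: "on (insert s A) w = on A w" "on (insert s (insert t A)) w = on A w"
      "on (- insert s A) w = on (- A) w" "on (- insert s (insert t A)) w = on (- A) w"
      using st(2,3) R by (auto intro!: filter_cong)
    have us: "unshuffle_sign (insert s A) w = (unshuffle_sign A w :: 'k)"
      "unshuffle_sign (insert s (insert t A)) w = (unshuffle_sign A w :: 'k)"
    proof -
      have *: "unshuffle_sign B u = (unshuffle_sign A u :: 'k)"
        if "\<And>x. x \<in> labels u \<Longrightarrow> x \<in> B \<longleftrightarrow> x \<in> A" for B and u :: "(nat \<times> int \<times> 'v) list"
        using that by (induction u) (auto intro!: arg_cong[where f="pass_sign _"] filter_cong)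
      show "unshuffle_sign (insert s A) w = (unshuffle_sign A w :: 'k)"
        by (rule *) (use st R in auto)
      show "unshuffle_sign (insert s (insert t A)) w = (unshuffle_sign A w :: 'k)"
        by (rule *) (use st R in auto)
    qed
    have p: "word_prod m (elts (on (insert s A) ?w')) = word_prod m (elts (on (insert s (insert t A)) ?w))"
      using o(1,2) by (simp add: word_prod_Cons del: word_prod.simps)
    have "extend (insert s A) ?w' y = extend (insert s (insert t A)) ?w y" for y
      using o(3,4) us by (simp add: extend_def)
    then show ?thesis unfolding op_term_def p by simp
  qed
  have "moebius ?h (insert s (insert t R)) = moebius (\<lambda>A. ?h (insert s A) - ?h A) (insert t R)"
    using st by (subst moebius_insert) auto
  also have "\<dots> = moebius (\<lambda>A. (?h (insert s (insert t A)) - ?h (insert t A)) - (?h (insert s A) - ?h A)) R"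
    using st by (intro moebius_insert) auto
  also have "\<dots> = moebius (\<lambda>A. (?h' (insert s A) - ?h' A) - (?h (insert s A) - ?h A)
      - (?h (insert t A) - ?h A)) R"
    by (rule moebius_cong) (simp only: 1 2, simp)
  also have "\<dots> = moebius ?h' (insert s R) - moebius ?h (insert s R) - moebius ?h (insert t R)"
    by (simp only: moebius_diff moebius_insert[OF st(4,2)] moebius_insert[OF st(4,3)])
  finally show ?thesis .
qed

text \<open>Induction on the length, by \<open>moebius_merge\<close>: merging and omitting letters both produce words of
  homogeneous letters that are one letter shorter.\<close>

lemma higher_braces_vanish:
  assumes order: "diff_order_at_most scale V m D k"
    and D0: "D 0 = 0"
    and "typed w" "distinct (map fst w)" "length w > k"
  shows "moebius (op_term D w) (labels w) = 0"
  using assms(3-)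
proof (induction "length w" arbitrary: w rule: less_induct)
  case less
  show ?case
  proof (cases "length w = k + 1")
    case True
    have "koszul_brace scale V m D (elts w) = 0"
      using order True less.prems(1)
      unfolding diff_order_at_most_def typed_def homogeneous_def
      by (elim allE[of _ "elts w"]) fastforce
    then show ?thesis using koszul_brace_eq_moebius[where D=D, OF less.prems(2,1) D0] by simp
  next
    case False
    with less.prems have "length w > k + 1" by simp
    then obtain s i a t j b u where w: "w = (s, i, a) # (t, j, b) # u"
      by (cases w; cases "tl w") auto
    let ?R = "labels u" and ?w' = "(s, i + j, m a b) # u"
    note typed = less.prems(1)[unfolded w] and distinct = less.prems(2)[unfolded w]
    have IH: "moebius (op_term D v) (labels v) = 0"
      if "typed v" "distinct (map fst v)" "length v = Suc (length u)" for v
      using less.hyps[of v] that \<open>length w > k + 1\<close> by (simp add: w)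
    have "typed ?w'" using typed by (simp add: m_in_V)
    then have 1: "moebius (op_term D ?w') (insert s ?R) = 0"
      using IH[of ?w'] distinct by simp
    have sub: "moebius (op_term D w) B = 0" if "length (on B w) = Suc (length u)" "B \<subseteq> labels w" for B
    proof -
      have "labels (on B w) = B" using that(2) by force
      moreover have "distinct (map fst (on B w))"
        using less.prems(2) by (simp add: distinct_map_filter)
      ultimately have "moebius (op_term D (on B w)) B = 0"
        using IH[of "on B w"] less.prems(1) that(1) by (simp add: typed_filter)
      then show ?thesis using extend_moebius_op_term[OF less.prems(1), of B D] by simp
    qed
    have "on (insert s ?R) w = (s, i, a) # u" "on (insert t ?R) w = (t, j, b) # u"
      using distinct by (auto simp: w filter_id_conv)
    then have 2: "moebius (op_term D w) (insert s ?R) = 0" "moebius (op_term D w) (insert t ?R) = 0"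
      using sub[of "insert s ?R"] sub[of "insert t ?R"] by (auto simp: w)
    show ?thesis
      using moebius_merge[OF typed distinct refl, of D] 1 2 by (simp add: w)
  qed
qed

end

section \<open>The free operad and its quotient HyperCom\<close>

abbreviation free_carr :: "nat \<Rightarrow> nat set \<Rightarrow> int \<Rightarrow> (nat hctree \<Rightarrow>\<^sub>0 'k::field) set" where
  "free_carr d S e \<equiv> {u. Poly_Mapping.keys u \<subseteq> {t \<in> hc_trees S. hc_deg d t = e}}"

lemma op_carr_Free: "op_carr (Free_operad d) S e = free_carr d S e"
  by (simp add: Free_operad_def)

lemma op_comp_Free: "op_comp (Free_operad d) S T = free_comp"
  by (simp add: Free_operad_def)

lemma free_carr_space: "u \<in> free_carr d S e \<Longrightarrow> u \<in> free_space S"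
  by (auto simp: free_space_def)

lemma free_comp_expand:
  assumes "finite K" "Poly_Mapping.keys u \<subseteq> K" "finite L" "Poly_Mapping.keys v \<subseteq> L"
  shows "free_comp s u v = (\<Sum>t\<in>K. \<Sum>t'\<in>L.
    Poly_Mapping.single (graft s t' t) (Poly_Mapping.lookup u t * Poly_Mapping.lookup v t'))"
proof -
  have "free_comp s u v = (\<Sum>t\<in>Poly_Mapping.keys u. \<Sum>t'\<in>L.
    Poly_Mapping.single (graft s t' t) (Poly_Mapping.lookup u t * Poly_Mapping.lookup v t'))"
    unfolding free_comp_def
    by (intro sum.cong refl sum.mono_neutral_left assms) (auto simp: in_keys_iff)
  also have "\<dots> = (\<Sum>t\<in>K. \<Sum>t'\<in>L.
    Poly_Mapping.single (graft s t' t) (Poly_Mapping.lookup u t * Poly_Mapping.lookup v t'))"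
    by (intro sum.mono_neutral_left assms) (auto simp: in_keys_iff)
  finally show ?thesis .
qed

lemma free_comp_add_left: "free_comp s (u + u') v = free_comp s u v + free_comp s u' v"
proof -
  let ?K = "Poly_Mapping.keys u \<union> Poly_Mapping.keys u'" and ?L = "Poly_Mapping.keys v"
  have "Poly_Mapping.keys (u + u') \<subseteq> ?K" by (rule Poly_Mapping.keys_add)
  then show ?thesis
    by (simp add: free_comp_expand[of ?K _ ?L] lookup_add distrib_right single_add sum.distrib)
qed

lemma free_comp_add_right: "free_comp s u (v + v') = free_comp s u v + free_comp s u v'"
proof -
  let ?L = "Poly_Mapping.keys v \<union> Poly_Mapping.keys v'" and ?K = "Poly_Mapping.keys u"
  have "Poly_Mapping.keys (v + v') \<subseteq> ?L" by (rule Poly_Mapping.keys_add)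
  then show ?thesis
    by (simp add: free_comp_expand[of ?K _ ?L] lookup_add distrib_left single_add sum.distrib)
qed

lemma free_comp_diff_left: "free_comp s (u - u') v = free_comp s u v - free_comp s u' v"
  using free_comp_add_left[of s "u - u'" u' v] by (simp add: algebra_simps)

lemma free_comp_diff_right: "free_comp s u (v - v') = free_comp s u v - free_comp s u v'"
  using free_comp_add_right[of s u "v - v'" v'] by (simp add: algebra_simps)

lemma free_comp_single:
  "free_comp s (Poly_Mapping.single t a) (Poly_Mapping.single t' b)
    = Poly_Mapping.single (graft s t' t) (a * b)"
  by (subst free_comp_expand[of "{t}" _ "{t'}"]) auto

lemma free_ren_add: "free_ren \<sigma> (u + v) = free_ren \<sigma> u + free_ren \<sigma> v"
  unfolding free_ren_def by (rule setsum_keys_plus_distrib) (simp_all add: single_add)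

lemma free_ren_diff: "free_ren \<sigma> (u - v) = free_ren \<sigma> u - free_ren \<sigma> v"
  using free_ren_add[of \<sigma> "u - v" v] by (simp add: algebra_simps)

lemma lookup_scaled [simp]:
  "Poly_Mapping.lookup (Poly_Mapping.map ((*) c) u) t = (c :: 'k::field) * Poly_Mapping.lookup u t"
  by (auto simp: Poly_Mapping.map.rep_eq when_def)

lemma scaled_diff:
  "Poly_Mapping.map ((*) (c :: 'k::field)) (u - v) = Poly_Mapping.map ((*) c) u - Poly_Mapping.map ((*) c) v"
  by (rule poly_mapping_eqI) (simp add: lookup_minus algebra_simps)

lemma hc_ideal_minus: "hc_ideal d S u \<Longrightarrow> hc_ideal d S (- u)"
proof -
  assume "hc_ideal d S u"
  then have "hc_ideal d S (Poly_Mapping.map ((*) (- 1)) u)" by (rule hc_ideal.scale)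
  moreover have "Poly_Mapping.map ((*) (- 1)) u = - u"
    by (rule poly_mapping_eqI) simp
  ultimately show ?thesis by simp
qed

lemma hc_class_eqI:
  assumes "hc_ideal d S (u - v)"
  shows "hc_class d S u = hc_class d S v"
proof -
  have "hc_ideal d S (x - v)" if "hc_ideal d S (x - u)" for x
    using hc_ideal.add[OF that assms] by simp
  moreover have "hc_ideal d S (x - u)" if "hc_ideal d S (x - v)" for x
    using hc_ideal.add[OF that hc_ideal_minus[OF assms]] by simp
  ultimately show ?thesis unfolding hc_class_def by blast
qed

lemma hc_class_self: "finite S \<Longrightarrow> u \<in> free_space S \<Longrightarrow> u \<in> hc_class d S u"
  by (simp add: hc_class_def hc_ideal.zero)

text \<open>The operations of HyperCom are unions over representatives. They are computed from one
  representative as soon as the class of the result is known to be independent of it.\<close>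

lemma UN_constant_eq2:
  assumes "a \<in> A" "b \<in> B" "\<And>x y. x \<in> A \<Longrightarrow> y \<in> B \<Longrightarrow> g x y = c"
  shows "(\<Union>x\<in>A. \<Union>y\<in>B. g x y) = c"
proof -
  have "(\<Union>y\<in>B. g x y) = c" if "x \<in> A" for x
    using assms(2,3) that by (intro UN_constant_eq) auto
  then show ?thesis using assms(1) by (intro UN_constant_eq) auto
qed

lemma HyperCom_simps:
  "op_carr (HyperCom d) S e = hc_class d S ` free_carr d S e"
  "op_add (HyperCom d) S A B = (\<Union>u\<in>A. \<Union>v\<in>B. hc_class d S (u + v))"
  "op_scale (HyperCom d) S c A = (\<Union>u\<in>A. hc_class d S (Poly_Mapping.map ((*) c) u))"
  "op_comp (HyperCom d) S T s A B = (\<Union>u\<in>A. \<Union>v\<in>B. hc_class d (S - {s} \<union> T) (free_comp s u v))"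
  "op_ren (HyperCom d) S \<sigma> A = (\<Union>u\<in>A. hc_class d (\<sigma> ` S) (free_ren \<sigma> u))"
  by (simp_all add: HyperCom_def op_carr_Free)

lemma HyperCom_add:
  assumes "finite S" "u \<in> free_space S" "v \<in> free_space S"
  shows "op_add (HyperCom d) S (hc_class d S u) (hc_class d S v) = hc_class d S (u + v)"
proof -
  have "hc_class d S (u' + v') = hc_class d S (u + v)"
    if "u' \<in> hc_class d S u" "v' \<in> hc_class d S v" for u' v'
  proof (rule hc_class_eqI)
    have "hc_ideal d S ((u' - u) + (v' - v))"
      using that by (intro hc_ideal.add) (auto simp: hc_class_def)
    then show "hc_ideal d S (u' + v' - (u + v))" by (simp add: algebra_simps)
  qed
  then show ?thesis
    unfolding HyperCom_simps
    by (rule UN_constant_eq2[OF hc_class_self[OF assms(1,2)] hc_class_self[OF assms(1,3)]])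
qed

lemma HyperCom_scale:
  assumes "finite S" "u \<in> free_space S"
  shows "op_scale (HyperCom d) S c (hc_class d S u) = hc_class d S (Poly_Mapping.map ((*) c) u)"
proof -
  have "hc_class d S (Poly_Mapping.map ((*) c) u') = hc_class d S (Poly_Mapping.map ((*) c) u)"
    if "u' \<in> hc_class d S u" for u'
  proof (rule hc_class_eqI)
    have "hc_ideal d S (Poly_Mapping.map ((*) c) (u' - u))"
      using that by (intro hc_ideal.scale) (auto simp: hc_class_def)
    then show "hc_ideal d S (Poly_Mapping.map ((*) c) u' - Poly_Mapping.map ((*) c) u)"
      by (simp add: scaled_diff)
  qed
  then show ?thesis
    unfolding HyperCom_simps by (intro UN_constant_eq[OF hc_class_self[OF assms]] ballI)
qed

lemma HyperCom_ren:
  assumes "finite S" "u \<in> free_space S" "bij \<sigma>"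
  shows "op_ren (HyperCom d) S \<sigma> (hc_class d S u) = hc_class d (\<sigma> ` S) (free_ren \<sigma> u)"
proof -
  have "hc_class d (\<sigma> ` S) (free_ren \<sigma> u') = hc_class d (\<sigma> ` S) (free_ren \<sigma> u)"
    if "u' \<in> hc_class d S u" for u'
  proof (rule hc_class_eqI)
    have "hc_ideal d (\<sigma> ` S) (free_ren \<sigma> (u' - u))"
      using that assms by (intro hc_ideal.ren) (auto simp: hc_class_def)
    then show "hc_ideal d (\<sigma> ` S) (free_ren \<sigma> u' - free_ren \<sigma> u)"
      by (simp add: free_ren_diff)
  qed
  then show ?thesis
    unfolding HyperCom_simps by (intro UN_constant_eq[OF hc_class_self[OF assms(1,2)]] ballI)
qed

lemma HyperCom_comp:
  assumes "composable S T s" "u \<in> free_space S" "v \<in> free_space T"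
  shows "op_comp (HyperCom d) S T s (hc_class d S u) (hc_class d T v)
    = hc_class d (S - {s} \<union> T) (free_comp s u v)"
proof -
  have fin: "finite S" "finite T" using assms(1) by (auto simp: composable_def)
  have "hc_class d (S - {s} \<union> T) (free_comp s u' v') = hc_class d (S - {s} \<union> T) (free_comp s u v)"
    if "u' \<in> hc_class d S u" "v' \<in> hc_class d T v" for u' v'
  proof (rule hc_class_eqI)
    have "hc_ideal d (S - {s} \<union> T) (free_comp s (u' - u) v' + free_comp s u (v' - v))"
      using that assms
      by (intro hc_ideal.add hc_ideal.comp_left hc_ideal.comp_right) (auto simp: hc_class_def)
    then show "hc_ideal d (S - {s} \<union> T) (free_comp s u' v' - free_comp s u v)"
      by (simp add: free_comp_diff_left free_comp_diff_right)
  qed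
  then show ?thesis
    unfolding HyperCom_simps
    by (rule UN_constant_eq2[OF hc_class_self[OF fin(1) assms(2)] hc_class_self[OF fin(2) assms(3)]])
qed

lemma HyperCom_carrI: "u \<in> free_carr d S e \<Longrightarrow> hc_class d S u \<in> op_carr (HyperCom d) S e"
  unfolding HyperCom_simps by (rule imageI)

lemma HyperCom_unit: "op_unit (HyperCom d) s = hc_class d {s} (Poly_Mapping.single (Leaf s) 1)"
  by (simp add: HyperCom_def)

text \<open>Allowing arbitrary multiplicities of \<open>s\<close> keeps the induction over the multiset of subtrees
  uniform: it need not be known which subtree contains \<open>s\<close>.\<close>

lemma hc_leaves_graft:
  "hc_leaves (graft s t' t)
    = filter_mset (\<lambda>x. x \<noteq> s) (hc_leaves t) + repeat_mset (count (hc_leaves t) s) (hc_leaves t')"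
proof (induction t)
  case (Node p ts)
  then show ?case
    by (induction ts) (simp_all add: repeat_mset_distrib add_ac)
qed simp

lemma hc_deg_graft:
  "hc_deg d (graft s t' t) = hc_deg d t + int (count (hc_leaves t) s) * hc_deg d t'"
proof (induction t)
  case (Node p ts)
  then have "\<Sum>\<^sub># (image_mset (\<lambda>t. hc_deg d (graft s t' t)) ts)
     = \<Sum>\<^sub># (image_mset (hc_deg d) ts) + int (count (\<Sum>\<^sub># (image_mset hc_leaves ts)) s) * hc_deg d t'"
    by (induction ts) (simp_all add: algebra_simps)
  then show ?case by (simp add: multiset.map_comp o_def)
qed simp

lemma hc_wf_graft: "hc_wf t \<Longrightarrow> hc_wf t' \<Longrightarrow> hc_wf (graft s t' t)"
  by (induction t) auto

lemma graft_absent: "s \<notin># hc_leaves t \<Longrightarrow> graft s t' t = t"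
proof (induction t)
  case (Node p ts)
  then have "image_mset (graft s t') ts = image_mset (\<lambda>t. t) ts"
    by (intro image_mset_cong) auto
  then show ?case by simp
qed simp

lemma graft_in_hc_trees:
  assumes "composable S T s" "t \<in> hc_trees S" "t' \<in> hc_trees T"
  shows "graft s t' t \<in> hc_trees (S - {s} \<union> T)" "hc_deg d (graft s t' t) = hc_deg d t + hc_deg d t'"
proof -
  have fin: "finite S" "finite T" "s \<in> S" "(S - {s}) \<inter> T = {}"
    using assms(1) by (auto simp: composable_def)
  have 1: "count (hc_leaves t) s = 1" using assms(2) fin by (simp add: hc_trees_def)
  show "hc_deg d (graft s t' t) = hc_deg d t + hc_deg d t'"
    by (simp add: hc_deg_graft 1)
  have "{x \<in> S. x \<noteq> s} = S - {s}" by auto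
  then have "filter_mset (\<lambda>x. x \<noteq> s) (mset_set S) = mset_set (S - {s})"
    using fin by simp
  then have "hc_leaves (graft s t' t) = mset_set (S - {s} \<union> T)"
    unfolding hc_leaves_graft 1 using assms fin
    by (simp add: hc_trees_def mset_set_Union)
  then show "graft s t' t \<in> hc_trees (S - {s} \<union> T)"
    using assms fin by (simp add: hc_trees_def hc_wf_graft)
qed

lemma free_comp_in_carr:
  assumes "composable S T s" "u \<in> free_carr d S e" "v \<in> free_carr d T e'"
  shows "free_comp s u v \<in> free_carr d (S - {s} \<union> T) (e + e')"
proof -
  have "Poly_Mapping.keys (free_comp s u v) \<subseteq> (\<Union>t\<in>Poly_Mapping.keys u. \<Union>t'\<in>Poly_Mapping.keys v. {graft s t' t})"
    unfolding free_comp_def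
    by (rule order_trans[OF keys_sum], rule UN_mono[OF order_refl], rule order_trans[OF keys_sum],
        rule UN_mono[OF order_refl]) simp
  also have "\<dots> \<subseteq> {t \<in> hc_trees (S - {s} \<union> T). hc_deg d t = e + e'}"
    using assms graft_in_hc_trees[OF assms(1)] by fastforce
  finally show ?thesis by simp
qed

lemma sum_mset_singletons: "(\<Sum>x\<in>#M. {#x#}) = M"
  by (induction M) simp_all

lemma free_gen_in_carr:
  assumes "finite S" "card S \<ge> 2"
  shows "free_gen S p \<in> free_carr d S (gen_deg d (card S) p)"
  using assms
  by (auto simp: free_gen_def hc_trees_def multiset.map_comp o_def sum_mset_singletons image_iff
      split: if_splits)

lemma free_ren_single: "free_ren \<sigma> (Poly_Mapping.single t c) = Poly_Mapping.single (map_hctree \<sigma> t) c"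
  by (cases "c = 0") (auto simp: free_ren_def)

lemma free_ren_gen:
  assumes "bij \<sigma>"
  shows "free_ren \<sigma> (free_gen S p) = free_gen (\<sigma> ` S) p"
proof -
  have "inj_on \<sigma> S" using assms by (meson bij_is_inj inj_on_subset subset_UNIV)
  then have "image_mset \<sigma> (mset_set S) = mset_set (\<sigma> ` S)" by (rule image_mset_mset_set)
  from this[symmetric] show ?thesis
    by (simp add: free_gen_def free_ren_single multiset.map_comp o_def)
qed

text \<open>Relabellings act through permutations of all natural numbers, so a bijection from \<open>A\<close> to \<open>B\<close> has to be
  extended; this is possible because \<open>B - A\<close> and \<open>A - B\<close> are equinumerous.\<close>

lemma ex_bij_image:
  fixes A B :: "'l set"
  assumes "finite A" "finite B" "card A = card B"
  obtains \<sigma> where "bij \<sigma>" "\<sigma> ` A = B"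
proof -
  obtain g where g: "bij_betw g A B" using assms finite_same_card_bij by blast
  have "card (B - A) = card (A - B)"
    using assms card_Diff_subset_Int[of B A] card_Diff_subset_Int[of A B] by (simp add: Int_commute)
  then obtain h where h: "bij_betw h (B - A) (A - B)"
    using assms finite_same_card_bij[of "B - A" "A - B"] by auto
  define \<sigma> where "\<sigma> x = (if x \<in> A then g x else if x \<in> B then h x else x)" for x
  have 1: "bij_betw \<sigma> A B" using g by (simp add: \<sigma>_def cong: bij_betw_cong)
  have 2: "bij_betw \<sigma> (B - A) (A - B)"
    using h by (subst bij_betw_cong[where g=h]) (auto simp: \<sigma>_def)
  have 3: "bij_betw \<sigma> (- (A \<union> B)) (- (A \<union> B))"
    by (subst bij_betw_cong[where g=id]) (auto simp: \<sigma>_def)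
  have "bij_betw \<sigma> (A \<union> (B - A)) (B \<union> (A - B))"
    by (rule bij_betw_combine[OF 1 2]) auto
  then have "bij_betw \<sigma> (A \<union> (B - A) \<union> - (A \<union> B)) (B \<union> (A - B) \<union> - (A \<union> B))"
    by (rule bij_betw_combine[OF _ 3]) auto
  moreover have "A \<union> (B - A) \<union> - (A \<union> B) = UNIV" "B \<union> (A - B) \<union> - (A \<union> B) = UNIV" by auto
  ultimately have "bij \<sigma>" by simp
  moreover have "\<sigma> ` A = B" using 1 by (rule bij_betw_imp_surj_on)
  ultimately show ?thesis using that by blast
qed

section \<open>Maps out of HyperCom\<close>

lemma species_mapD:
  assumes "species_map P Q \<delta> E" "finite S"
  shows "u \<in> op_carr P S e \<Longrightarrow> E S u \<in> op_carr Q S (e + \<delta>)"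
    and "u \<in> op_carr P S e \<Longrightarrow> v \<in> op_carr P S e \<Longrightarrow> E S (op_add P S u v) = op_add Q S (E S u) (E S v)"
    and "u \<in> op_carr P S e \<Longrightarrow> E S (op_scale P S c u) = op_scale Q S c (E S u)"
    and "u \<in> op_carr P S e \<Longrightarrow> bij \<sigma> \<Longrightarrow> E (\<sigma> ` S) (op_ren P S \<sigma> u) = op_ren Q S \<sigma> (E S u)"
proof -
  note * = assms(1)[unfolded species_map_def, rule_format, OF assms(2), of e]
  show "u \<in> op_carr P S e \<Longrightarrow> E S u \<in> op_carr Q S (e + \<delta>)"
    by (rule bspec[OF *[THEN conjunct1]])
  show "u \<in> op_carr P S e \<Longrightarrow> v \<in> op_carr P S e \<Longrightarrow> E S (op_add P S u v) = op_add Q S (E S u) (E S v)"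
    by (rule bspec[OF bspec[OF *[THEN conjunct2, THEN conjunct1]]])
  show "u \<in> op_carr P S e \<Longrightarrow> E S (op_scale P S c u) = op_scale Q S c (E S u)"
    by (rule bspec[OF spec[OF *[THEN conjunct2, THEN conjunct2, THEN conjunct1]]])
  show "u \<in> op_carr P S e \<Longrightarrow> bij \<sigma> \<Longrightarrow> E (\<sigma> ` S) (op_ren P S \<sigma> u) = op_ren Q S \<sigma> (E S u)"
    by (rule bspec[OF mp[OF spec[OF *[THEN conjunct2, THEN conjunct2, THEN conjunct2]]]])
qed

context graded_comm_alg
begin

abbreviation End where "End \<equiv> End_operad scale V"

lemma End_simps [simp]:
  "op_carr End = end_carr scale V" "op_add End S u v = (\<lambda>w. u w + v w)"
  "op_scale End S c u = (\<lambda>w. scale c (u w))" "op_comp End = end_comp scale V"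
  "op_unit End s = (\<lambda>w. if is_word V {s} w then snd (hd w) else 0)"
  "op_ren End S \<sigma> u = (\<lambda>w. u (map (\<lambda>x. (inv \<sigma> (fst x), snd x)) w))"
  by (simp_all add: End_operad_def)

context
  fixes d :: nat and \<delta> :: int and E
  assumes E: "species_map (HyperCom d) End \<delta> E"
begin

lemma species_carr:
  "finite S \<Longrightarrow> u \<in> free_carr d S e \<Longrightarrow> E S (hc_class d S u) \<in> end_carr scale V S (e + \<delta>)"
  using species_mapD(1)[OF E _ HyperCom_carrI] by simp

lemma species_add:
  assumes "finite S" "u \<in> free_carr d S e" "v \<in> free_carr d S e"
  shows "E S (hc_class d S (u + v)) = (\<lambda>w. E S (hc_class d S u) w + E S (hc_class d S v) w)"
proof -
  from species_mapD(2)[OF E assms(1) HyperCom_carrI[OF assms(2)] HyperCom_carrI[OF assms(3)]] show ?thesis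
    using HyperCom_add[OF assms(1) free_carr_space[OF assms(2)] free_carr_space[OF assms(3)], of d]
    by simp
qed

lemma species_zero:
  assumes "finite S"
  shows "E S (hc_class d S 0) = (\<lambda>w. 0)"
proof -
  have "E S (hc_class d S (0 + 0)) = (\<lambda>w. E S (hc_class d S 0) w + E S (hc_class d S 0) w)"
    using assms by (rule species_add[where e=0]) auto
  from fun_cong[OF this] show ?thesis by auto
qed

lemma species_sum:
  assumes "finite S" "\<And>x. x \<in> X \<Longrightarrow> g x \<in> free_carr d S e"
  shows "E S (hc_class d S (\<Sum>x\<in>X. g x)) = (\<lambda>w. \<Sum>x\<in>X. E S (hc_class d S (g x)) w)"
  using assms(2)
proof (induction X rule: infinite_finite_induct)
  case (insert x X)
  have "(\<Sum>x\<in>X. g x) \<in> free_carr d S e"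
    using insert.prems keys_sum[of g X] by blast
  then show ?case
    using insert species_add[OF assms(1), of "g x" e "\<Sum>x\<in>X. g x"] by simp
qed (simp_all add: species_zero[OF assms(1)])

lemma species_scale:
  assumes "finite S" "u \<in> free_carr d S e"
  shows "E S (hc_class d S (Poly_Mapping.map ((*) c) u)) = (\<lambda>w. scale c (E S (hc_class d S u) w))"
proof -
  from species_mapD(3)[where c = c, OF E assms(1) HyperCom_carrI[OF assms(2)]] show ?thesis
    using HyperCom_scale[OF assms(1) free_carr_space[OF assms(2)], of d c] by simp
qed

lemma species_ren:
  assumes "finite S" "u \<in> free_carr d S e" "bij \<sigma>"
  shows "E (\<sigma> ` S) (hc_class d (\<sigma> ` S) (free_ren \<sigma> u))
    = (\<lambda>w. E S (hc_class d S u) (map (\<lambda>x. (inv \<sigma> (fst x), snd x)) w))"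
proof -
  from species_mapD(4)[OF E assms(1) HyperCom_carrI[OF assms(2)] assms(3)] show ?thesis
    using HyperCom_ren[OF assms(1) free_carr_space[OF assms(2)] assms(3), of d] by simp
qed

text \<open>Values on generators are prescribed only for the label sets \<open>{1..n}\<close>; this carries them over to
  arbitrary label sets.\<close>

lemma species_gen_ren:
  assumes "finite S" "card S = n" "n \<ge> 2"
  obtains \<sigma> where "bij \<sigma>" "\<sigma> ` {1..n} = S"
    "E S (hc_gen d S p) = (\<lambda>w. E {1..n} (hc_gen d {1..n} p) (map (\<lambda>x. (inv \<sigma> (fst x), snd x)) w))"
proof -
  obtain \<sigma> where \<sigma>: "bij \<sigma>" "\<sigma> ` {1..n} = S"
    using ex_bij_image[of "{1..n}" S] assms by auto
  moreover have "free_gen {1..n} p \<in> free_carr d {1..n} (gen_deg d n p)"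
    using free_gen_in_carr[of "{1..n}" p d] assms by simp
  from species_ren[OF _ this \<sigma>(1)]
  have "E S (hc_gen d S p) = (\<lambda>w. E {1..n} (hc_gen d {1..n} p) (map (\<lambda>x. (inv \<sigma> (fst x), snd x)) w))"
    using \<sigma> by (simp add: hc_gen_def free_ren_gen)
  ultimately show ?thesis using that by blast
qed

end

section \<open>Derivations vanishing on the generators\<close>

lemma end_comp_zero_left: "end_comp scale V S T s (\<lambda>w. 0) v = (\<lambda>w. 0)"
  by (simp add: end_comp_def fun_eq_iff)

lemma end_carr_zero_arg:
  assumes "u \<in> end_carr scale V S e"
  shows "u ((s, 0) # w) = 0"
proof (cases "is_word V S ((s, 0) # w)")
  case True
  have "\<forall>w w' s c a. is_word V S (w @ (s, a) # w') \<longrightarrow>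
            u (w @ (s, scale c a) # w') = scale c (u (w @ (s, a) # w'))"
    using assms unfolding end_carr_def by blast
  from this[rule_format, of "[]" s 0 w 0] True show ?thesis by simp
next
  case False
  then show ?thesis using assms unfolding end_carr_def by blast
qed

lemma end_comp_zero_right:
  assumes "u \<in> end_carr scale V S e"
  shows "end_comp scale V S T s u (\<lambda>w. 0) = (\<lambda>w. 0)"
  using end_carr_zero_arg[OF assms] by (simp add: end_comp_def fun_eq_iff)

lemma is_word_singleton: "is_word V {s} w \<longleftrightarrow> (\<exists>a. w = [(s, a)] \<and> homogeneous V a)"
proof
  assume w: "is_word V {s} w"
  then have "card (set (map fst w)) = 1" "distinct (map fst w)" by (simp_all add: is_word_def)
  then have "length w = 1" using distinct_card[of "map fst w"] by simp
  then obtain x where "w = [x]" by (auto simp: length_Suc_conv)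
  then show "\<exists>a. w = [(s, a)] \<and> homogeneous V a" using w by (cases x) (auto simp: is_word_def)
qed (auto simp: is_word_def)

lemma operad_derivation_comp:
  assumes "operad_derivation (HyperCom d) End f \<delta> E" "composable S T s"
    "u \<in> free_carr d S e" "v \<in> free_carr d T e'"
  shows "E (S - {s} \<union> T) (op_comp (HyperCom d) S T s (hc_class d S u) (hc_class d T v))
    = (\<lambda>w. end_comp scale V S T s (E S (hc_class d S u)) (f T (hc_class d T v)) w
       + scale (ksign \<delta> e) (end_comp scale V S T s (f S (hc_class d S u)) (E T (hc_class d T v)) w))"
  using assms(1)[unfolded operad_derivation_def, THEN conjunct2, rule_format, OF assms(2)
    HyperCom_carrI[OF assms(3)] HyperCom_carrI[OF assms(4)]]
  by simp

text \<open>The unit \<open>u\<close> satisfies \<open>u \<circ> u = u\<close> and has degree 0, so \<open>E u = E u + E u\<close>.\<close>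

lemma derivation_unit:
  assumes "operad_hom (HyperCom d) End f" "operad_derivation (HyperCom d) End f \<delta> E"
  shows "E {s} (op_unit (HyperCom d) s) = (\<lambda>w. 0)"
proof -
  let ?u = "Poly_Mapping.single (Leaf s) (1 :: 'k)"
  let ?e = "E {s} (hc_class d {s} ?u)"
  have u: "?u \<in> free_carr d {s} 0" by (auto simp: hc_trees_def)
  have co: "composable {s} {s} s" by (simp add: composable_def)
  have sp: "species_map (HyperCom d) End \<delta> E" using assms(2) by (simp add: operad_derivation_def)
  have "?e \<in> end_carr scale V {s} (0 + \<delta>)" by (rule species_carr[OF sp _ u]) simp
  then have e: "?e w = 0" if "\<not> is_word V {s} w" for w
    using that unfolding end_carr_def by blast
  have eh: "homogeneous V (?e w)" if "is_word V {s} w" for w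
    using \<open>?e \<in> _\<close> that unfolding end_carr_def homogeneous_def by blast
  have fu: "f {s} (hc_class d {s} ?u) = (\<lambda>w. if is_word V {s} w then snd (hd w) else 0)"
    using assms(1) by (simp add: operad_hom_def HyperCom_unit)
  have "op_comp (HyperCom d) {s} {s} s (hc_class d {s} ?u) (hc_class d {s} ?u) = hc_class d {s} ?u"
    using HyperCom_comp[OF co free_carr_space[OF u] free_carr_space[OF u]]
    by (simp add: free_comp_single)
  then have "?e = (\<lambda>w. end_comp scale V {s} {s} s ?e (f {s} (hc_class d {s} ?u)) w
       + scale (ksign \<delta> 0) (end_comp scale V {s} {s} s (f {s} (hc_class d {s} ?u)) ?e w))"
    using operad_derivation_comp[OF assms(2) co u u] by simp
  note * = fun_cong[OF this]
  have "?e w = 0" for w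
  proof (cases "is_word V {s} w")
    case True
    then obtain a where w: "w = [(s, a)]" "homogeneous V a" by (auto simp: is_word_singleton)
    have [simp]: "front_sign (word_degs V [(s, a)]) J = (1 :: 'k)" for J
    proof -
      have *: "{(i, j). i < j \<and> j < length (word_degs V [(s, a)]) \<and> i \<notin> J \<and> j \<in> J} = {}"
        by (auto simp: word_degs_def)
      show ?thesis unfolding front_sign_def * by simp
    qed
    have "?e w = ?e w + ?e w"
      using *[of w] w eh[OF True] fu by (simp add: end_comp_def is_word_singleton ksign_def)
    then show ?thesis by simp
  qed (rule e)
  then show ?thesis by (simp add: HyperCom_unit fun_eq_iff)
qed

end

primrec hc_nodes :: "'l hctree \<Rightarrow> nat" where
  "hc_nodes (Leaf x) = 0"
| "hc_nodes (Node p ts) = Suc (\<Sum>\<^sub># (image_mset hc_nodes ts))"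

lemma hc_leaves_nonempty: "hc_wf t \<Longrightarrow> hc_leaves t \<noteq> {#}"
proof (induction t)
  case (Node p ts)
  then have "ts \<noteq> {#}" by auto
  then obtain t where "t \<in># ts" by auto
  then show ?case using Node by auto
qed simp

text \<open>A tree that is neither a single leaf nor a corolla has a subtree below its root that is not a leaf.
  Cutting it off writes the tree as a composite of two trees with fewer nodes.\<close>

lemma hc_tree_cases:
  assumes "t \<in> hc_trees S"
  obtains (leaf) s where "S = {s}" "t = Leaf s"
  | (corolla) p where "card S \<ge> 2" "t = Node p (image_mset Leaf (mset_set S))"
  | (graft) S' T s t0 t' where "composable S' T s" "S = S' - {s} \<union> T" "t0 \<in> hc_trees S'"
      "t' \<in> hc_trees T" "t = graft s t' t0" "hc_nodes t0 < hc_nodes t" "hc_nodes t' < hc_nodes t"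
proof (cases t)
  case (Leaf s)
  then have "mset_set S = {#s#}" "finite S" using assms by (auto simp: hc_trees_def)
  then have "S = {s}" by (metis finite_set_mset_mset_set set_mset_single)
  then show ?thesis using leaf Leaf by blast
next
  case (Node p ts)
  have S: "finite S" "mset_set S = \<Sum>\<^sub># (image_mset hc_leaves ts)"
    and wf: "2 \<le> size ts" "\<And>u. u \<in># ts \<Longrightarrow> hc_wf u"
    using assms Node by (auto simp: hc_trees_def)
  show ?thesis
  proof (cases "\<forall>u\<in>#ts. \<exists>x. u = Leaf x")
    case True
    then have *: "ts = image_mset Leaf (\<Sum>\<^sub># (image_mset hc_leaves ts))"
      by (induction ts) auto
    then have "size ts = card S" using S by (metis size_image_mset size_mset_set)
    then show ?thesis using corolla * S wf Node by metis
  next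
    case False
    then obtain t' where t': "t' \<in># ts" "\<nexists>x. t' = Leaf x" by blast
    then obtain ts' where ts: "ts = add_mset t' ts'" by (metis multi_member_split)
    have "hc_leaves t' \<noteq> {#}" using wf t' hc_leaves_nonempty by blast
    \<comment> \<open>The leaf that replaces the subtree borrows its label from the subtree; labels then stay distinct.\<close>
    then obtain s where s: "s \<in># hc_leaves t'" by auto
    let ?M = "\<Sum>\<^sub># (image_mset hc_leaves ts')"
    define t0 where "t0 = Node p (add_mset (Leaf s) ts')"
    define T where "T = set_mset (hc_leaves t')"
    define S' where "S' = insert s (set_mset ?M)"
    have sum: "mset_set S = hc_leaves t' + ?M" using S ts by simp
    have c: "count (hc_leaves t') x + count ?M x \<le> 1" for x
    proof -
      have "count (mset_set S) x \<le> 1" by (simp add: count_mset_set')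
      then show ?thesis unfolding sum by simp
    qed
    have disj: "x \<notin># ?M" if "x \<in># hc_leaves t'" for x
    proof -
      have "count (hc_leaves t') x \<ge> 1" using that by (simp add: Suc_le_eq)
      with c[of x] have "count ?M x = 0" by linarith
      then show ?thesis unfolding not_in_iff .
    qed
    have "M = mset_set (set_mset M)" if "\<And>x. count M x \<le> 1" for M :: "nat multiset"
    proof (rule multiset_eqI)
      fix x
      show "count M x = count (mset_set (set_mset M)) x"
        using that[of x] by (cases "x \<in># M") (auto simp: count_eq_zero_iff le_Suc_eq)
    qed
    then have T: "hc_leaves t' = mset_set T" "?M = mset_set (set_mset ?M)"
      unfolding T_def using c by (meson add_leE)+
    have S': "hc_leaves t0 = mset_set S'"
      unfolding S'_def t0_def using T(2) disj[OF s] by simp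
    have SS: "S = S' - {s} \<union> T"
    proof -
      have "S = set_mset (mset_set S)" by (rule finite_set_mset_mset_set[OF S(1), symmetric])
      also have "\<dots> = T \<union> set_mset ?M" unfolding sum T_def by simp
      finally show ?thesis unfolding S'_def using s disj[OF s] by (auto simp: T_def)
    qed
    have "composable S' T s"
      unfolding composable_def using disj by (auto simp: S'_def T_def)
    moreover have "t0 \<in> hc_trees S'"
      using S' wf ts by (auto simp: hc_trees_def S'_def t0_def)
    moreover have "t' \<in> hc_trees T" using T wf t' by (simp add: hc_trees_def T_def)
    moreover have "t = graft s t' t0"
    proof -
      have "image_mset (graft s t') ts' = image_mset (\<lambda>t. t) ts'"
        using disj[OF s] by (intro image_mset_cong graft_absent) auto
      then show ?thesis by (simp add: t0_def Node ts)
    qed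
    moreover have "hc_nodes t' \<ge> 1" using t'(2) by (cases t') auto
    then have "hc_nodes t0 < hc_nodes t" "hc_nodes t' < hc_nodes t"
      by (simp_all add: t0_def Node ts)
    ultimately show ?thesis using graft SS by blast
  qed
qed

text \<open>Induction on the number of nodes: every tree is a unit, a generator or a composite of smaller trees.\<close>

lemma (in graded_comm_alg) derivation_zero:
  assumes f: "operad_hom (HyperCom d) End f"
    and E: "operad_derivation (HyperCom d) End f \<delta> E"
    and gen: "\<And>n k. n \<ge> 2 \<Longrightarrow> E {1..n} (hc_gen d {1..n} k) = (\<lambda>w. 0)"
    and S: "finite S" "x \<in> op_carr (HyperCom d) S e"
  shows "E S x = (\<lambda>w. 0)"
proof -
  have sp: "species_map (HyperCom d) End \<delta> E" using E by (simp add: operad_derivation_def)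
  have fsp: "species_map (HyperCom d) End 0 f" using f by (simp add: operad_hom_def)
  have tree: "E S (hc_class d S (Poly_Mapping.single t 1)) = (\<lambda>w. 0)" if "t \<in> hc_trees S" for t S
    using that
  proof (induction "hc_nodes t" arbitrary: t S rule: less_induct)
    case less
    from less.prems show ?case
    proof (cases rule: hc_tree_cases)
      case (leaf s)
      then show ?thesis using derivation_unit[OF f E, of s] by (simp add: HyperCom_unit)
    next
      case (corolla p)
      have "finite S" using less.prems by (simp add: hc_trees_def)
      from species_gen_ren[OF sp this refl corolla(1), of p] show ?thesis
        using gen[OF corolla(1)] corolla(2) by (simp add: free_gen_def hc_gen_def)
    next
      case (graft S' T s t0 t')
      have c: "Poly_Mapping.single t0 (1::'k) \<in> free_carr d S' (hc_deg d t0)"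
        "Poly_Mapping.single t' (1::'k) \<in> free_carr d T (hc_deg d t')"
        using graft by auto
      have "hc_class d S (Poly_Mapping.single t 1)
         = op_comp (HyperCom d) S' T s (hc_class d S' (Poly_Mapping.single t0 1))
            (hc_class d T (Poly_Mapping.single t' (1 :: 'k)))"
        using HyperCom_comp[OF graft(1) free_carr_space[OF c(1)] free_carr_space[OF c(2)]] graft
        by (simp add: free_comp_single)
      moreover have "E S (op_comp (HyperCom d) S' T s (hc_class d S' (Poly_Mapping.single t0 1))
            (hc_class d T (Poly_Mapping.single t' (1 :: 'k))))
         = (\<lambda>w. end_comp scale V S' T s (E S' (hc_class d S' (Poly_Mapping.single t0 1)))
                (f T (hc_class d T (Poly_Mapping.single t' (1 :: 'k)))) w
          + scale (ksign \<delta> (hc_deg d t0)) (end_comp scale V S' T s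
              (f S' (hc_class d S' (Poly_Mapping.single t0 1)))
                (E T (hc_class d T (Poly_Mapping.single t' (1 :: 'k)))) w))"
        unfolding graft(2) by (rule operad_derivation_comp[OF E graft(1) c])
      moreover have "E S' (hc_class d S' (Poly_Mapping.single t0 1)) = (\<lambda>w. 0)"
        "E T (hc_class d T (Poly_Mapping.single t' 1)) = (\<lambda>w. 0)"
        using less.hyps graft by auto
      moreover have "f S' (hc_class d S' (Poly_Mapping.single t0 1)) \<in> end_carr scale V S' (hc_deg d t0 + 0)"
        using graft(1) c(1) by (intro species_carr[OF fsp]) (auto simp: composable_def)
      ultimately show ?thesis
        by (simp add: end_comp_zero_left end_comp_zero_right)
    qed
  qed
  from S(2) obtain u where u: "x = hc_class d S u" "u \<in> free_carr d S e"
    unfolding HyperCom_simps by blast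
  have single: "E S (hc_class d S (Poly_Mapping.single t c)) = (\<lambda>w. 0)" if "t \<in> hc_trees S" for t c
  proof -
    have "Poly_Mapping.single t c = Poly_Mapping.map ((*) c) (Poly_Mapping.single t 1)"
      by (rule poly_mapping_eqI) (simp add: lookup_single when_def)
    moreover have "Poly_Mapping.single t (1::'k) \<in> free_carr d S (hc_deg d t)" using that by auto
    ultimately show ?thesis
      using species_scale[OF sp S(1), of "Poly_Mapping.single t 1" "hc_deg d t" c] tree[OF that] by simp
  qed
  have "u = (\<Sum>t\<in>Poly_Mapping.keys u. Poly_Mapping.single t (Poly_Mapping.lookup u t))"
    by (rule poly_mapping_eqI) (auto simp: lookup_sum lookup_single when_def in_keys_iff)
  moreover have "E S (hc_class d S (\<Sum>t\<in>Poly_Mapping.keys u. Poly_Mapping.single t (Poly_Mapping.lookup u t)))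
     = (\<lambda>w. \<Sum>t\<in>Poly_Mapping.keys u. E S (hc_class d S (Poly_Mapping.single t (Poly_Mapping.lookup u t))) w)"
    using u(2) by (intro species_sum[OF sp S(1), where e=e]) auto
  moreover have "E S (hc_class d S (Poly_Mapping.single t (Poly_Mapping.lookup u t))) w = 0"
    if "t \<in> Poly_Mapping.keys u" for t w
    using single[of t] u(2) that by auto
  ultimately show ?thesis unfolding u(1) by (metis (no_types, lifting) sum.neutral)
qed

section \<open>Signed counts of ordered partitions\<close>

lemma sum_alternating_Pow:
  assumes "finite M" "M \<noteq> {}"
  shows "(\<Sum>A\<in>Pow M. (- 1) ^ card (M - A)) = (0 :: 'k::comm_ring_1)"
proof -
  have "(\<Sum>A\<in>Pow M. (- 1) ^ card (M - A)) = (\<Prod>x\<in>M. 1 + (- 1 :: 'k))"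
    by (subst prod_add[OF assms(1)]) simp
  then show ?thesis using assms by (simp add: power_0_left)
qed

lemma ordered_partition_Nil [simp]: "ordered_partition A [] \<longleftrightarrow> A = {}"
  by (auto simp: ordered_partition_def)

lemma ordered_partition_Cons:
  "ordered_partition A (S # Ss) \<longleftrightarrow> S \<noteq> {} \<and> S \<subseteq> A \<and> ordered_partition (A - S) Ss" (is "?l \<longleftrightarrow> ?r")
proof
  assume l: ?l
  have d: "S \<inter> Ss ! j = {}" if "j < length Ss" for j
    using l that unfolding ordered_partition_def by (metis Suc_less_eq length_Cons nth_Cons_0 nth_Cons_Suc zero_less_Suc)
  then have "S \<inter> \<Union> (set Ss) = {}" by (fastforce simp: in_set_conv_nth)
  moreover have "Ss ! i \<inter> Ss ! j = {}" if "i < j" "j < length Ss" for i j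
    using l that unfolding ordered_partition_def by (metis Suc_less_eq length_Cons nth_Cons_Suc)
  ultimately show ?r using l unfolding ordered_partition_def by auto
next
  assume r: ?r
  have "(S # Ss) ! i \<inter> (S # Ss) ! j = {}" if ij: "i < j" "j < length (S # Ss)" for i j
  proof -
    from ij obtain j' where j: "j = Suc j'" "j' < length Ss" by (cases j) auto
    have "Ss ! j' \<subseteq> A - S" using r j by (auto simp: ordered_partition_def)
    then show ?thesis using r j ij by (cases i) (auto simp: ordered_partition_def)
  qed
  then show ?l using r by (auto simp: ordered_partition_def)
qed

lemma ordered_partition_snoc:
  "ordered_partition A (Ss @ [Q]) \<longleftrightarrow> Q \<noteq> {} \<and> Q \<subseteq> A \<and> ordered_partition (A - Q) Ss"
proof (induction Ss arbitrary: A)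
  case (Cons S Ss)
  have "A - S - Q = A - Q - S" by auto
  then show ?case using Cons by (auto simp: ordered_partition_Cons)
qed (auto simp: ordered_partition_Cons)

lemma finite_ordered_partitions: "finite A \<Longrightarrow> finite {Ss. ordered_partition A Ss}"
proof (induction "card A" arbitrary: A rule: less_induct)
  case less
  have "{Ss. ordered_partition A Ss} \<subseteq> insert [] (\<Union>S\<in>Pow A - {{}}. (#) S ` {Ss. ordered_partition (A - S) Ss})"
  proof
    fix Ss assume "Ss \<in> {Ss. ordered_partition A Ss}"
    then show "Ss \<in> insert [] (\<Union>S\<in>Pow A - {{}}. (#) S ` {Ss. ordered_partition (A - S) Ss})"
      by (cases Ss) (auto simp: ordered_partition_Cons)
  qed
  moreover have "finite {Ss. ordered_partition (A - S) Ss}" if "S \<in> Pow A - {{}}" for S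
  proof (rule less.hyps)
    show "card (A - S) < card A" using that less.prems by (intro psubset_card_mono) auto
    show "finite (A - S)" using less.prems by simp
  qed
  ultimately show ?case using less.prems by (meson finite.insertI finite_Diff finite_Pow_iff finite_UN finite_imageI finite_subset)
qed

text \<open>By induction, splitting off the first block \<open>S\<close> of an ordered partition of a non-empty set \<open>A\<close>
  yields minus the sum of \<open>(-1)\<^bsup>|A-S|\<^esup>\<close> over all non-empty \<open>S\<close>. The sum over all \<open>S\<close> vanishes, so that
  the missing summand of the empty set remains.\<close>

lemma sum_ordered_partitions_sign:
  assumes "finite A"
  shows "(\<Sum>Ss | ordered_partition A Ss. (- 1) ^ length Ss) = ((- 1) ^ card A :: 'k::comm_ring_1)"
  using assms
proof (induction "card A" arbitrary: A rule: less_induct)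
  case less
  show ?case
  proof (cases "A = {}")
    case True
    have "{Ss. ordered_partition {} Ss} = {[]}"
    proof -
      have "Ss = []" if "ordered_partition {} Ss" for Ss
        using that by (cases Ss) (auto simp: ordered_partition_Cons)
      then show ?thesis by auto
    qed
    then show ?thesis using True by simp
  next
    case False
    have eq: "{Ss. ordered_partition A Ss}
       = (\<lambda>(S, Ss). S # Ss) ` (SIGMA S:Pow A - {{}}. {Ss. ordered_partition (A - S) Ss})"
      (is "?L = ?f ` ?R")
    proof
      show "?L \<subseteq> ?f ` ?R"
      proof
        fix Ss assume "Ss \<in> ?L"
        then show "Ss \<in> ?f ` ?R" using False by (cases Ss) (auto simp: ordered_partition_Cons)
      qed
    qed (auto simp: ordered_partition_Cons)
    have "(\<Sum>Ss | ordered_partition A Ss. (- 1 :: 'k) ^ length Ss)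
       = (\<Sum>(S, Ss)\<in>?R. (- 1) ^ Suc (length Ss))"
      unfolding eq by (subst sum.reindex) (auto simp: inj_on_def case_prod_beta)
    also have "\<dots> = (\<Sum>S\<in>Pow A - {{}}. \<Sum>Ss | ordered_partition (A - S) Ss. (- 1) ^ Suc (length Ss))"
      using less.prems by (subst sum.Sigma) (auto intro!: finite_ordered_partitions)
    also have "\<dots> = (\<Sum>S\<in>Pow A - {{}}. - ((- 1) ^ card (A - S)))"
    proof (rule sum.cong[OF refl])
      fix S assume S: "S \<in> Pow A - {{}}"
      then have "card (A - S) < card A" using less.prems by (intro psubset_card_mono) auto
      then show "(\<Sum>Ss | ordered_partition (A - S) Ss. (- 1 :: 'k) ^ Suc (length Ss)) = - ((- 1) ^ card (A - S))"
        using less.hyps[of "A - S"] less.prems by (simp add: sum_negf)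
    qed
    also have "\<dots> = - (\<Sum>S\<in>Pow A. (- 1) ^ card (A - S)) + (- 1) ^ card A"
      using less.prems by (simp add: sum_negf sum.remove[of "Pow A" "{}"])
    also have "\<dots> = (- 1) ^ card A"
      using sum_alternating_Pow[OF less.prems False, where 'k='k] by simp
    finally show ?thesis .
  qed
qed

text \<open>The conditions on input sets under which operations with inputs \<open>S \<union> {\<star>}\<close> can be composed one after the
  other onto an operation with inputs \<open>T\<close>.\<close>

fun blocks :: "nat set \<Rightarrow> nat set list \<Rightarrow> bool" where
  "blocks T [] = True"
| "blocks T (S # Ss) \<longleftrightarrow> finite S \<and> S \<noteq> {} \<and> 0 \<notin> S \<and> S \<inter> T = {} \<and> blocks (S \<union> T) Ss"

lemma ordered_partition_card:
  assumes "ordered_partition A Ss" "finite A"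
  shows "sum_list (map card Ss) = card A" "\<forall>S\<in>set Ss. finite S \<and> S \<noteq> {}"
proof -
  have "sum_list (map card Ss) = card A \<and> (\<forall>S\<in>set Ss. finite S \<and> S \<noteq> {})"
    using assms
  proof (induction Ss arbitrary: A)
    case (Cons S Ss)
    then have S: "S \<noteq> {}" "S \<subseteq> A" "ordered_partition (A - S) Ss" "finite S"
      by (auto simp: ordered_partition_Cons dest: finite_subset)
    have "card (A - S) + card S = card A"
      using S Cons.prems(2) by (metis card_Diff_subset card_mono le_add_diff_inverse2)
    then show ?case using S Cons.IH[OF S(3)] Cons.prems(2) by auto
  qed simp
  then show "sum_list (map card Ss) = card A" "\<forall>S\<in>set Ss. finite S \<and> S \<noteq> {}" by auto
qed

lemma ordered_partition_blocks:
  assumes "ordered_partition A Ss" "finite A" "0 \<notin> A" "A \<inter> T = {}"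
  shows "blocks T Ss" "\<Union>(set Ss) = A"
proof -
  have "blocks T Ss \<and> \<Union>(set Ss) = A"
    using assms
  proof (induction Ss arbitrary: A T)
    case (Cons S Ss)
    then have S: "S \<noteq> {}" "S \<subseteq> A" "ordered_partition (A - S) Ss"
      by (simp_all add: ordered_partition_Cons)
    have "blocks (S \<union> T) Ss \<and> \<Union>(set Ss) = A - S"
      by (rule Cons.IH) (use S Cons.prems in auto)
    then show ?case using S Cons.prems by (auto dest: finite_subset)
  qed simp
  then show "blocks T Ss" "\<Union>(set Ss) = A" by auto
qed

section \<open>Multiples of the iterated products in the endomorphism operad\<close>

context graded_comm_alg
begin

definition mult_op :: "nat set \<Rightarrow> (nat \<times> 'v) list \<Rightarrow> 'v" where
  "mult_op S w = (if is_word V S w then word_prod m (map snd w) else 0)"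

lemma is_word_on: "is_word V U w \<Longrightarrow> T \<subseteq> U \<Longrightarrow> is_word V T (on T w)"
  by (fastforce simp: is_word_def distinct_map_filter)

lemma is_word_typed: "is_word V U w \<Longrightarrow> typed (with_degrees w)"
  unfolding is_word_def by (intro typed_with_degrees) blast

lemma is_word_labels: "is_word V U w \<Longrightarrow> labels w = U"
  by (simp add: is_word_def)

lemma homogeneous_mult_op:
  assumes "is_word V S w" "S \<noteq> {}"
  shows "homogeneous V (mult_op S w)"
proof -
  have "with_degrees w \<noteq> []" using assms by (auto simp: is_word_def with_degrees_def)
  then have "homogeneous V (word_prod m (elts (with_degrees w)))"
    using word_prod_in_V[OF is_word_typed[OF assms(1)]] unfolding homogeneous_def by blast
  then show ?thesis using assms by (simp add: mult_op_def)
qed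

definition extend_op :: "nat set \<Rightarrow> nat set \<Rightarrow> ((nat \<times> 'v) list \<Rightarrow> 'v) \<Rightarrow> (nat \<times> 'v) list \<Rightarrow> 'v" where
  "extend_op T U v w = (if is_word V U w then extend T (with_degrees w) (v (on T w)) else 0)"

text \<open>The iterated products compose like the operations of the commutative operad, so two successive
  composites with products merge into one; the signs are taken care of by \<open>extend_extend\<close>.\<close>

lemma extend_op_extend_op:
  assumes "T \<subseteq> S" "S \<subseteq> U"
  shows "extend_op S U (\<lambda>w. scale c (extend_op T S v w)) = (\<lambda>w. scale c (extend_op T U v w))"
proof
  fix w
  show "extend_op S U (\<lambda>w. scale c (extend_op T S v w)) w = scale c (extend_op T U v w)"
  proof (cases "is_word V U w")
    case True
    then show ?thesis
      using is_word_on[OF True assms(2)]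
        extend_extend[OF is_word_typed[OF True] assms(1), of "v (on T w)"] on_on[OF assms(1), of w]
      by (simp add: extend_op_def extend_scale on_with_degrees del: filter_filter)
  qed (simp add: extend_op_def)
qed

lemma extend_op_self:
  assumes "\<And>w. \<not> is_word V T w \<Longrightarrow> v w = 0"
  shows "extend_op T T v = v"
proof
  fix w
  show "extend_op T T v w = v w"
  proof (cases "is_word V T w")
    case True
    then have "on T w = w" by (auto simp: is_word_def filter_id_conv)
    then show ?thesis using True is_word_labels[OF True]
      by (simp add: extend_op_def extend_all)
  qed (simp add: extend_op_def assms)
qed

lemma end_comp_mult_op:
  assumes S: "s \<in> S" "(S - {s}) \<inter> T = {}"
    and v: "\<And>w. is_word V T w \<Longrightarrow> homogeneous V (v w)"
  shows "end_comp scale V S T s (\<lambda>w. scale c (mult_op S w)) v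
    = (\<lambda>w. scale c (extend_op T (S - {s} \<union> T) v w))"
proof
  fix w
  show "end_comp scale V S T s (\<lambda>w. scale c (mult_op S w)) v w
    = scale c (extend_op T (S - {s} \<union> T) v w)"
  proof (cases "is_word V (S - {s} \<union> T) w")
    case True
    have "homogeneous V (v (on T w))" using is_word_on[OF True, of T] v by simp
    moreover have "is_word V (S - {s}) (filter (\<lambda>x. fst x \<notin> T) w)"
    proof -
      have "on (S - {s}) w = filter (\<lambda>x. fst x \<notin> T) w"
        using is_word_labels[OF True] S(2) by (auto intro!: filter_cong)
      then show ?thesis using is_word_on[OF True, of "S - {s}"] by (simp only: Un_upper1)
    qed
    ultimately have word: "is_word V S ((s, v (on T w)) # filter (\<lambda>x. fst x \<notin> T) w)"
      using S(1) by (auto simp: is_word_def)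
    have "map snd (filter (\<lambda>x. fst x \<notin> T) w) = elts (on (- T) (with_degrees w))"
      by (simp add: with_degrees_def filter_map o_def)
    then have "mult_op S ((s, v (on T w)) # filter (\<lambda>x. fst x \<notin> T) w)
       = mul_word (v (on T w)) (on (- T) (with_degrees w))"
      using word unfolding mult_op_def by (simp add: word_prod_Cons mul_word_def del: word_prod.simps)
    then show ?thesis
      using True unfolding end_comp_def front_sign_with_degrees extend_op_def extend_def
      by (simp add: mult.commute)
  next
    case False
    then show ?thesis unfolding end_comp_def extend_op_def by simp
  qed
qed

lemma homogeneous_extend_op:
  assumes "\<And>w. is_word V T w \<Longrightarrow> homogeneous V (v w)" "T \<subseteq> U" "is_word V U w"
  shows "homogeneous V (extend_op T U v w)"
  using assms is_word_on[OF assms(3,2)] is_word_typed[OF assms(3)]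
  by (auto simp: extend_op_def extend_def intro!: homogeneous_scale homogeneous_mul_word typed_filter)

text \<open>In a nested composite of multiples of products onto \<open>v\<close> the scalars multiply and the products merge
  into one, so that only the total scalar depends on the list of blocks.\<close>

lemma nested_mult_op:
  assumes "blocks T (map fst L)"
    and "\<And>w. is_word V T w \<Longrightarrow> homogeneous V (v w)"
    and "\<And>w. \<not> is_word V T w \<Longrightarrow> v w = 0"
  shows "nested End T v (map (\<lambda>x. (fst x, \<lambda>w. scale (c x) (mult_op (insert 0 (fst x)) w))) L)
    = (\<lambda>w. scale (\<Prod>x\<leftarrow>L. c x) (extend_op T (T \<union> \<Union>(set (map fst L))) v w))"
  using assms
proof (induction L arbitrary: T v)
  case Nil
  then show ?case by (simp add: extend_op_self)
next
  case (Cons x L)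
  obtain S p where x: "x = (S, p)" by (cases x)
  define v' where "v' = (\<lambda>w. scale (c x) (extend_op T (S \<union> T) v w))"
  let ?U = "T \<union> \<Union>(set (map fst (x # L)))"
  have S: "S \<noteq> {}" "0 \<notin> S" "S \<inter> T = {}" using Cons.prems(1) x by auto
  have "nested End T v (map (\<lambda>x. (fst x, \<lambda>w. scale (c x) (mult_op (insert 0 (fst x)) w))) (x # L))
     = nested End (S \<union> T) v' (map (\<lambda>x. (fst x, \<lambda>w. scale (c x) (mult_op (insert 0 (fst x)) w))) L)"
  proof -
    have "insert 0 S - {0} \<union> T = S \<union> T" "(insert 0 S - {0}) \<inter> T = {}" using S by auto
    then show ?thesis
      using end_comp_mult_op[where c = "c x" and s = 0 and S = "insert 0 S", OF _ _ Cons.prems(2)]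
      by (simp add: v'_def x)
  qed
  also have "\<dots> = (\<lambda>w. scale (\<Prod>x\<leftarrow>L. c x) (extend_op (S \<union> T) (S \<union> T \<union> \<Union>(set (map fst L))) v' w))"
  proof (rule Cons.IH)
    show "blocks (S \<union> T) (map fst L)" using Cons.prems(1) x by simp
    show "homogeneous V (v' w)" if "is_word V (S \<union> T) w" for w
      unfolding v'_def using that Cons.prems(2)
      by (intro homogeneous_scale homogeneous_extend_op[where T=T]) auto
    show "v' w = 0" if "\<not> is_word V (S \<union> T) w" for w
      using that by (simp add: v'_def extend_op_def)
  qed
  also have "S \<union> T \<union> \<Union>(set (map fst L)) = ?U" using x by auto
  also have "extend_op (S \<union> T) ?U v' = (\<lambda>w. scale (c x) (extend_op T ?U v w))"
    unfolding v'_def using x by (intro extend_op_extend_op) auto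
  finally show ?case by (simp add: mult.commute)
qed

text \<open>By graded commutativity, the sign of \<open>word_prod_unshuffle\<close> is exactly the one in the composition of
  the endomorphism operad.\<close>

lemma extend_op_mult_op:
  assumes "T \<subseteq> U" "T \<noteq> {}"
  shows "extend_op T U (mult_op T) = mult_op U"
proof
  fix w
  show "extend_op T U (mult_op T) w = mult_op U w"
  proof (cases "is_word V U w")
    case True
    let ?w = "with_degrees w"
    have typed: "typed ?w" by (rule is_word_typed[OF True])
    have ne: "on T w \<noteq> []" using is_word_labels[OF True] assms by (force simp: filter_empty_conv)
    have wp: "mult_op T (on T w) = word_prod m (elts (on T ?w))"
      using is_word_on[OF True assms(1)] by (simp add: mult_op_def flip: on_with_degrees)
    have "with_degrees (on T w) \<noteq> []" using ne by (simp add: with_degrees_def)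
    then have "on T ?w \<noteq> []" unfolding on_with_degrees .
    from word_prod_unshuffle[OF typed this] show ?thesis
      using True wp by (simp add: extend_op_def extend_def mult_op_def)
  qed (simp add: extend_op_def mult_op_def)
qed

end

section \<open>Brackets of an operator with the iterated products\<close>

context graded_comm_alg
begin

lemma word_deg_split: "word_deg (on A w) + word_deg (on (- A) w) = word_deg w"
  by (induction w) (auto simp: word_deg_def)

lemma extend_in_V:
  assumes "typed w" "y \<in> V (e + word_deg (on A w))"
  shows "extend A w y \<in> V (e + word_deg w)"
  using mul_word_in_V[OF assms(2) typed_filter[OF assms(1)], of "\<lambda>x. fst x \<in> - A"]
    word_deg_split[of A w] unfolding extend_def
  by (intro subspace_scale[OF V_subspace]) (simp add: add.assoc)

lemma op_term_in_V:
  assumes D: "homogeneous_operator scale V e D" and w: "typed w" "A \<subseteq> labels w"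
  shows "op_term D w A \<in> V (e + word_deg w)"
proof (cases "A = {}")
  case False
  then have "on A w \<noteq> []" using w(2) by (force simp: filter_empty_conv)
  then have "word_prod m (elts (on A w)) \<in> V (word_deg (on A w))"
    using w(1) by (intro word_prod_in_V typed_filter)
  then have "D (word_prod m (elts (on A w))) \<in> V (word_deg (on A w) + e)"
    using D unfolding homogeneous_operator_def by blast
  then show ?thesis
    using False extend_in_V[OF w(1), of _ e A] by (simp add: op_term_def add.commute)
qed (simp add: subspace_0[OF V_subspace])

text \<open>The bracket of \<open>D\<close> with the product of the letters labelled by \<open>A\<close>, multiplied by the remaining letters of \<open>w\<close>.\<close>

definition reduced_term :: "('v \<Rightarrow> 'v) \<Rightarrow> (nat \<times> int \<times> 'v) list \<Rightarrow> nat set \<Rightarrow> 'v" where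
  "reduced_term D w A = op_term D w A - (\<Sum>i\<in>A. op_term D w {i})"

lemma reduced_term_in_V:
  assumes "homogeneous_operator scale V e D" "typed w" "A \<subseteq> labels w"
  shows "reduced_term D w A \<in> V (e + word_deg w)"
  unfolding reduced_term_def using assms
  by (intro subspace_diff[OF V_subspace] subspace_sum[OF V_subspace] op_term_in_V) auto

lemma extend_reduced_term:
  assumes "typed w" "A \<subseteq> T"
  shows "extend T w (reduced_term D (on T w) A) = reduced_term D w A"
  using assms unfolding reduced_term_def extend_diff extend_sum
  by (intro arg_cong2[where f="(-)"] sum.cong extend_op_term refl) auto

lemma homogeneous_operator_linear:
  assumes "homogeneous_operator scale V e D"
  shows "D (a + b) = D a + D b" "D (scale c a) = scale c (D a)" "D 0 = 0" "homogeneous V a \<Longrightarrow> homogeneous V (D a)"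
proof -
  have l: "Vector_Spaces.linear scale scale D"
    using assms by (simp add: homogeneous_operator_def)
  show add: "D (a + b) = D a + D b" for a b
    using l unfolding Vector_Spaces.linear_iff by blast
  show "D (scale c a) = scale c (D a)"
    using l unfolding Vector_Spaces.linear_iff by blast
  show "D 0 = 0" using add[of 0 0] by simp
  show "homogeneous V a \<Longrightarrow> homogeneous V (D a)"
    using assms unfolding homogeneous_operator_def homogeneous_def by blast
qed

text \<open>The products have even degree, so the bracket subtracts the terms without a further sign. The
  composite with \<open>D\<close> in the slot \<open>i\<close> is the term of the set \<open>{i}\<close>, and the composite with \<open>D\<close> on the outside is the
  term of \<open>S\<close>.\<close>

lemma end_bracket_mult_op:
  assumes D: "homogeneous_operator scale V e D" and "even eu" "finite S" "S \<noteq> {}"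
  shows "end_bracket scale V er eu S (end_unary V D) (\<lambda>w. scale c (mult_op S w))
    = (\<lambda>w. scale c (if is_word V S w then reduced_term D (with_degrees w) S else 0))"
proof
  fix w
  note lin = homogeneous_operator_linear[OF D]
  have ks: "ksign er eu = (1 :: 'k)" using \<open>even eu\<close> by (simp add: ksign_def)
  let ?r = "end_unary V D" and ?u = "\<lambda>w. scale c (mult_op S w)"
  let ?w = "with_degrees w"
  show "end_bracket scale V er eu S ?r ?u w
    = scale c (if is_word V S w then reduced_term D ?w S else 0)"
  proof (cases "is_word V S w")
    case False
    have "S - {i} \<union> {i} = S" if "i \<in> S" for i using that by auto
    then show ?thesis using False by (simp add: end_bracket_def end_comp_def)
  next
    case True
    have lab: "labels w = S" by (rule is_word_labels[OF True])
    have all: "on S w = w" "filter (\<lambda>x. fst x \<notin> S) w = []" "on S ?w = ?w"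
      using lab by (auto simp: filter_id_conv filter_empty_conv with_degrees_def)
    have "unshuffle_sign S ?w = (1 :: 'k)" using lab by (intro unshuffle_sign_all) simp
    moreover have "op_term D ?w S = D (mult_op S w)"
      using \<open>S \<noteq> {}\<close> extend_all[of ?w S] lab True by (simp add: op_term_def all mult_op_def)
    moreover have "is_word V {1} [(1, ?u w)]"
      using homogeneous_mult_op[OF True \<open>S \<noteq> {}\<close>] by (simp add: is_word_def homogeneous_scale)
    ultimately have 1: "end_comp scale V {1} S 1 ?r ?u w = scale c (op_term D ?w S)"
      using True lin(2) unfolding end_comp_def front_sign_with_degrees
      by (simp add: all end_unary_def)
    have 2: "end_comp scale V S {i} i ?u (op_ren End {1} (transpose 1 i) ?r) w = scale c (op_term D ?w {i})"
      if "i \<in> S" for i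
    proof -
      let ?ri = "op_ren End {1} (transpose 1 i) ?r"
      have S: "S - {i} \<union> {i} = S" using that by auto
      have ri: "?ri [(i, a)] = D a" if "homogeneous V a" for a
        using that by (simp add: end_unary_def is_word_def)
      have "homogeneous V (?ri v)" if "is_word V {i} v" for v
        using that ri lin(4) by (auto simp: is_word_singleton simp del: End_simps)
      then have "end_comp scale V S {i} i ?u ?ri w = scale c (extend_op {i} S ?ri w)"
        using end_comp_mult_op[OF that, of "{i}" ?ri c] S by (simp del: End_simps)
      also have "extend_op {i} S ?ri w = op_term D ?w {i}"
      proof -
        have "is_word V {i} (on {i} w)" using is_word_on[OF True, of "{i}"] that by simp
        then obtain a where a: "on {i} w = [(i, a)]" "homogeneous V a"
          by (auto simp: is_word_singleton)
        then have "elts (on {i} ?w) = [a]" 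
          unfolding on_with_degrees[symmetric] with_degrees_simps by simp
        then show ?thesis using True a ri[OF a(2)] by (simp add: extend_op_def op_term_def del: End_simps)
      qed
      finally show ?thesis .
    qed
    have "(\<Sum>i\<in>S. end_comp scale V S {i} i ?u (op_ren End {1} (transpose 1 i) ?r) w)
       = (\<Sum>i\<in>S. scale c (op_term D ?w {i}))"
      by (rule sum.cong[OF refl 2])
    then show ?thesis
      unfolding end_bracket_def ks 1 using True
      by (simp only: reduced_term_def scale_right_diff_distrib scale_sum_right scale_one if_True)
  qed
qed

lemma mult_op_ren:
  assumes "bij \<sigma>"
  shows "mult_op S (map (\<lambda>x. (inv \<sigma> (fst x), snd x)) w) = mult_op (\<sigma> ` S) w"
proof -
  have inj: "inj (inv \<sigma>)" using assms by (simp add: bij_is_surj surj_imp_inj_inv)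
  have "distinct (map (inv \<sigma>) (map fst w)) \<longleftrightarrow> distinct (map fst w)"
    using inj by (simp only: distinct_map) (meson inj_on_subset subset_UNIV)
  moreover have "inv \<sigma> ` labels w = S \<longleftrightarrow> labels w = \<sigma> ` S"
    using image_f_inv_f[OF bij_is_surj[OF assms], of "labels w"] image_inv_f_f[OF bij_is_inj[OF assms], of S]
    by metis
  ultimately have "is_word V S (map (\<lambda>x. (inv \<sigma> (fst x), snd x)) w) \<longleftrightarrow> is_word V (\<sigma> ` S) w"
    by (simp add: is_word_def o_def image_image)
  then show ?thesis by (simp add: mult_op_def o_def)
qed

lemma end_product_eq_mult_op: "end_product V m = mult_op {1, 2}"
proof
  fix w
  show "end_product V m w = mult_op {1, 2} w"
  proof (cases "is_word V {1, 2} w")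
    case True
    then have "card (set (map fst w)) = 2" "distinct (map fst w)" by (simp_all add: is_word_def)
    then have "length w = 2" using distinct_card[of "map fst w"] by simp
    then obtain x y where "w = [x, y]" by (auto simp: length_Suc_conv numeral_2_eq_2)
    then show ?thesis using True by (simp add: end_product_def mult_op_def)
  qed (simp add: end_product_def mult_op_def)
qed

end

section \<open>The morphism on generators\<close>

text \<open>The scalar by which the image of \<open>\<mu>\<^sub>n\<^bsup>(p)\<^esup>\<close> under \<open>f\<close> differs from the \<open>n\<close>-fold product, as \<open>f_gen\<close> shows.\<close>

definition gen_coeff :: "nat \<Rightarrow> nat \<Rightarrow> nat \<Rightarrow> 'k::comm_ring_1" where
  "gen_coeff d n p = (if p = d * (n - 1) - 1 then (- 1) ^ n else 0)"

text \<open>The superscripts of non-zero factors are determined by their blocks, so a sum of such products is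
  really a sum over lists of blocks.\<close>

lemma prod_gen_coeff:
  "(\<Prod>x\<leftarrow>L. gen_coeff d (Suc (card (fst x))) (snd x) :: 'k::comm_ring_1)
    = (if L = map (\<lambda>S. (S, d * card S - 1)) (map fst L)
       then (- 1) ^ (sum_list (map card (map fst L)) + length L) else 0)"
  by (induction L) (auto simp: gen_coeff_def power_add prod_eq_iff)

lemma sum_list_exponents:
  assumes "\<forall>S\<in>set Ss. finite S \<and> S \<noteq> {}" "d \<ge> 1"
  shows "sum_list (map (\<lambda>S. d * card S - 1) Ss) + length Ss = d * sum_list (map card Ss)"
  using assms(1)
proof (induction Ss)
  case (Cons S Ss)
  then have "card S \<ge> 1" by (simp add: Suc_le_eq card_gt_0_iff)
  then have "d * card S \<ge> 1" using assms(2) by (metis One_nat_def Suc_le_eq nat_0_less_mult_iff)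
  then have "d * card S - 1 + 1 = d * card S" by (rule le_add_diff_inverse2)
  moreover have "sum_list (map (\<lambda>S. d * card S - 1) Ss) + length Ss = d * sum_list (map card Ss)"
    using Cons by simp
  moreover have "sum_list (map (\<lambda>S. d * card S - 1) (S # Ss)) + length (S # Ss)
     = (d * card S - 1 + 1) + (sum_list (map (\<lambda>S. d * card S - 1) Ss) + length Ss)"
    by simp
  ultimately show ?case by (simp add: distrib_left)
qed simp

lemma ordered_partition_exponents:
  assumes "ordered_partition A Ss" "finite A" "d \<ge> 1"
  shows "sum_list (map (\<lambda>S. d * card S - 1) Ss) + length Ss = d * card A"
  using sum_list_exponents[of Ss d] ordered_partition_card[OF assms(1,2)] assms(3) by simp

definition relation_index :: "nat \<Rightarrow> nat \<Rightarrow> (nat set \<times> nat \<times> (nat set \<times> nat) list) set" where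
  "relation_index n p = {(S1, p1, L). ordered_partition {1..n} (S1 # map fst L) \<and> {1, 2} \<subseteq> S1 \<and>
          p1 + sum_list (map snd L) + length L = p}"

lemma finite_relation_index: "finite (relation_index n p)"
proof (rule finite_subset)
  have *: "L \<in> {L. set L \<subseteq> Pow {1..n} \<times> {..p} \<and> length L \<le> p}"
    if "ordered_partition {1..n} (S1 # map fst L)" "p1 + sum_list (map snd L) + length L = p" for S1 p1 L
  proof -
    have "x \<in> Pow {1..n} \<times> {..p}" if "x \<in> set L" for x
    proof -
      have "snd x \<le> sum_list (map snd L)" using that by (intro member_le_sum_list) auto
      moreover have "fst x \<subseteq> {1..n}"
        using that \<open>ordered_partition _ _\<close> unfolding ordered_partition_def by auto
      ultimately show ?thesis using that \<open>_ = p\<close> by (cases x) auto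
    qed
    then show ?thesis using that by auto
  qed
  show "relation_index n p \<subseteq> Pow {1..n} \<times> {..p} \<times> {L. set L \<subseteq> Pow {1..n} \<times> {..p} \<and> length L \<le> p}"
  proof
    fix x assume x: "x \<in> relation_index n p"
    obtain S1 p1 L where xx: "x = (S1, p1, L)" by (cases x)
    have "S1 \<in> Pow {1..n}" "p1 \<in> {..p}"
      using x by (auto simp: xx relation_index_def ordered_partition_Cons)
    with *[of S1 L p1] x show "x \<in> Pow {1..n} \<times> {..p} \<times> {L. set L \<subseteq> Pow {1..n} \<times> {..p} \<and> length L \<le> p}"
      by (simp add: xx relation_index_def)
  qed
  show "finite (Pow {1..n} \<times> {..p} \<times> {L. set L \<subseteq> Pow {1..n} \<times> {..p} \<and> length L \<le> p})"
    by (intro finite_cartesian_product finite_lists_length_le) auto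
qed

text \<open>The scalar with which a summand of the defining relation contributes a multiple of the \<open>n\<close>-fold product.\<close>

definition relation_coeff :: "nat \<Rightarrow> nat set \<times> nat \<times> (nat set \<times> nat) list \<Rightarrow> 'k::comm_ring_1" where
  "relation_coeff d = (\<lambda>(S1, p1, L). gen_coeff d (card S1) p1
    * (\<Prod>x\<leftarrow>L. gen_coeff d (Suc (card (fst x))) (snd x)))"

text \<open>Only ordered partitions remain, with sign \<open>(-1)\<^sup>n\<close> times \<open>-1\<close> to the number of blocks after the first.
  Summation over these blocks leaves the alternating sum over the subsets of \<open>{3..n}\<close>, which vanishes because this
  set is not empty.\<close>

lemma sum_relation_coeff:
  assumes "n \<ge> 3" "d \<ge> 1"
  shows "(\<Sum>x\<in>relation_index n (d * (n - 1) - 1). relation_coeff d x) = (0 :: 'k::comm_ring_1)"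
proof -
  let ?A = "{1..n}"
  define Q where "Q = (SIGMA S1:{S1 \<in> Pow ?A. {1, 2} \<subseteq> S1}. {Ss. ordered_partition (?A - S1) Ss})"
  define \<phi> where "\<phi> = (\<lambda>(S1 :: nat set, Ss :: nat set list). (S1, d * (card S1 - 1) - 1, map (\<lambda>S. (S, d * card S - 1)) Ss))"
  have card2: "card S1 \<ge> 2" if "{1, 2} \<subseteq> S1" "S1 \<subseteq> ?A" for S1 :: "nat set"
    using card_mono[OF _ that(1)] finite_subset[OF that(2)] by simp
  have split: "card (?A - S1) + card S1 = n" if "S1 \<subseteq> ?A" for S1
  proof -
    have "card (?A - S1) = n - card S1" using that by (simp add: card_Diff_subset finite_subset[OF that])
    moreover have "card S1 \<le> n" using card_mono[OF _ that] by simp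
    ultimately show ?thesis by simp
  qed
  have sub: "\<phi> ` Q \<subseteq> relation_index n (d * (n - 1) - 1)"
  proof
    fix x assume "x \<in> \<phi> ` Q"
    then obtain S1 Ss where x: "x = \<phi> (S1, Ss)" and S: "S1 \<subseteq> ?A" "{1, 2} \<subseteq> S1" "ordered_partition (?A - S1) Ss"
      by (auto simp: Q_def)
    have "sum_list (map (\<lambda>S. d * card S - 1) Ss) + length Ss = d * card (?A - S1)"
      using S assms by (intro ordered_partition_exponents) auto
    moreover have "d * (n - 1) = d * (card S1 - 1) + d * card (?A - S1)"
    proof -
      have "n - 1 = (card S1 - 1) + card (?A - S1)"
        using split[OF S(1)] card2[OF S(2,1)] by linarith
      then show ?thesis by (simp only: distrib_left)
    qed
    moreover have "d * (card S1 - 1) \<ge> 1"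
      using card2[OF S(2,1)] assms by (simp add: Suc_le_eq)
    ultimately have "d * (card S1 - 1) - 1 + sum_list (map (\<lambda>S. d * card S - 1) Ss) + length Ss = d * (n - 1) - 1"
      by linarith
    then show "x \<in> relation_index n (d * (n - 1) - 1)"
      using S by (auto simp: x \<phi>_def relation_index_def ordered_partition_Cons o_def)
  qed
  have zero: "relation_coeff d x = (0 :: 'k)" if "x \<in> relation_index n (d * (n - 1) - 1) - \<phi> ` Q" for x
  proof (rule ccontr)
    obtain S1 p1 L where x: "x = (S1, p1, L)" by (cases x)
    assume "relation_coeff d x \<noteq> (0 :: 'k)"
    then have *: "gen_coeff d (card S1) p1 \<noteq> (0 :: 'k)"
      "(\<Prod>x\<leftarrow>L. gen_coeff d (Suc (card (fst x))) (snd x)) \<noteq> (0 :: 'k)"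
      by (auto simp: relation_coeff_def x)
    have "p1 = d * (card S1 - 1) - 1" using *(1) by (simp add: gen_coeff_def split: if_splits)
    moreover have "L = map (\<lambda>S. (S, d * card S - 1)) (map fst L)"
      using *(2) unfolding prod_gen_coeff by metis
    ultimately have "x = \<phi> (S1, map fst L)" by (simp add: x \<phi>_def)
    moreover have "(S1, map fst L) \<in> Q"
      using that by (auto simp: x Q_def relation_index_def ordered_partition_Cons)
    ultimately show False using that by blast
  qed
  have inj: "inj_on \<phi> Q"
    by (rule inj_on_inverseI[where g = "\<lambda>(S1, p1, L). (S1, map fst L)"]) (auto simp: \<phi>_def o_def)
  have val: "relation_coeff d (\<phi> z) = ((- 1) ^ n * (- 1) ^ length (snd z) :: 'k)" if "z \<in> Q" for z
  proof -
    obtain S1 Ss where z: "z = (S1, Ss)" and S: "S1 \<subseteq> ?A" "ordered_partition (?A - S1) Ss"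
      using \<open>z \<in> Q\<close> by (auto simp: Q_def)
    have e: "relation_coeff d (\<phi> z) = ((- 1) ^ card S1 * (- 1) ^ (sum_list (map card Ss) + length Ss) :: 'k)"
      unfolding relation_coeff_def \<phi>_def z prod.case prod_gen_coeff by (simp add: gen_coeff_def o_def)
    have "sum_list (map card Ss) = card (?A - S1)"
      using S assms by (intro ordered_partition_card) auto
    then have "card S1 + (sum_list (map card Ss) + length Ss) = n + length Ss"
      using split[OF S(1)] by linarith
    then show ?thesis unfolding e unfolding z snd_conv power_add[symmetric] by (rule arg_cong)
  qed
  let ?M = "?A - {1, 2}"
  have fin: "finite {S1 \<in> Pow ?A. {1, 2} \<subseteq> S1}" by simp
  have "(\<Sum>x\<in>relation_index n (d * (n - 1) - 1). relation_coeff d x :: 'k) = (\<Sum>x\<in>\<phi> ` Q. relation_coeff d x)"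
    using zero by (intro sum.mono_neutral_right finite_relation_index sub) auto
  also have "\<dots> = (\<Sum>z\<in>Q. (- 1) ^ n * (- 1) ^ length (snd z))"
    using val by (simp add: sum.reindex[OF inj])
  also have "\<dots> = (\<Sum>S1 | S1 \<in> Pow ?A \<and> {1, 2} \<subseteq> S1. \<Sum>Ss | ordered_partition (?A - S1) Ss. (- 1) ^ n * (- 1) ^ length Ss)"
    unfolding Q_def using fin by (subst sum.Sigma) (auto intro!: finite_ordered_partitions simp: case_prod_beta)
  also have "\<dots> = (\<Sum>S1 | S1 \<in> Pow ?A \<and> {1, 2} \<subseteq> S1. (- 1) ^ n * (- 1) ^ card (?A - S1))"
    by (intro sum.cong) (simp_all add: sum_ordered_partitions_sign flip: sum_distrib_left)
  also have "\<dots> = (\<Sum>C\<in>Pow ?M. (- 1) ^ n * (- 1) ^ card (?M - C))"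
  proof (rule sum.reindex_bij_witness[where i="\<lambda>C. C \<union> {1, 2}" and j="\<lambda>S. S - {1, 2}"])
    fix S assume S: "S \<in> {S1 \<in> Pow ?A. {1, 2} \<subseteq> S1}"
    then have "?M - (S - {1, 2}) = ?A - S" by auto
    then show "(- 1) ^ n * (- 1) ^ card (?M - (S - {1, 2})) = (- 1) ^ n * (- 1 :: 'k) ^ card (?A - S)" by simp
  qed (use assms in auto)
  also have "\<dots> = (- 1) ^ n * (\<Sum>C\<in>Pow ?M. (- 1) ^ card (?M - C))" by (simp add: sum_distrib_left)
  also have "(\<Sum>C\<in>Pow ?M. (- 1) ^ card (?M - C)) = (0 :: 'k)"
  proof (rule sum_alternating_Pow)
    have "3 \<in> ?M" using assms by simp
    then show "?M \<noteq> {}" by blast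
  qed simp
  finally show ?thesis by simp
qed

locale commutative_rep = graded_comm_alg scale V m
  for scale :: "'k::field_char_0 \<Rightarrow> 'v::ab_group_add \<Rightarrow> 'v" and V m +
  fixes d :: nat and f :: "nat set \<Rightarrow> (nat hctree \<Rightarrow>\<^sub>0 'k) set \<Rightarrow> (nat \<times> 'v) list \<Rightarrow> 'v"
  assumes d_pos: "d \<ge> 1"
    and f_hom: "operad_hom (HyperCom d) End f"
    and f_product: "f {1, 2} (hc_gen d {1, 2} (d - 1)) = end_product V m"
    and f_other: "\<And>n k. n \<ge> 2 \<Longrightarrow> k \<noteq> d * (n - 1) - 1 \<Longrightarrow> f {1..n} (hc_gen d {1..n} k) = (\<lambda>w. 0)"
begin

lemma f_species: "species_map (HyperCom d) End 0 f"
  using f_hom by (simp add: operad_hom_def)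

lemma f_comp:
  assumes "composable S T s" "u \<in> free_carr d S e" "v \<in> free_carr d T e'"
  shows "f (S - {s} \<union> T) (hc_class d (S - {s} \<union> T) (free_comp s u v))
    = end_comp scale V S T s (f S (hc_class d S u)) (f T (hc_class d T v))"
  using f_hom[unfolded operad_hom_def, THEN conjunct2, THEN conjunct2, rule_format, OF assms(1)
      HyperCom_carrI[OF assms(2)] HyperCom_carrI[OF assms(3)]]
    HyperCom_comp[OF assms(1) free_carr_space[OF assms(2)] free_carr_space[OF assms(3)], of d]
  by simp

lemma f_nested:
  assumes "blocks T (map fst L)" "finite T" "v \<in> free_carr d T e"
  defines "U \<equiv> T \<union> \<Union>(set (map fst L))"
  defines "u \<equiv> nested (Free_operad d) T v (map (\<lambda>x. (fst x, free_gen (insert 0 (fst x)) (snd x))) L)"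
  shows "u \<in> free_carr d U (e + (\<Sum>x\<leftarrow>L. gen_deg d (Suc (card (fst x))) (snd x)))"
    and "f U (hc_class d U u) = nested End T (f T (hc_class d T v))
      (map (\<lambda>x. (fst x, f (insert 0 (fst x)) (hc_gen d (insert 0 (fst x)) (snd x)))) L)"
proof -
  have "u \<in> free_carr d U (e + (\<Sum>x\<leftarrow>L. gen_deg d (Suc (card (fst x))) (snd x))) \<and>
    f U (hc_class d U u) = nested End T (f T (hc_class d T v))
      (map (\<lambda>x. (fst x, f (insert 0 (fst x)) (hc_gen d (insert 0 (fst x)) (snd x)))) L)"
    unfolding U_def u_def using assms(1-3)
  proof (induction L arbitrary: T v e)
    case (Cons x L)
    obtain S p where x: "x = (S, p)" by (cases x)
    have S: "finite S" "S \<noteq> {}" "0 \<notin> S" "S \<inter> T = {}" "blocks (S \<union> T) (map fst L)"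
      using Cons.prems(1) x by auto
    have c: "composable (insert 0 S) T 0" using S Cons.prems(2) by (auto simp: composable_def)
    have card: "card (insert 0 S) = Suc (card S)" "card S \<ge> 1"
      using S by (simp_all add: Suc_le_eq card_gt_0_iff)
    then have g: "free_gen (insert 0 S) p \<in> free_carr d (insert 0 S) (gen_deg d (Suc (card S)) p)"
      using free_gen_in_carr[of "insert 0 S" p d] S by simp
    have set: "insert 0 S - {0} \<union> T = S \<union> T" "S \<union> T \<union> \<Union>(set (map fst L)) = T \<union> \<Union>(set (map fst (x # L)))"
      using S x by auto
    have v': "free_comp 0 (free_gen (insert 0 S) p) v \<in> free_carr d (S \<union> T) (gen_deg d (Suc (card S)) p + e)"
      using free_comp_in_carr[OF c g Cons.prems(3)] unfolding set .
    have fv': "f (S \<union> T) (hc_class d (S \<union> T) (free_comp 0 (free_gen (insert 0 S) p) v))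
       = end_comp scale V (insert 0 S) T 0 (f (insert 0 S) (hc_gen d (insert 0 S) p)) (f T (hc_class d T v))"
      using f_comp[OF c g Cons.prems(3)] unfolding set hc_gen_def .
    show ?case
      using Cons.IH[OF S(5) _ v'] S(1) Cons.prems(2) unfolding set fv' by (simp add: x ac_simps op_comp_Free)
  qed simp
  then show "u \<in> free_carr d U (e + (\<Sum>x\<leftarrow>L. gen_deg d (Suc (card (fst x))) (snd x)))"
    and "f U (hc_class d U u) = nested End T (f T (hc_class d T v))
      (map (\<lambda>x. (fst x, f (insert 0 (fst x)) (hc_gen d (insert 0 (fst x)) (snd x)))) L)"
    by auto
qed

text \<open>All summands of the relation have the same degree, so additivity of \<open>f\<close> on homogeneous elements
  suffices to apply \<open>f\<close> to the relation termwise.\<close>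

lemma f_relation:
  assumes "n \<ge> 2" "p \<ge> d"
  shows "(\<Sum>(S1, p1, L)\<in>relation_index n p. nested End S1 (f S1 (hc_gen d S1 p1))
      (map (\<lambda>x. (fst x, f (insert 0 (fst x)) (hc_gen d (insert 0 (fst x)) (snd x)))) L) w) = 0"
proof -
  let ?A = "{1..n}"
  define g :: "nat set \<times> nat \<times> (nat set \<times> nat) list \<Rightarrow> nat hctree \<Rightarrow>\<^sub>0 'k"
    where "g = (\<lambda>(S1, p1, L). nested (Free_operad d) S1 (free_gen S1 p1)
          (map (\<lambda>(S, p). (S, free_gen (insert 0 S) p)) L))"
  have g: "g x \<in> free_carr d ?A (2 * (int d * (int n - 1) - 1 - int p))
     \<and> f ?A (hc_class d ?A (g x)) = (case x of (S1, p1, L) \<Rightarrow> nested End S1 (f S1 (hc_gen d S1 p1))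
      (map (\<lambda>x. (fst x, f (insert 0 (fst x)) (hc_gen d (insert 0 (fst x)) (snd x)))) L))"
    if "x \<in> relation_index n p" for x
  proof -
    obtain S1 p1 L where x: "x = (S1, p1, L)" by (cases x)
    have S1: "S1 \<subseteq> ?A" "{1, 2} \<subseteq> S1" "ordered_partition (?A - S1) (map fst L)"
      "p1 + sum_list (map snd L) + length L = p"
      using that by (auto simp: x relation_index_def ordered_partition_Cons)
    have fin: "finite S1" using S1(1) by (rule finite_subset) simp
    have card: "card S1 \<ge> 2" using card_mono[OF fin S1(2)] by simp
    have b: "blocks S1 (map fst L)" "S1 \<union> \<Union>(set (map fst L)) = ?A"
      using ordered_partition_blocks[OF S1(3), of S1] S1(1) by auto
    have sum_card: "sum_list (map card (map fst L)) = card (?A - S1)"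
      using ordered_partition_card(1)[OF S1(3)] by simp
    have n: "card (?A - S1) = n - card S1" "card S1 \<le> n"
      using S1(1) fin card_mono[OF _ S1(1)] by (simp_all add: card_Diff_subset)
    have sum: "(\<Sum>x\<leftarrow>L. gen_deg d (Suc (card (fst x))) (snd x))
       = 2 * (int d * int (sum_list (map card (map fst L))) - int (sum_list (map snd L)) - int (length L))" for L :: "(nat set \<times> nat) list"
      by (induction L) (simp_all add: gen_deg_def algebra_simps)
    have deg: "gen_deg d (card S1) p1 + (\<Sum>x\<leftarrow>L. gen_deg d (Suc (card (fst x))) (snd x))
       = 2 * (int d * (int n - 1) - 1 - int p)"
      unfolding sum[of L] sum_card n(1) S1(4)[symmetric] using n(2)
      by (simp add: gen_deg_def algebra_simps of_nat_diff)
    have g': "g x = nested (Free_operad d) S1 (free_gen S1 p1) (map (\<lambda>x. (fst x, free_gen (insert 0 (fst x)) (snd x))) L)"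
      by (simp add: g_def x case_prod_beta')
    show ?thesis
      using f_nested[OF b(1) fin free_gen_in_carr[OF fin card, of p1 d]]
      unfolding b(2) deg g' by (simp add: x hc_gen_def)
  qed
  have rel: "hc_relation d n 1 2 p = (\<Sum>x\<in>relation_index n p. g x)"
    unfolding hc_relation_def relation_index_def g_def ..
  have "hc_ideal d ?A (hc_relation d n 1 2 p - (0 :: nat hctree \<Rightarrow>\<^sub>0 'k))"
    using hc_ideal.rel[of n 1 2 d p] assms by simp
  then have class0: "hc_class d ?A (hc_relation d n 1 2 p) = hc_class d ?A (0 :: nat hctree \<Rightarrow>\<^sub>0 'k)"
    by (rule hc_class_eqI)
  have "f ?A (hc_class d ?A (\<Sum>x\<in>relation_index n p. g x)) w = 0"
    unfolding rel[symmetric] class0 using species_zero[OF f_species, of ?A] by simp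
  moreover have "f ?A (hc_class d ?A (\<Sum>x\<in>relation_index n p. g x))
     = (\<lambda>w. \<Sum>x\<in>relation_index n p. f ?A (hc_class d ?A (g x)) w)"
    using g by (intro species_sum[OF f_species]) auto
  ultimately have "(\<Sum>x\<in>relation_index n p. f ?A (hc_class d ?A (g x)) w) = 0" by simp
  moreover have "(\<Sum>x\<in>relation_index n p. f ?A (hc_class d ?A (g x)) w)
     = (\<Sum>(S1, p1, L)\<in>relation_index n p. nested End S1 (f S1 (hc_gen d S1 p1))
      (map (\<lambda>x. (fst x, f (insert 0 (fst x)) (hc_gen d (insert 0 (fst x)) (snd x)))) L) w)"
  proof (rule sum.cong[OF refl])
    fix x assume "x \<in> relation_index n p"
    from g[OF this] show "f ?A (hc_class d ?A (g x)) w = (case x of (S1, p1, L) \<Rightarrow>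
        nested End S1 (f S1 (hc_gen d S1 p1))
          (map (\<lambda>x. (fst x, f (insert 0 (fst x)) (hc_gen d (insert 0 (fst x)) (snd x)))) L) w)"
      by (cases x) simp
  qed
  ultimately show ?thesis by simp
qed

text \<open>Induction on the arity. For \<open>n \<ge> 3\<close> and \<open>p = d(n-1)-1\<close>, which is at least \<open>d\<close>, the relation with
  \<open>m = p\<close> has the generator itself as its summand with a single block. All other summands are composites of
  generators of smaller arity, hence known multiples of the product, and \<open>sum_relation_coeff\<close> determines the one that is left.\<close>

lemma f_gen:
  assumes "finite S" "card S \<ge> 2"
  shows "f S (hc_gen d S p) = (\<lambda>w. scale (gen_coeff d (card S) p) (mult_op S w))"
  using assms
proof (induction "card S" arbitrary: S p rule: less_induct)
  case less
  let ?n = "card S"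
  let ?A = "{1..?n}"
  have *: "f ?A (hc_gen d ?A p) w = scale (gen_coeff d ?n p) (mult_op ?A w)" for w
  proof (cases "p = d * (?n - 1) - 1")
    case False
    then show ?thesis using f_other[OF less.prems(2) False] by (simp add: gen_coeff_def)
  next
    case p: True
    show ?thesis
    proof (cases "?n = 2")
      case True
      then have A: "?A = {1, 2}" by auto
      have p': "p = d - 1" using p True by simp
      show ?thesis
        unfolding A p' f_product end_product_eq_mult_op using True by (simp add: gen_coeff_def)
    next
      case False
      then have n: "?n \<ge> 3" using less.prems by simp
      let ?R = "relation_index ?n p"
      define \<tau> where "\<tau> = (\<lambda>(S1, p1, L :: (nat set \<times> nat) list). nested End S1 (f S1 (hc_gen d S1 p1))
        (map (\<lambda>x. (fst x, f (insert 0 (fst x)) (hc_gen d (insert 0 (fst x)) (snd x)))) L) w)"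
      have "d * (?n - 1) \<ge> d * 2" using n by (intro mult_left_mono) auto
      then have "p \<ge> d" using p d_pos by linarith
      then have sum0: "(\<Sum>x\<in>?R. \<tau> x) = 0"
        using f_relation[of ?n p w] n by (simp add: \<tau>_def)
      let ?x = "(?A, p, [])"
      have x: "?x \<in> ?R" using n by (auto simp: relation_index_def ordered_partition_Cons)
      have val: "\<tau> x = scale (relation_coeff d x) (mult_op ?A w)" if "x \<in> ?R - {?x}" for x
      proof -
        obtain S1 p1 L where xx: "x = (S1, p1, L)" by (cases x)
        have S1: "S1 \<subseteq> ?A" "{1, 2} \<subseteq> S1" "ordered_partition (?A - S1) (map fst L)"
          "p1 + sum_list (map snd L) + length L = p"
          using that by (auto simp: xx relation_index_def ordered_partition_Cons)
        have fin: "finite S1" using S1(1) by (rule finite_subset) simp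
        have card: "card S1 \<ge> 2" using card_mono[OF fin S1(2)] by simp
        have b: "blocks S1 (map fst L)" "S1 \<union> \<Union>(set (map fst L)) = ?A"
          using ordered_partition_blocks[OF S1(3), of S1] S1(1) by auto
        have "L \<noteq> []"
        proof
          assume "L = []"
          then have "S1 = ?A" using S1 by auto
          then show False using that S1(4) \<open>L = []\<close> xx by simp
        qed
        then have "S1 \<noteq> ?A" using S1(3) by (cases L) (auto simp: ordered_partition_Cons)
        then have "card S1 < ?n" using S1(1) psubset_card_mono[of ?A S1] by auto
        then have fS1: "f S1 (hc_gen d S1 p1) = (\<lambda>w. scale (gen_coeff d (card S1) p1) (mult_op S1 w))"
          using less.hyps fin card by blast
        have fL: "f (insert 0 (fst y)) (hc_gen d (insert 0 (fst y)) (snd y))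
           = (\<lambda>w. scale (gen_coeff d (Suc (card (fst y))) (snd y)) (mult_op (insert 0 (fst y)) w))"
          if "y \<in> set L" for y
        proof -
          have y: "fst y \<noteq> {}" "fst y \<subseteq> ?A - S1"
            using that S1(3) unfolding ordered_partition_def by auto
          then have fy: "finite (fst y)" "0 \<notin> fst y" by (auto dest: finite_subset)
          have "card (fst y) \<le> card (?A - S1)" using y by (intro card_mono) auto
          also have "\<dots> = ?n - card S1" using S1(1) fin by (simp add: card_Diff_subset)
          finally have "Suc (card (fst y)) < ?n" using card n by linarith
          moreover have "card (insert 0 (fst y)) = Suc (card (fst y))" using fy by simp
          moreover have "card (fst y) \<ge> 1" using y fy by (simp add: Suc_le_eq card_gt_0_iff)
          ultimately show ?thesis using less.hyps[of "insert 0 (fst y)"] fy by simp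
        qed
        define c1 :: 'k where "c1 = gen_coeff d (card S1) p1"
        have hom: "homogeneous V (scale c1 (mult_op S1 w))" if "is_word V S1 w" for w
          using that S1(2) by (intro homogeneous_scale homogeneous_mult_op) auto
        have zero: "scale c1 (mult_op S1 w) = 0" if "\<not> is_word V S1 w" for w
          using that by (simp add: mult_op_def)
        have "\<tau> x = nested End S1 (\<lambda>w. scale c1 (mult_op S1 w))
            (map (\<lambda>x. (fst x, \<lambda>w. scale (gen_coeff d (Suc (card (fst x))) (snd x)) (mult_op (insert 0 (fst x)) w))) L) w"
        proof -
          have "map (\<lambda>x. (fst x, f (insert 0 (fst x)) (hc_gen d (insert 0 (fst x)) (snd x)))) L
             = map (\<lambda>x. (fst x, \<lambda>w. scale (gen_coeff d (Suc (card (fst x))) (snd x)) (mult_op (insert 0 (fst x)) w))) L"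
            by (rule map_cong[OF refl]) (simp add: fL)
          then show ?thesis unfolding \<tau>_def xx prod.case fS1 c1_def by (rule arg_cong[where f = "\<lambda>us. nested End S1 _ us w"])
        qed
        also have "\<dots> = scale (\<Prod>x\<leftarrow>L. gen_coeff d (Suc (card (fst x))) (snd x))
             (extend_op S1 ?A (\<lambda>w. scale c1 (mult_op S1 w)) w)"
          using fun_cong[OF nested_mult_op[where c = "\<lambda>x. gen_coeff d (Suc (card (fst x))) (snd x)", OF b(1) hom zero], where x = w]
          unfolding b(2) .
        also have "extend_op S1 ?A (\<lambda>w. scale c1 (mult_op S1 w)) w = scale c1 (extend_op S1 ?A (mult_op S1) w)"
          by (simp add: extend_op_def extend_scale)
        also have "extend_op S1 ?A (mult_op S1) = mult_op ?A"
          using S1 by (intro extend_op_mult_op) auto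
        finally show ?thesis
          by (simp add: xx relation_coeff_def c1_def mult.commute)
      qed
      \<comment> \<open>The coefficients of all summands other than the generator add up to minus \<open>(-1)\<^sup>n\<close>.\<close>
      have "0 = \<tau> ?x + (\<Sum>x\<in>?R - {?x}. \<tau> x)"
        using sum0 sum.remove[OF finite_relation_index x, of \<tau>] by simp
      also have "(\<Sum>x\<in>?R - {?x}. \<tau> x) = scale (\<Sum>x\<in>?R - {?x}. relation_coeff d x) (mult_op ?A w)"
        using val by (simp add: scale_sum_left)
      also have "(\<Sum>x\<in>?R - {?x}. relation_coeff d x) = - (relation_coeff d ?x :: 'k)"
        using sum.remove[OF finite_relation_index x, of "relation_coeff d :: _ \<Rightarrow> 'k"]
          sum_relation_coeff[OF n d_pos, where 'k='k] p by (simp add: eq_neg_iff_add_eq_0 add.commute)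
      finally have "\<tau> ?x = scale (relation_coeff d ?x) (mult_op ?A w)" by simp
      then show ?thesis by (simp add: \<tau>_def relation_coeff_def)
    qed
  qed
  obtain \<sigma> where \<sigma>: "bij \<sigma>" "\<sigma> ` ?A = S"
    "f S (hc_gen d S p) = (\<lambda>w. f ?A (hc_gen d ?A p) (map (\<lambda>x. (inv \<sigma> (fst x), snd x)) w))"
    by (rule species_gen_ren[OF f_species less.prems(1) refl less.prems(2), of p])
  show ?case unfolding \<sigma>(3) * mult_op_ren[OF \<sigma>(1)] \<sigma>(2) ..
qed

end

section \<open>The values of X on the generators\<close>

definition X_index :: "nat \<Rightarrow> nat \<Rightarrow> (nat set \<times> nat \<times> (nat set \<times> nat) list \<times> nat set \<times> nat) set" where
  "X_index n p = {(S0, p0, L, Sq, pq). ordered_partition {1..n} (S0 # map fst L @ [Sq]) \<and> card S0 \<ge> 2 \<and>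
            p0 + sum_list (map snd L) + pq + (length L + 1) = p}"

text \<open>The scalar of a nested composite in the value of \<open>X\<close> on \<open>\<mu>\<^sub>n\<^bsup>(k)\<^esup>\<close>; only the last block sees \<open>k\<close>.\<close>

definition X_coeff :: "nat \<Rightarrow> nat \<Rightarrow> nat set \<times> nat \<times> (nat set \<times> nat) list \<times> nat set \<times> nat \<Rightarrow> 'k::comm_ring_1" where
  "X_coeff d k = (\<lambda>(S0, p0, L, Sq, pq). gen_coeff d (card S0) p0
    * (\<Prod>x\<leftarrow>L. gen_coeff d (Suc (card (fst x))) (snd x)) * gen_coeff d (Suc (card Sq)) (k + pq))"

lemma X_indexD:
  assumes "(S0, p0, L, Sq, pq) \<in> X_index n p"
  shows "S0 \<subseteq> {1..n}" "finite S0" "card S0 \<ge> 2" "Sq \<noteq> {}" "Sq \<subseteq> {1..n} - S0"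
    "ordered_partition ({1..n} - Sq - S0) (map fst L)"
    "ordered_partition ({1..n} - S0) (map fst L @ [Sq])"
    "p0 + sum_list (map snd L) + pq + (length L + 1) = p"
    "card S0 + card ({1..n} - Sq - S0) + card Sq = n" "card Sq \<ge> 1"
proof -
  have *: "ordered_partition {1..n} (S0 # map fst L @ [Sq])" "card S0 \<ge> 2"
    "p0 + sum_list (map snd L) + pq + (length L + 1) = p"
    using assms by (auto simp: X_index_def)
  have "{1..n} - S0 - Sq = {1..n} - Sq - S0" by auto
  then show S: "S0 \<subseteq> {1..n}" "Sq \<noteq> {}" "Sq \<subseteq> {1..n} - S0"
    "ordered_partition ({1..n} - Sq - S0) (map fst L)"
    "ordered_partition ({1..n} - S0) (map fst L @ [Sq])"
    using *(1) by (auto simp: ordered_partition_Cons ordered_partition_snoc)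
  show "card S0 \<ge> 2" "p0 + sum_list (map snd L) + pq + (length L + 1) = p" by (fact *)+
  show fin: "finite S0" using S(1) by (rule finite_subset) simp
  have finq: "finite Sq" using S(3) by (rule finite_subset) simp
  show "card Sq \<ge> 1" using finq S(2) by (simp add: Suc_le_eq card_gt_0_iff)
  have "card ({1..n} - Sq - S0) = card ({1..n} - Sq) - card S0"
    using S fin by (intro card_Diff_subset) auto
  moreover have "card ({1..n} - Sq) = n - card Sq"
    using S finq by (subst card_Diff_subset) auto
  moreover have "card S0 \<le> card ({1..n} - Sq)" using S by (intro card_mono) auto
  moreover have "card Sq \<le> n" using card_mono[of "{1..n}" Sq] S by auto
  ultimately show "card S0 + card ({1..n} - Sq - S0) + card Sq = n" by linarith
qed

lemma finite_X_index: "finite (X_index n p)"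
proof (rule finite_subset)
  let ?Ls = "{L. set L \<subseteq> Pow {1..n} \<times> {..p} \<and> length L \<le> p}"
  show "X_index n p \<subseteq> Pow {1..n} \<times> {..p} \<times> ?Ls \<times> Pow {1..n} \<times> {..p}"
  proof
    fix x assume x: "x \<in> X_index n p"
    obtain S0 p0 L Sq pq where xx: "x = (S0, p0, L, Sq, pq)" by (cases x)
    note D = X_indexD[OF x[unfolded xx]]
    have "y \<in> Pow {1..n} \<times> {..p}" if "y \<in> set L" for y
    proof -
      have "snd y \<le> sum_list (map snd L)" using that by (intro member_le_sum_list) auto
      moreover have "fst y \<subseteq> {1..n}"
        using that D(6) unfolding ordered_partition_def by auto
      ultimately show ?thesis using D(8) by (cases y) auto
    qed
    then have "L \<in> ?Ls" using D(8) by auto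
    then show "x \<in> Pow {1..n} \<times> {..p} \<times> ?Ls \<times> Pow {1..n} \<times> {..p}"
      using D(1,5,8) unfolding xx by auto
  qed
  show "finite (Pow {1..n} \<times> {..p} \<times> ?Ls \<times> Pow {1..n} \<times> {..p})"
    by (intro finite_cartesian_product finite_lists_length_le) auto
qed

text \<open>Each factor determines its superscript, and the sum of these superscripts determines \<open>k + p\<close>.\<close>

lemma X_coeff_nonzero:
  assumes x: "(S0, p0, L, Sq, pq) \<in> X_index n p" and d: "d \<ge> 1"
    and nz: "X_coeff d k (S0, p0, L, Sq, pq) \<noteq> (0 :: 'k::comm_ring_1)"
  shows "p0 = d * (card S0 - 1) - 1" "L = map (\<lambda>S. (S, d * card S - 1)) (map fst L)"
    "k + pq = d * card Sq - 1" "k + p = d * (n - 1) - 1"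
proof -
  note D = X_indexD[OF x]
  have *: "gen_coeff d (card S0) p0 \<noteq> (0 :: 'k)"
    "(\<Prod>x\<leftarrow>L. gen_coeff d (Suc (card (fst x))) (snd x)) \<noteq> (0 :: 'k)"
    "gen_coeff d (Suc (card Sq)) (k + pq) \<noteq> (0 :: 'k)"
    using nz by (auto simp: X_coeff_def)
  show p0: "p0 = d * (card S0 - 1) - 1" using *(1) by (simp add: gen_coeff_def split: if_splits)
  show L: "L = map (\<lambda>S. (S, d * card S - 1)) (map fst L)"
    using *(2) unfolding prod_gen_coeff by metis
  show pq: "k + pq = d * card Sq - 1" using *(3) by (simp add: gen_coeff_def split: if_splits)
  have snd_L: "map snd L = map (\<lambda>S. d * card S - 1) (map fst L)"
    by (subst L) (simp add: o_def)
  have "sum_list (map snd L) + length L = d * card ({1..n} - Sq - S0)"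
    unfolding snd_L using ordered_partition_exponents[OF D(6) _ d] by simp
  moreover have "d * (card S0 - 1) \<ge> 1" "d * card Sq \<ge> 1" using D(3,10) d by (simp_all add: Suc_le_eq)
  moreover have "d * (n - 1) = d * (card S0 - 1) + d * card ({1..n} - Sq - S0) + d * card Sq"
  proof -
    have "n - 1 = (card S0 - 1) + card ({1..n} - Sq - S0) + card Sq" using D(3,9) by linarith
    then show ?thesis by (simp only: distrib_left)
  qed
  ultimately show "k + p = d * (n - 1) - 1" using D(8) p0 pq by linarith
qed

text \<open>Since \<open>p = d(n-1)-1-k\<close> and \<open>k \<ge> d(n-|B|)\<close>, it follows that \<open>p < d(|B|-1)\<close>.\<close>

lemma card_surviving_subset:
  assumes "d \<ge> 1" "n \<ge> 2" "k + p = d * (n - 1) - 1" "B \<subseteq> {1..n}" "d * card ({1..n} - B) \<le> k"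
  shows "p div d + 1 < card B"
proof -
  have fin: "finite B" using assms(4) by (rule finite_subset) simp
  have cB: "card ({1..n} - B) = n - card B" "card B \<le> n"
    using assms(4) fin card_mono[OF _ assms(4)] by (simp_all add: card_Diff_subset)
  have pos: "1 * 1 \<le> d * (n - 1)" using assms(1,2) by (intro mult_mono) auto
  then have "d * (n - card B) < d * (n - 1)" using assms(3,5) unfolding cB by linarith
  then have "card B \<ge> 2" using cB assms(2) by auto
  then have "n - 1 = (card B - 1) + (n - card B)" using cB by linarith
  then have "d * (n - 1) = d * (card B - 1) + d * (n - card B)" by (simp only: distrib_left)
  then have "p < d * (card B - 1)" using assms(3,5) pos unfolding cB by linarith
  then have "p div d < card B - 1" by (simp add: less_mult_imp_div_less mult.commute)
  then show ?thesis by linarith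
qed

lemma labels_on: "labels (on B w) = labels w \<inter> B"
  by auto

context graded_comm_alg
begin

text \<open>For a fixed last block \<open>Q\<close> and first block \<open>S\<^sub>0\<close>, the middle blocks form an arbitrary ordered partition of
  the other labels, and their signs add up to the sign in the Moebius transform at \<open>A - Q\<close>, \<open>A = {1..n}\<close>. The condition on
  \<open>Q\<close> says that the superscript \<open>d|Q| - 1 - k\<close>, by which the last operation exceeds \<open>\<mu>\<^bsup>(k)\<^esup>\<close>, is not negative.\<close>

lemma sum_X_coeff:
  fixes G :: "nat set \<Rightarrow> 'v"
  assumes d: "d \<ge> 1" and kp: "k + p = d * (n - 1) - 1"
    and G: "\<And>B. B \<subseteq> {1..n} \<Longrightarrow> card B < 2 \<Longrightarrow> G B = 0"
  shows "(\<Sum>x\<in>X_index n p. scale (X_coeff d k x) (G (fst x)))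
    = - scale ((- 1) ^ n) (\<Sum>B | B \<subseteq> {1..n} \<and> k < d * card ({1..n} - B). moebius G B)"
proof -
  let ?A = "{1..n}"
  define Qs where "Qs = {Q \<in> Pow ?A. k < d * card Q}"
  define J where "J = (SIGMA Q:Qs. SIGMA S0:{S0 \<in> Pow (?A - Q). card S0 \<ge> 2}. {Ss. ordered_partition (?A - Q - S0) Ss})"
  define \<psi> where "\<psi> = (\<lambda>(Q :: nat set, S0 :: nat set, Ss :: nat set list).
    (S0, d * (card S0 - 1) - 1, map (\<lambda>S. (S, d * card S - 1)) Ss, Q, d * card Q - 1 - k))"
  have Jn: "card S0 + card (?A - Q - S0) + card Q = n" if "Q \<subseteq> ?A" "S0 \<subseteq> ?A - Q" for Q S0
  proof -
    have fin: "finite Q" "finite S0" using that by (auto intro: finite_subset)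
    have "card (?A - Q - S0) = card (?A - Q) - card S0" "card (?A - Q) = n - card Q"
      using that fin by (simp_all add: card_Diff_subset)
    moreover have "card S0 \<le> card (?A - Q)" by (rule card_mono[OF _ that(2)]) simp
    moreover have "card Q \<le> card ?A" by (rule card_mono[OF _ that(1)]) simp
    ultimately show ?thesis by simp
  qed
  have sub: "\<psi> ` J \<subseteq> X_index n p"
  proof
    fix x assume "x \<in> \<psi> ` J"
    then obtain Q S0 Ss where x: "x = \<psi> (Q, S0, Ss)" and S: "Q \<subseteq> ?A" "k < d * card Q"
      "S0 \<subseteq> ?A - Q" "card S0 \<ge> 2" "ordered_partition (?A - Q - S0) Ss"
      by (auto simp: J_def Qs_def)
    have "Q \<noteq> {}" using S(2) by auto
    moreover have "S0 \<noteq> {}" using S(4) by auto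
    moreover have "?A - S0 - Q = ?A - Q - S0" by auto
    ultimately have "ordered_partition ?A (S0 # Ss @ [Q])"
      using S by (auto simp: ordered_partition_Cons ordered_partition_snoc)
    moreover have "d * (card S0 - 1) - 1 + sum_list (map (\<lambda>S. d * card S - 1) Ss) + (d * card Q - 1 - k) + (length Ss + 1) = p"
    proof -
      have "sum_list (map (\<lambda>S. d * card S - 1) Ss) + length Ss = d * card (?A - Q - S0)"
        using S d by (intro ordered_partition_exponents) auto
      moreover have "d * (card S0 - 1) \<ge> 1" using S(4) d by (simp add: Suc_le_eq)
      moreover have "d * (n - 1) = d * (card S0 - 1) + d * card (?A - Q - S0) + d * card Q"
      proof -
        have "n - 1 = (card S0 - 1) + card (?A - Q - S0) + card Q" using Jn[OF S(1,3)] S(4) by linarith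
        then show ?thesis by (simp only: distrib_left)
      qed
      ultimately show ?thesis using S(2) kp by linarith
    qed
    ultimately show "x \<in> X_index n p"
      using S(4) by (simp add: x \<psi>_def X_index_def o_def)
  qed
  have zero: "X_coeff d k x = (0 :: 'k)" if "x \<in> X_index n p - \<psi> ` J" for x
  proof (rule ccontr)
    obtain S0 p0 L Sq pq where xx: "x = (S0, p0, L, Sq, pq)" by (cases x)
    have x: "(S0, p0, L, Sq, pq) \<in> X_index n p" using that xx by simp
    assume "X_coeff d k x \<noteq> (0 :: 'k)"
    note nz = X_coeff_nonzero[OF x d this[unfolded xx]] and D = X_indexD[OF x]
    have "d * card Sq \<ge> 1" using D(10) d by (simp add: Suc_le_eq)
    then have "pq = d * card Sq - 1 - k" "k < d * card Sq" using nz(3) by linarith+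
    then have "x = \<psi> (Sq, S0, map fst L)"
      using nz(1,2) by (simp add: xx \<psi>_def)
    moreover have "(Sq, S0, map fst L) \<in> J"
      using D \<open>k < _\<close> by (auto simp: J_def Qs_def)
    ultimately show False using that by blast
  qed
  have inj: "inj_on \<psi> J"
    by (rule inj_on_inverseI[where g = "\<lambda>(S0, p0, L, Q, pq). (Q, S0, map fst L)"]) (auto simp: \<psi>_def o_def)
  have val: "X_coeff d k (\<psi> (Q, S0, Ss)) = (- ((- 1) ^ n) * (- 1) ^ length Ss :: 'k)"
    if "(Q, S0, Ss) \<in> J" for Q S0 Ss
  proof -
    have S: "Q \<subseteq> ?A" "k < d * card Q" "S0 \<subseteq> ?A - Q" "ordered_partition (?A - Q - S0) Ss"
      using that by (auto simp: J_def Qs_def)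
    have "k + (d * card Q - 1 - k) = d * card Q - 1" using S(2) by simp
    then have e: "X_coeff d k (\<psi> (Q, S0, Ss))
       = ((- 1) ^ card S0 * (- 1) ^ (sum_list (map card Ss) + length Ss) * (- 1) ^ Suc (card Q) :: 'k)"
      unfolding X_coeff_def \<psi>_def prod.case prod_gen_coeff by (simp add: gen_coeff_def o_def)
    have "sum_list (map card Ss) = card (?A - Q - S0)"
      using S d by (intro ordered_partition_card) auto
    then have exponent: "card S0 + (sum_list (map card Ss) + length Ss) + Suc (card Q) = Suc (n + length Ss)"
      using Jn[OF S(1,3)] by linarith
    show ?thesis unfolding e unfolding power_add[symmetric] exponent by (simp add: power_add)
  qed
  have fin: "finite Qs" by (simp add: Qs_def)
  have "(\<Sum>x\<in>X_index n p. scale (X_coeff d k x) (G (fst x)))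
     = (\<Sum>x\<in>\<psi> ` J. scale (X_coeff d k x) (G (fst x)))"
    using zero by (intro sum.mono_neutral_right finite_X_index sub) auto
  also have "\<dots> = (\<Sum>(Q, S0, Ss)\<in>J. scale (- ((- 1) ^ n) * (- 1) ^ length Ss) (G S0))"
    unfolding sum.reindex[OF inj] o_def
  proof (rule sum.cong[OF refl])
    fix z assume "z \<in> J"
    then show "scale (X_coeff d k (\<psi> z)) (G (fst (\<psi> z)))
       = (case z of (Q, S0, Ss) \<Rightarrow> scale (- ((- 1) ^ n) * (- 1) ^ length Ss) (G S0))"
      using val by (cases z) (simp add: \<psi>_def)
  qed
  also have "\<dots> = (\<Sum>Q\<in>Qs. \<Sum>S0\<in>{S0 \<in> Pow (?A - Q). card S0 \<ge> 2}.
      \<Sum>Ss | ordered_partition (?A - Q - S0) Ss. scale (- ((- 1) ^ n) * (- 1) ^ length Ss) (G S0))"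
    unfolding J_def using fin
    by (simp add: sum.Sigma finite_ordered_partitions case_prod_beta')
  also have "\<dots> = (\<Sum>Q\<in>Qs. \<Sum>S0\<in>{S0 \<in> Pow (?A - Q). card S0 \<ge> 2}.
      scale (- ((- 1) ^ n)) (scale ((- 1) ^ card (?A - Q - S0)) (G S0)))"
  proof (intro sum.cong refl)
    fix Q S0
    have "(\<Sum>Ss | ordered_partition (?A - Q - S0) Ss. scale (- ((- 1) ^ n) * (- 1) ^ length Ss) (G S0))
       = scale (- ((- 1) ^ n) * (\<Sum>Ss | ordered_partition (?A - Q - S0) Ss. (- 1) ^ length Ss)) (G S0)"
      by (simp only: scale_sum_left sum_distrib_left)
    then show "(\<Sum>Ss | ordered_partition (?A - Q - S0) Ss. scale (- ((- 1) ^ n) * (- 1) ^ length Ss) (G S0))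
       = scale (- ((- 1) ^ n)) (scale ((- 1) ^ card (?A - Q - S0)) (G S0))"
      by (simp only: sum_ordered_partitions_sign finite_Diff finite_atLeastAtMost scale_scale)
  qed
  also have "\<dots> = (\<Sum>Q\<in>Qs. scale (- ((- 1) ^ n)) (moebius G (?A - Q)))"
  proof (rule sum.cong[OF refl])
    fix Q assume "Q \<in> Qs"
    have "(\<Sum>S0\<in>{S0 \<in> Pow (?A - Q). card S0 \<ge> 2}. scale ((- 1) ^ card (?A - Q - S0)) (G S0))
       = (\<Sum>S0\<in>Pow (?A - Q). scale ((- 1) ^ card (?A - Q - S0)) (G S0))"
    proof (rule sum.mono_neutral_left)
      show "\<forall>S0\<in>Pow (?A - Q) - {S0 \<in> Pow (?A - Q). card S0 \<ge> 2}. scale ((- 1) ^ card (?A - Q - S0)) (G S0) = 0"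
      proof
        fix S0 assume "S0 \<in> Pow (?A - Q) - {S0 \<in> Pow (?A - Q). card S0 \<ge> 2}"
        then have "G S0 = 0" by (intro G) auto
        then show "scale ((- 1) ^ card (?A - Q - S0)) (G S0) = 0" by simp
      qed
    qed auto
    then show "(\<Sum>S0\<in>{S0 \<in> Pow (?A - Q). card S0 \<ge> 2}.
        scale (- ((- 1) ^ n)) (scale ((- 1) ^ card (?A - Q - S0)) (G S0)))
      = scale (- ((- 1) ^ n)) (moebius G (?A - Q))"
      unfolding scale_sum_right[symmetric] moebius_def by simp
  qed
  also have "\<dots> = scale (- ((- 1) ^ n)) (\<Sum>Q\<in>Qs. moebius G (?A - Q))"
    by (simp only: scale_sum_right)
  also have "(\<Sum>Q\<in>Qs. moebius G (?A - Q)) = (\<Sum>B | B \<subseteq> ?A \<and> k < d * card (?A - B). moebius G B)"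
    by (rule sum.reindex_bij_witness[where i="\<lambda>B. ?A - B" and j="\<lambda>Q. ?A - Q"])
      (auto simp: Qs_def double_diff)
  finally show ?thesis by (simp only: scale_minus_left)
qed

text \<open>By Moebius inversion \<open>G {1..n}\<close> is the sum of all Moebius transforms, of which \<open>sum_X_coeff\<close> cancels those
  at complements of large sets.\<close>

lemma X_sum_eq:
  fixes G :: "nat set \<Rightarrow> 'v"
  assumes d: "d \<ge> 1" and kp: "k + p = d * (n - 1) - 1"
    and G: "\<And>B. B \<subseteq> {1..n} \<Longrightarrow> card B < 2 \<Longrightarrow> G B = 0"
  shows "scale (gen_coeff d n (k + p)) (G {1..n}) + (\<Sum>x\<in>X_index n p. scale (X_coeff d k x) (G (fst x)))
    = scale ((- 1) ^ n) (\<Sum>B | B \<subseteq> {1..n} \<and> d * card ({1..n} - B) \<le> k. moebius G B)"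
proof -
  let ?A = "{1..n}"
  let ?X = "{B. B \<subseteq> ?A \<and> k < d * card (?A - B)}" and ?Y = "{B. B \<subseteq> ?A \<and> d * card (?A - B) \<le> k}"
  have "G ?A = (\<Sum>B\<in>Pow ?A. moebius G B)" by (rule sum_moebius[symmetric]) simp
  also have "\<dots> = (\<Sum>B\<in>?X \<union> ?Y. moebius G B)"
    by (rule sum.cong) auto
  also have "\<dots> = (\<Sum>B\<in>?X. moebius G B) + (\<Sum>B\<in>?Y. moebius G B)"
    by (rule sum.union_disjoint) auto
  finally have "G ?A = (\<Sum>B\<in>?X. moebius G B) + (\<Sum>B\<in>?Y. moebius G B)" .
  moreover have "gen_coeff d n (k + p) = ((- 1) ^ n :: 'k)" using kp by (simp add: gen_coeff_def)
  moreover have "(\<Sum>x\<in>X_index n p. scale (X_coeff d k x) (G (fst x)))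
    = - scale ((- 1) ^ n) (\<Sum>B\<in>?X. moebius G B)"
    by (rule sum_X_coeff[OF d kp]) (rule G)
  moreover have "scale c (x + y) + - scale c x = scale c y" for c x y
    by (simp add: scale_right_distrib)
  ultimately show ?thesis by (simp only:)
qed

end

context commutative_rep
begin

text \<open>By \<open>nested_mult_op\<close>, each nested composite collapses to the bracket of the first block times all other
  letters, with the scalar \<open>X_coeff\<close>.\<close>

lemma X_value_eq:
  assumes D: "homogeneous_operator scale V e D" and n: "n \<ge> 2"
  shows "X_value d scale V f er (end_unary V D) p n k w
    = (if is_word V {1..n} w
       then scale (gen_coeff d n (k + p)) (reduced_term D (with_degrees w) {1..n})
         + (\<Sum>x\<in>X_index n p. scale (X_coeff d k x) (reduced_term D (with_degrees w) (fst x)))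
       else 0)"
proof -
  let ?A = "{1..n}" and ?w = "with_degrees w"
  define br where "br S w = (if is_word V S w then reduced_term D (with_degrees w) S else 0)" for S w
  have bracket: "end_bracket scale V er (gen_deg d (card S) q) S (end_unary V D) (f S (hc_gen d S q))
     = (\<lambda>w. scale (gen_coeff d (card S) q) (br S w))" if "finite S" "card S \<ge> 2" for S q
  proof -
    have "S \<noteq> {}" using that by auto
    moreover have "even (gen_deg d (card S) q)" by (simp add: gen_deg_def)
    ultimately show ?thesis
      unfolding f_gen[OF that] br_def using that by (intro end_bracket_mult_op[OF D])
  qed
  have hom: "homogeneous V (br S w)" if "is_word V S w" for S w
    using reduced_term_in_V[OF D is_word_typed[OF that], of S] is_word_labels[OF that] that
    by (auto simp: br_def homogeneous_def)
  have summand: "nested End S0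
      (end_bracket scale V er (gen_deg d (card S0) p0) S0 (end_unary V D) (f S0 (hc_gen d S0 p0)))
      (map (\<lambda>(S, j). (S, f (insert 0 S) (hc_gen d (insert 0 S) j))) L
        @ [(Sq, f (insert 0 Sq) (hc_gen d (insert 0 Sq) (k + pq)))]) w
    = (if is_word V ?A w then scale (X_coeff d k (S0, p0, L, Sq, pq)) (reduced_term D ?w S0) else 0)"
    if x: "(S0, p0, L, Sq, pq) \<in> X_index n p" for S0 p0 L Sq pq
  proof -
    note S = X_indexD[OF x]
    let ?L = "L @ [(Sq, k + pq)]"
    have "map fst ?L = map fst L @ [Sq]" by simp
    then have b: "blocks S0 (map fst ?L)" "\<Union>(set (map fst ?L)) = ?A - S0"
      using ordered_partition_blocks[OF S(7), of S0] by auto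
    have gen: "f (insert 0 (fst y)) (hc_gen d (insert 0 (fst y)) (snd y))
       = (\<lambda>w. scale (gen_coeff d (Suc (card (fst y))) (snd y)) (mult_op (insert 0 (fst y)) w))"
      if "y \<in> set ?L" for y
    proof -
      have y: "fst y \<noteq> {}" "fst y \<subseteq> ?A - S0"
        using that S(7) unfolding ordered_partition_def by auto
      then have fy: "finite (fst y)" "0 \<notin> fst y" by (auto dest: finite_subset)
      have "card (insert 0 (fst y)) = Suc (card (fst y))" using fy by simp
      moreover have "card (fst y) \<ge> 1" using y fy by (simp add: Suc_le_eq card_gt_0_iff)
      ultimately show ?thesis using f_gen[of "insert 0 (fst y)"] fy by simp
    qed
    define c0 :: 'k where "c0 = gen_coeff d (card S0) p0"
    have h: "homogeneous V (scale c0 (br S0 v))" if "is_word V S0 v" for v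
      using that by (intro homogeneous_scale hom)
    have z: "scale c0 (br S0 v) = 0" if "\<not> is_word V S0 v" for v
      using that by (simp add: br_def)
    have "map (\<lambda>(S, j). (S, f (insert 0 S) (hc_gen d (insert 0 S) j))) L
        @ [(Sq, f (insert 0 Sq) (hc_gen d (insert 0 Sq) (k + pq)))]
      = map (\<lambda>x. (fst x, f (insert 0 (fst x)) (hc_gen d (insert 0 (fst x)) (snd x)))) ?L"
      by (simp add: case_prod_beta')
    also have "\<dots> = map (\<lambda>x. (fst x, \<lambda>w. scale (gen_coeff d (Suc (card (fst x))) (snd x)) (mult_op (insert 0 (fst x)) w))) ?L"
      by (rule map_cong[OF refl]) (simp add: gen)
    finally have L: "map (\<lambda>(S, j). (S, f (insert 0 S) (hc_gen d (insert 0 S) j))) L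
        @ [(Sq, f (insert 0 Sq) (hc_gen d (insert 0 Sq) (k + pq)))]
      = map (\<lambda>x. (fst x, \<lambda>w. scale (gen_coeff d (Suc (card (fst x))) (snd x)) (mult_op (insert 0 (fst x)) w))) ?L" .
    have "S0 \<union> (?A - S0) = ?A" using S(1) by auto
    then have "nested End S0
      (end_bracket scale V er (gen_deg d (card S0) p0) S0 (end_unary V D) (f S0 (hc_gen d S0 p0)))
      (map (\<lambda>(S, j). (S, f (insert 0 S) (hc_gen d (insert 0 S) j))) L
        @ [(Sq, f (insert 0 Sq) (hc_gen d (insert 0 Sq) (k + pq)))]) w
      = scale (\<Prod>x\<leftarrow>?L. gen_coeff d (Suc (card (fst x))) (snd x)) (extend_op S0 ?A (\<lambda>w. scale c0 (br S0 w)) w)"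
      using fun_cong[OF nested_mult_op[where c = "\<lambda>x. gen_coeff d (Suc (card (fst x))) (snd x)", OF b(1) h z], where x = w]
      unfolding L bracket[OF S(2,3)] b(2) c0_def by simp
    also have "extend_op S0 ?A (\<lambda>w. scale c0 (br S0 w)) w
      = scale c0 (if is_word V ?A w then reduced_term D ?w S0 else 0)"
    proof (cases "is_word V ?A w")
      case True
      then show ?thesis
        using is_word_on[OF True S(1)] extend_reduced_term[OF is_word_typed[OF True] order_refl, of S0 D]
        by (simp add: extend_op_def br_def extend_scale on_with_degrees)
    qed (simp add: extend_op_def)
    also have "(\<Prod>x\<leftarrow>?L. gen_coeff d (Suc (card (fst x))) (snd x))
        = (\<Prod>x\<leftarrow>L. gen_coeff d (Suc (card (fst x))) (snd x)) * (gen_coeff d (Suc (card Sq)) (k + pq) :: 'k)"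
      by simp
    finally show ?thesis
      by (simp add: X_coeff_def c0_def mult_ac)
  qed
  have "X_value d scale V f er (end_unary V D) p n k w
    = scale (gen_coeff d n (k + p)) (br ?A w)
      + (\<Sum>x\<in>X_index n p. if is_word V ?A w then scale (X_coeff d k x) (reduced_term D ?w (fst x)) else 0)"
    unfolding X_value_def
  proof (rule arg_cong2[where f = "(+)"])
    show "end_bracket scale V er (gen_deg d n (k + p)) ?A (end_unary V D) (f ?A (hc_gen d ?A (k + p))) w
        = scale (gen_coeff d n (k + p)) (br ?A w)"
      using bracket[of ?A "k + p"] n by simp
    show "(\<Sum>(S0, p0, L, Sq, pq) \<in> {(S0, p0, L :: (nat set \<times> nat) list, Sq, pq).
            ordered_partition {1..n} (S0 # map fst L @ [Sq]) \<and> card S0 \<ge> 2 \<and>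
            p0 + sum_list (map snd L) + pq + (length L + 1) = p}.
          nested (End_operad scale V) S0
            (end_bracket scale V er (gen_deg d (card S0) p0) S0 (end_unary V D) (f S0 (hc_gen d S0 p0)))
            (map (\<lambda>(S, j). (S, f (insert 0 S) (hc_gen d (insert 0 S) j))) L
              @ [(Sq, f (insert 0 Sq) (hc_gen d (insert 0 Sq) (k + pq)))]) w)
      = (\<Sum>x\<in>X_index n p. if is_word V ?A w then scale (X_coeff d k x) (reduced_term D ?w (fst x)) else 0)"
      unfolding X_index_def[symmetric]
    proof (rule sum.cong[OF refl])
      fix x assume "x \<in> X_index n p"
      then show "(case x of (S0, p0, L, Sq, pq) \<Rightarrow> nested (End_operad scale V) S0
            (end_bracket scale V er (gen_deg d (card S0) p0) S0 (end_unary V D) (f S0 (hc_gen d S0 p0)))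
            (map (\<lambda>(S, j). (S, f (insert 0 S) (hc_gen d (insert 0 S) j))) L
              @ [(Sq, f (insert 0 Sq) (hc_gen d (insert 0 Sq) (k + pq)))]) w)
        = (if is_word V ?A w then scale (X_coeff d k x) (reduced_term D ?w (fst x)) else 0)"
        using summand by (cases x) simp
    qed
  qed
  then show ?thesis by (simp add: br_def)
qed

lemma X_value_off_degree:
  assumes D: "homogeneous_operator scale V e D" and n: "n \<ge> 2" and kp: "k + p \<noteq> d * (n - 1) - 1"
  shows "X_value d scale V f er (end_unary V D) p n k w = 0"
proof -
  have "X_coeff d k x = (0 :: 'k)" if "x \<in> X_index n p" for x
  proof (rule ccontr)
    assume nz: "X_coeff d k x \<noteq> (0 :: 'k)"
    obtain S0 p0 L Sq pq where xx: "x = (S0, p0, L, Sq, pq)" by (cases x)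
    show False using X_coeff_nonzero(4)[OF that[unfolded xx] d_pos nz[unfolded xx]] kp by simp
  qed
  then show ?thesis
    unfolding X_value_eq[OF D n] using kp by (simp add: gen_coeff_def)
qed

lemma X_value_brace_sum:
  assumes D: "homogeneous_operator scale V e D" and n: "n \<ge> 2" and kp: "k + p = d * (n - 1) - 1"
    and w: "is_word V {1..n} w"
  shows "X_value d scale V f er (end_unary V D) p n k w
    = scale ((- 1) ^ n)
        (\<Sum>B | B \<subseteq> {1..n} \<and> d * card ({1..n} - B) \<le> k. moebius (op_term D (with_degrees w)) B)"
proof -
  let ?A = "{1..n}" and ?w = "with_degrees w"
  let ?G = "reduced_term D ?w"
  have G: "?G B = 0" if "B \<subseteq> ?A" "card B < 2" for B
  proof -
    have "finite B" using that(1) by (rule finite_subset) simp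
    moreover have "card B = 0 \<or> card B = 1" using that(2) by linarith
    ultimately consider "B = {}" | i where "B = {i}" by (auto simp: card_1_singleton_iff)
    then show ?thesis by cases (simp_all add: reduced_term_def)
  qed
  have "moebius ?G B = moebius (op_term D ?w) B" if "B \<subseteq> ?A" "d * card (?A - B) \<le> k" for B
  proof -
    have "finite B" using that(1) by (rule finite_subset) simp
    moreover have "card B \<ge> 2" using card_surviving_subset[OF d_pos n kp that] by linarith
    ultimately show ?thesis
      using moebius_minus_linear_part[of B "op_term D ?w"] unfolding reduced_term_def[abs_def] by simp
  qed
  then show ?thesis
    unfolding X_value_eq[OF D n] using w X_sum_eq[where G = ?G, OF d_pos kp G] by simp
qed

text \<open>All surviving sets have more than \<open>p div d + 1\<close> elements, so their braces vanish.\<close>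

lemma X_value_zero:
  assumes D: "homogeneous_operator scale V e D" and n: "n \<ge> 2"
    and order: "diff_order_at_most scale V m D (p div d + 1)"
  shows "X_value d scale V f er (end_unary V D) p n k w = 0"
proof (cases "k + p = d * (n - 1) - 1 \<and> is_word V {1..n} w")
  case False
  then show ?thesis using X_value_off_degree[OF D n] X_value_eq[OF D n, of er p k w] by auto
next
  case True
  then have kp: "k + p = d * (n - 1) - 1" and w: "is_word V {1..n} w" by auto
  let ?A = "{1..n}" and ?w = "with_degrees w"
  have "moebius (op_term D ?w) B = 0" if B: "B \<subseteq> ?A" "d * card (?A - B) \<le> k" for B
  proof -
    have lt: "p div d + 1 < card B" by (rule card_surviving_subset[OF d_pos n kp B])
    let ?v = "on B ?w"
    have typed: "typed ?w" by (rule is_word_typed[OF w])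
    have "labels ?w = ?A" using is_word_labels[OF w] by (simp only: labels_with_degrees)
    then have lab: "labels ?v = B" using labels_on[of B ?w] B(1) by blast
    have dist: "distinct (map fst ?v)"
    proof (rule distinct_map_filter)
      show "distinct (map fst ?w)" using w by (simp only: with_degrees_simps is_word_def)
    qed
    have "length ?v = card B" using distinct_card[OF dist] lab by simp
    then have "moebius (op_term D ?v) B = 0"
      using higher_braces_vanish[OF order homogeneous_operator_linear(3)[OF D] typed_filter[OF typed] dist] lt
      unfolding lab by simp
    then show ?thesis using extend_moebius_op_term[OF typed, of B D] by simp
  qed
  then show ?thesis unfolding X_value_brace_sum[OF D n kp w] by simp
qed

text \<open>The arity \<open>n = p div d + 2\<close> is the length of the brace that has to vanish, and \<open>k = d - 1 - p mod d\<close>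
  is then the superscript for which \<open>p\<close> contributes. As \<open>k < d\<close>, no proper subset of \<open>{1..n}\<close> survives.\<close>

lemma diff_order_from_X_value:
  assumes D: "homogeneous_operator scale V e D"
    and zero: "\<And>n k w. n \<ge> 2 \<Longrightarrow> k + p = d * (n - 1) - 1 \<Longrightarrow> X_value d scale V f er (end_unary V D) p n k w = 0"
  shows "diff_order_at_most scale V m D (p div d + 1)"
  unfolding diff_order_at_most_def
proof (intro allI impI)
  fix xs assume xs: "length xs = p div d + 1 + 1 \<and> (\<forall>a\<in>set xs. homogeneous V a)"
  define n where "n = p div d + 2"
  define k where "k = d - 1 - p mod d"
  define w where "w = zip [1..<n + 1] xs"
  let ?A = "{1..n}" and ?w = "with_degrees w"
  have n: "n \<ge> 2" by (simp add: n_def)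
  have md: "p mod d < d" using d_pos by simp
  have "d * (n - 1) = d * (p div d) + d" by (simp add: n_def distrib_left)
  moreover have "d * (p div d) + p mod d = p" by simp
  ultimately have kp: "k + p = d * (n - 1) - 1" and k: "k < d" using md unfolding k_def by linarith+
  have len: "length xs = n" using xs by (simp add: n_def)
  have maps: "map fst w = [1..<n + 1]" "map snd w = xs" using len by (simp_all add: w_def)
  have word: "is_word V ?A w"
  proof -
    have "snd ` set w = set xs" using maps(2) by (metis list.set_map)
    then have "\<forall>x\<in>set w. homogeneous V (snd x)" using xs by (metis imageI)
    then show ?thesis unfolding is_word_def maps by auto
  qed
  have typed: "typed ?w" by (rule is_word_typed[OF word])
  have "{B. B \<subseteq> ?A \<and> d * card (?A - B) \<le> k} = {?A}"
  proof -
    have "B = ?A" if "B \<subseteq> ?A" "d * card (?A - B) \<le> k" for B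
    proof -
      have "card (?A - B) = 0"
      proof (rule ccontr)
        assume "card (?A - B) \<noteq> 0"
        then have "1 \<le> card (?A - B)" by linarith
        then have "d * 1 \<le> d * card (?A - B)" by (rule mult_le_mono2)
        then show False using that(2) k by linarith
      qed
      then have "?A - B = {}" by (simp only: card_0_eq finite_Diff finite_atLeastAtMost)
      then show ?thesis using that(1) by blast
    qed
    then have "{B. B \<subseteq> ?A \<and> d * card (?A - B) \<le> k} \<subseteq> {?A}" by blast
    moreover have "{?A} \<subseteq> {B. B \<subseteq> ?A \<and> d * card (?A - B) \<le> k}" by simp
    ultimately show ?thesis by (rule subset_antisym)
  qed
  then have "scale ((- 1) ^ n) (moebius (op_term D ?w) ?A) = 0"
    using zero[OF n kp, of w] X_value_brace_sum[OF D n kp word, of er] by simp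
  then have "moebius (op_term D ?w) ?A = 0" by simp
  moreover have "koszul_brace scale V m D (elts ?w) = moebius (op_term D ?w) (labels ?w)"
    using typed word
    by (intro koszul_brace_eq_moebius homogeneous_operator_linear(3)[OF D]) (simp_all add: is_word_def)
  ultimately show "koszul_brace scale V m D xs = 0"
    using is_word_labels[OF word] maps(2) by simp
qed

lemma zero_derivation: "operad_derivation (HyperCom d) End f \<delta> (\<lambda>S u w. 0)"
proof -
  have zero: "(\<lambda>w. 0) \<in> end_carr scale V S e" for S e
    by (simp add: end_carr_def subspace_0[OF V_subspace])
  have "end_comp scale V S T s (f S u) (\<lambda>w. 0) = (\<lambda>w. 0)"
    if "finite S" "u \<in> op_carr (HyperCom d) S e" for S T s u e
    using species_mapD(1)[OF f_species that] by (intro end_comp_zero_right) simp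
  then show ?thesis
    unfolding operad_derivation_def species_map_def
    by (simp add: zero end_comp_zero_left composable_def)
qed

end

theorem proposition6p6:
  fixes d :: nat
    and scale :: "'k::field_char_0 \<Rightarrow> 'v::ab_group_add \<Rightarrow> 'v"
    and V :: "int \<Rightarrow> 'v set"
    and m :: "'v \<Rightarrow> 'v \<Rightarrow> 'v"
    and \<Delta> :: "nat \<Rightarrow> 'v \<Rightarrow> 'v"
    and f :: "nat set \<Rightarrow> (nat hctree \<Rightarrow>\<^sub>0 'k) set \<Rightarrow> (nat \<times> 'v) list \<Rightarrow> 'v"
  assumes "d \<ge> 1"
    and "graded_comm_algebra scale V m"
    and "homotopy_circle_action scale V \<Delta>"
    and "operad_hom (HyperCom d) (End_operad scale V) f"
    and "f {1, 2} (hc_gen d {1, 2} (d - 1)) = end_product V m"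
    and "\<And>n k. n \<ge> 2 \<Longrightarrow> k \<noteq> d * (n - 1) - 1 \<Longrightarrow> f {1..n} (hc_gen d {1..n} k) = (\<lambda>w. 0)"
  shows "homotopical_diff_order d scale V m \<Delta> \<longleftrightarrow>
    X_derivations d scale V f \<Delta> = {\<lambda>S u w. 0}"
proof -
  interpret graded_comm_alg scale V m by standard (rule assms(2))
  interpret commutative_rep scale V m d f by standard (use assms in auto)
  have D: "homogeneous_operator scale V (2 * int p - 1) (\<Delta> p)" for p
    using assms(3) by (simp add: homotopy_circle_action_def)
  define X where "X p = X_value d scale V f (2 * int p - 1) (end_unary V (\<Delta> p)) p" for p
  have X_off: "X p n k w = 0" if "n \<ge> 2" "k + p \<noteq> d * (n - 1) - 1" for p n k w
    unfolding X_def by (rule X_value_off_degree[OF D that])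
  have Sum_X: "Sum_any (\<lambda>p. X p n k w) = X p n k w" if "n \<ge> 2" "k + p = d * (n - 1) - 1" for p n k w
  proof -
    have "Sum_any (\<lambda>p. X p n k w) = (\<Sum>p\<in>{p}. X p n k w)"
    proof (rule Sum_any.expand_superset)
      have "X q n k w = 0" if "q \<noteq> p" for q
        using \<open>k + p = d * (n - 1) - 1\<close> that by (intro X_off \<open>n \<ge> 2\<close>) linarith
      then show "{a. X a n k w \<noteq> 0} \<subseteq> {p}" by blast
    qed simp
    then show ?thesis by simp
  qed
  show ?thesis
  proof
    assume "homotopical_diff_order d scale V m \<Delta>"
    then have "X p n k w = 0" if "n \<ge> 2" for p n k w
      unfolding X_def using that
      by (intro X_value_zero[OF D]) (simp_all add: homotopical_diff_order_def)
    then have gen_values: "(\<lambda>w. Sum_any (\<lambda>p. X p n k w)) = (\<lambda>w. 0)" if "n \<ge> 2" for n k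
      using that by simp
    have "(\<lambda>S u w. 0) \<in> X_derivations d scale V f \<Delta>"
      using gen_values zero_derivation unfolding X_derivations_def X_def by simp
    moreover have "E = (\<lambda>S u w. 0)" if E: "E \<in> X_derivations d scale V f \<Delta>" for E
    proof (intro ext)
      fix S u w
      have der: "operad_derivation (HyperCom d) End f (- 1) E"
        and off: "infinite S \<or> (\<forall>e. u \<notin> op_carr (HyperCom d) S e) \<Longrightarrow> E S u = (\<lambda>w. 0)"
        and gen: "\<And>n k. n \<ge> 2 \<Longrightarrow> E {1..n} (hc_gen d {1..n} k) = (\<lambda>w. 0)"
        using E gen_values unfolding X_derivations_def X_def by auto
      show "E S u w = 0"
      proof (cases "infinite S \<or> (\<forall>e. u \<notin> op_carr (HyperCom d) S e)")
        case True
        then show ?thesis using off by simp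
      next
        case False
        then obtain e where "finite S" "u \<in> op_carr (HyperCom d) S e" by blast
        from derivation_zero[OF f_hom der gen this] show ?thesis by simp
      qed
    qed
    ultimately show "X_derivations d scale V f \<Delta> = {\<lambda>S u w. 0}" by blast
  next
    assume "X_derivations d scale V f \<Delta> = {\<lambda>S u w. 0}"
    then have "(\<lambda>S u w. 0) \<in> X_derivations d scale V f \<Delta>" by simp
    then have "(\<lambda>w. Sum_any (\<lambda>p. X p n k w)) = (\<lambda>w. 0)" if "n \<ge> 2" for n k
      using that unfolding X_derivations_def X_def by simp
    then have "X p n k w = 0" if "n \<ge> 2" "k + p = d * (n - 1) - 1" for p n k w
      using Sum_X[OF that, of w] that(1) by (metis (no_types, lifting))
    then show "homotopical_diff_order d scale V m \<Delta>"
      unfolding homotopical_diff_order_def X_def by (intro allI diff_order_from_X_value[OF D])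
  qed
qed

end
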